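(* Let $(X,Y)$ be a bivariate normal random vector with mean vector $(\mu_X,\mu_Y)\in\mathbb{R}^2$, variances $(\sigma_X^2,\sigma_Y^2)$ with $\sigma_X,\sigma_Y>0$, and correlation coefficient $\rho\in(-1,1)$, and let $Z=XY$. For any integer $m\geq1$, we have the decomposition $Z=_d\sum_{i=1}^m U_{i,m}$ (equality in distribution), where $U_{1,m},\ldots,U_{m,m}$ are independent and identically distributed random variables with probability density function \begin{align*} f_{U_{1,m}}(x)&=\frac{(1-\rho^2)^{q/2-1}}{2^{q-1}\sigma_X\sigma_Y}\exp\bigg(-\frac{q}{2(1-\rho^2)}\bigg(\frac{\mu_X^2}{\sigma_X^2}+\frac{\mu_Y^2}{\sigma_Y^2}-\frac{2\rho\mu_X\mu_Y}{\sigma_X\sigma_Y}\bigg)-\frac{|x|}{\sigma_X\sigma_Y(1+\rho\,\mathrm{sgn}(x))}\bigg)\\ &\quad\times\sum_{k=0}^\infty\sum_{j=0}^k\frac{(q/8)^k}{k!\,\Gamma(q/2+a_{j,k}(x))}\binom{k}{j} \bigg(\frac{1+\rho}{1-\rho}\bigg)^j\bigg(\frac{\mu_X}{\sigma_X}-\frac{\mu_Y}{\sigma_Y}\bigg)^{2j} \bigg(\frac{1-\rho}{1+\rho}\bigg)^{k-j}\\ &\quad\times \bigg(\frac{\mu_X}{\sigma_X}+\frac{\mu_Y}{\sigma_Y}\bigg)^{2k-2j} U\bigg(1-\frac{q}{2}-a_{j,k}(x),\,2-q-k,\,\frac{2|x|}{\sigma_X\sigma_Y(1-\rho^2)}\bigg),\quad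 x\in\mathbb{R}, \end{align*} where $q=1/m$. In particular, the distribution of $Z$ is infinitely divisible.
   Context: $\mathrm{sgn}(x)=1$ for $x>0$, $\mathrm{sgn}(0)=0$, $\mathrm{sgn}(x)=-1$ for $x<0$. For integers $0\le j\le k$, $a_{j,k}(x)=k-j$ if $x\geq0$ and $a_{j,k}(x)=j$ if $x<0$. The convention $0^0=1$ is used. $U(a,b,x)$ is the (Tricomi) confluent hypergeometric function of the second kind (not to be confused with the random variables $U_{i,m}$): for $x>0$ and $b\notin\mathbb{Z}$, $$U(a,b,x)=\frac{\Gamma(b-1)}{\Gamma(a)}x^{1-b}{}_1F_1(a-b+1;2-b;x)+\frac{\Gamma(1-b)}{\Gamma(a-b+1)}{}_1F_1(a;b;x),$$ where $1/\Gamma$ is taken to be $0$ at the poles of $\Gamma$ and ${}_1F_1(a;b;x)=\sum_{j\ge0}\frac{(a)_j}{(b)_j}\frac{x^j}{j!}$ with $(u)_j=u(u+1)\cdots(u+j-1)$; for $b\in\mathbb{Z}$, $U(a,b,x)=\lim_{\beta\to b}U(a,\beta,x)$. The value $U(a,b,0)$ means $\lim_{x\to0^+}U(a,b,x)$, possibly $+\infty$ (the value of the density at the single point $x=0$ is immaterial). A distribution is infinitely divisible if for every integer $m\ge1$ it is the distribution of a sum of $m$ independent and identically distributed random variables. *)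

theory Defs
  imports "HOL-Probability.Probability"
begin

definition bivariate_normal_density ::
  "real \<Rightarrow> real \<Rightarrow> real \<Rightarrow> real \<Rightarrow> real \<Rightarrow> real \<times> real \<Rightarrow> real" where
  "bivariate_normal_density \<mu>\<^sub>X \<mu>\<^sub>Y \<sigma>\<^sub>X \<sigma>\<^sub>Y \<rho> = (\<lambda>(x, y).
     1 / (2 * pi * \<sigma>\<^sub>X * \<sigma>\<^sub>Y * sqrt (1 - \<rho>\<^sup>2)) *
     exp (- 1 / (2 * (1 - \<rho>\<^sup>2)) *
       (((x - \<mu>\<^sub>X) / \<sigma>\<^sub>X)\<^sup>2 - 2 * \<rho> * ((x - \<mu>\<^sub>X) / \<sigma>\<^sub>X) * ((y - \<mu>\<^sub>Y) / \<sigma>\<^sub>Y)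
         + ((y - \<mu>\<^sub>Y) / \<sigma>\<^sub>Y)\<^sup>2)))"

definition kummer_M :: "real \<Rightarrow> real \<Rightarrow> real \<Rightarrow> real" where
  "kummer_M a b x = (\<Sum>j. pochhammer a j / pochhammer b j * (x ^ j / fact j))"

(* The reciprocal Gamma function rGamma is 0 at the poles of Gamma. *)
definition tricomi_U_nonint :: "real \<Rightarrow> real \<Rightarrow> real \<Rightarrow> real" where
  "tricomi_U_nonint a b x =
     Gamma (b - 1) * rGamma a * x powr (1 - b) * kummer_M (a - b + 1) (2 - b) x
     + Gamma (1 - b) * rGamma (a - b + 1) * kummer_M a b x"

(* Meaningful for x > 0. *)
definition tricomi_U :: "real \<Rightarrow> real \<Rightarrow> real \<Rightarrow> real" where
  "tricomi_U a b x =
     (if b \<in> \<int> then Lim (at b) (\<lambda>\<beta>. tricomi_U_nonint a \<beta> x) else tricomi_U_nonint a b x)"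

(* Extension to x = 0 by the right limit, which may be infinite. *)
definition tricomi_U_ext :: "real \<Rightarrow> real \<Rightarrow> real \<Rightarrow> ereal" where
  "tricomi_U_ext a b x =
     (if x = 0 then Lim (at_right 0) (\<lambda>t. ereal (tricomi_U a b t)) else ereal (tricomi_U a b x))"

definition a_index :: "nat \<Rightarrow> nat \<Rightarrow> real \<Rightarrow> nat" where
  "a_index j k x = (if x \<ge> 0 then k - j else j)"

(* The values are extended reals, and the series is taken there, because the function is
   infinite at x = 0. *)
definition summand_density ::
  "real \<Rightarrow> real \<Rightarrow> real \<Rightarrow> real \<Rightarrow> real \<Rightarrow> real \<Rightarrow> real \<Rightarrow> ereal" where
  "summand_density \<mu>\<^sub>X \<mu>\<^sub>Y \<sigma>\<^sub>X \<sigma>\<^sub>Y \<rho> q x =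
     ereal ((1 - \<rho>\<^sup>2) powr (q / 2 - 1) / (2 powr (q - 1) * \<sigma>\<^sub>X * \<sigma>\<^sub>Y) *
       exp (- q / (2 * (1 - \<rho>\<^sup>2)) *
              (\<mu>\<^sub>X\<^sup>2 / \<sigma>\<^sub>X\<^sup>2 + \<mu>\<^sub>Y\<^sup>2 / \<sigma>\<^sub>Y\<^sup>2 - 2 * \<rho> * \<mu>\<^sub>X * \<mu>\<^sub>Y / (\<sigma>\<^sub>X * \<sigma>\<^sub>Y))
            - \<bar>x\<bar> / (\<sigma>\<^sub>X * \<sigma>\<^sub>Y * (1 + \<rho> * sgn x)))) *
     (\<Sum>k. \<Sum>j = 0..k.
        ereal ((q / 8) ^ k / (fact k * Gamma (q / 2 + real (a_index j k x))) * real (k choose j) *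
          ((1 + \<rho>) / (1 - \<rho>)) ^ j * (\<mu>\<^sub>X / \<sigma>\<^sub>X - \<mu>\<^sub>Y / \<sigma>\<^sub>Y) ^ (2 * j) *
          ((1 - \<rho>) / (1 + \<rho>)) ^ (k - j) * (\<mu>\<^sub>X / \<sigma>\<^sub>X + \<mu>\<^sub>Y / \<sigma>\<^sub>Y) ^ (2 * k - 2 * j)) *
        tricomi_U_ext (1 - q / 2 - real (a_index j k x)) (2 - q - real k)
          (2 * \<bar>x\<bar> / (\<sigma>\<^sub>X * \<sigma>\<^sub>Y * (1 - \<rho>\<^sup>2))))"

(* The conversion e2ennreal truncates negative values to 0; the first conjunct ensures that
   this changes f at most on a null set. *)
definition has_pdf :: "'a measure \<Rightarrow> ('a \<Rightarrow> real) \<Rightarrow> (real \<Rightarrow> ereal) \<Rightarrow> bool" where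
  "has_pdf M X f \<longleftrightarrow>
     (AE x in lborel. 0 \<le> f x) \<and> distributed M lborel X (\<lambda>x. e2ennreal (f x))"

(* The sample space may be different from the one carrying the random variable whose law is
   \<mu>; real sequences suffice as sample points, since m independent real random variables with
   given laws exist as the coordinates of a product space. *)
definition infinitely_divisible :: "real measure \<Rightarrow> bool" where
  "infinitely_divisible \<mu> \<longleftrightarrow>
     (\<forall>m::nat. 1 \<le> m \<longrightarrow>
       (\<exists>(N :: (nat \<Rightarrow> real) measure) V.
          prob_space N \<and>
          prob_space.indep_vars N (\<lambda>_. borel) V {1..m} \<and>
          (\<forall>i\<in>{1..m}. distr N borel (V i) = distr N borel (V 1)) \<and>
          \<mu> = distr N borel (\<lambda>\<omega>. \<Sum>i = 1..m. V i \<omega>)))"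

end

theory Submission
  imports Defs
begin

text \<open>
  Write \<open>X / \<sigma>\<^sub>X\<close> and \<open>Y / \<sigma>\<^sub>Y\<close> through their sum \<open>P\<close> and difference \<open>D\<close>: these are independent
  normal variables and \<open>X Y = \<sigma>\<^sub>X \<sigma>\<^sub>Y (P\<^sup>2 - D\<^sup>2) / 4\<close>, so \<open>X Y\<close> is a difference of two independent scaled
  noncentral chi-square variables with one degree of freedom.  A noncentral chi-square law is a
  Poisson mixture of Gamma laws, which makes sense for every real number \<open>q > 0\<close> of degrees of freedom
  and is a convolution semigroup in \<open>q\<close>; taking \<open>q = 1 / m\<close> gives the decomposition.  The density of
  the difference of two Gamma variables is an integral of the type
  \<open>\<integral> t\<^bsup>a-1\<^esup> (1 + t)\<^bsup>b-a-1\<^esup> e\<^bsup>-zt\<^esup> dt\<close> over the half-line, which represents \<open>\<Gamma>(a) U(a, b, z)\<close>.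

  To derive this representation from the definition of \<open>U\<close> by two Kummer series, substitute \<open>s = 1 + t\<close>
  and expand \<open>(1 - 1/s)\<^bsup>a-1\<^esup>\<close> by the binomial series.  The terms are upper incomplete Gamma functions;
  each splits into a complete Gamma function and a power series, and these two parts sum to the two
  Kummer series.
\<close>

section \<open>The integral representation of the Tricomi function\<close>

text \<open>The usual integral for \<Gamma>(a) U(a, b, z) needs a > 0, but the density series
  contains U with first parameter 1 - q/2 - \<open>a_index\<close>, which for q > 0 is negative as
  soon as \<open>a_index\<close> is at least 1. What stays positive is a - b + 1 = q/2 + k -
  \<open>a_index\<close>. The representation is therefore moved by the symmetry U(a, b, z) = z^(1-b)
  U(a-b+1, 2-b, z) before use. The two-series formula breaks down at integer b, which for b = 2 - q
  - k and q = 1/m happens only if m = 1; these values are reached from non-integer b by dominated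
  convergence with a fixed.

  Expanding in 1/s rather than in t keeps s away from 0, so the incomplete Gamma integrals exist for
  all the exponents b - 1 - n, however negative. The binomial coefficients are O(n^(-a)), so a > 0
  makes the sum of |coefficient| / (n + 1) finite; this bound carries the termwise integrations and
  the exchange of the double sum.

  On the probabilistic side series and integrals live in \<open>ennreal\<close>, where rearrangement
  needs no summability.\<close>

text \<open>The coefficient of v^n in (1 - v)^(a-1): the generalized binomial coefficient of a - 1
  over n times (-1)^n.\<close>

definition bincoeff :: "real \<Rightarrow> nat \<Rightarrow> real" where
  "bincoeff a n = pochhammer (1 - a) n / fact n"

lemma bincoeff_Suc: "bincoeff a (Suc n) * (real n + 1) = bincoeff a n * (real n + 1 - a)"
proof -
  have "real n + 1 \<noteq> 0" by linarith
  then show ?thesis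
    unfolding bincoeff_def pochhammer_Suc fact_Suc of_nat_Suc by (simp add: divide_simps) (simp add: algebra_simps)
qed

lemma bincoeff_sums:
  assumes "\<bar>v\<bar> < 1"
  shows "(\<lambda>n. bincoeff a n * v ^ n) sums (1 - v) powr (a - 1)"
proof -
  have "(\<lambda>n. ((a - 1) gchoose n) * (- v) ^ n) sums (1 + (- v)) powr (a - 1)"
    using assms by (intro gen_binomial_real) auto
  moreover have "((a - 1) gchoose n) * (- v) ^ n = bincoeff a n * v ^ n" for n
  proof -
    have "(- 1) ^ n * (- 1) ^ n = (1 :: real)" by (simp flip: power_mult_distrib)
    moreover have "((a - 1) gchoose n) * (- v) ^ n =
      ((- 1) ^ n * (- 1) ^ n) * (pochhammer (1 - a) n / fact n * v ^ n)"
      unfolding gbinomial_pochhammer power_minus[of v] by simp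
    ultimately show ?thesis by (simp add: bincoeff_def)
  qed
  ultimately show ?thesis by simp
qed

text \<open>Up to the factor (n + 1) / n^(1-a), the coefficient of index n + 1 is the n-th term of
  the Gauss product for 1/\<Gamma>(1 - a), which converges and hence is bounded. The index
  \<open>Suc n\<close> matches the n + 1 factors in \<open>rGamma_series\<close>.\<close>

lemma bincoeff_bound: "\<exists>C\<ge>0. \<forall>n\<ge>1. \<bar>bincoeff a (Suc n)\<bar> \<le> C * real n powr (- a)"
proof -
  have "rGamma_series (1 - a) \<longlonglongrightarrow> rGamma (1 - a)" by (rule rGamma_series_LIMSEQ)
  then have "Bseq (rGamma_series (1 - a))" by (meson convergentI convergent_imp_Bseq)
  then obtain C where C: "C > 0" "\<And>n. \<bar>rGamma_series (1 - a) n\<bar> \<le> C" by (auto simp: Bseq_def)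
  have "\<bar>bincoeff a (Suc n)\<bar> \<le> C * real n powr (- a)" if n: "n \<ge> 1" for n
  proof -
    have "rGamma_series (1 - a) n = bincoeff a (Suc n) * (real n + 1) / (real n powr (1 - a))"
    proof -
      have "real n + 1 \<noteq> 0" by linarith
      moreover have "exp ((1 - a) * ln (real n)) \<noteq> 0" by simp
      ultimately show ?thesis
        using n unfolding rGamma_series_def bincoeff_def powr_def fact_Suc of_nat_Suc
        by (simp add: divide_simps)
    qed
    then have "\<bar>bincoeff a (Suc n)\<bar> * (real n + 1) = \<bar>rGamma_series (1 - a) n\<bar> * real n powr (1 - a)"
      using n by (simp add: abs_mult)
    also have "\<dots> \<le> C * (real n powr (- a) * real n)"
    proof -
      have "real n powr (1 - a) = real n powr (- a) * real n"
        using n powr_add[of "real n" "- a" 1] by simp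
      then show ?thesis using mult_right_mono[OF C(2)[of n], of "real n powr (1 - a)"] by simp
    qed
    also have "\<dots> \<le> C * (real n powr (- a) * (real n + 1))"
      using C(1) by (intro mult_left_mono) auto
    finally have "\<bar>bincoeff a (Suc n)\<bar> * (real n + 1) \<le> (C * real n powr (- a)) * (real n + 1)"
      by (simp add: mult_ac)
    then show ?thesis by (rule mult_right_le_imp_le) auto
  qed
  with C(1) show ?thesis by (intro exI[of _ C]) auto
qed

lemma bincoeff_tendsto_0:
  assumes "a > 0" shows "bincoeff a \<longlonglongrightarrow> 0"
proof -
  obtain C where C: "C \<ge> 0" "\<And>n. n \<ge> 1 \<Longrightarrow> \<bar>bincoeff a (Suc n)\<bar> \<le> C * real n powr (- a)"
    using bincoeff_bound[of a] by metis
  have "(\<lambda>n. real n powr (- a)) \<longlonglongrightarrow> 0"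
    using assms by (intro tendsto_neg_powr filterlim_real_sequentially) simp
  from tendsto_mult_left[OF this, of C] have lim: "(\<lambda>n. C * real n powr (- a)) \<longlonglongrightarrow> 0" by simp
  have "(\<lambda>n. bincoeff a (Suc n)) \<longlonglongrightarrow> 0"
  proof (rule Lim_null_comparison[OF _ lim])
    show "\<forall>\<^sub>F n in sequentially. norm (bincoeff a (Suc n)) \<le> C * real n powr (- a)"
      using C(2) unfolding eventually_sequentially by auto
  qed
  then show ?thesis by (rule LIMSEQ_imp_Suc)
qed

text \<open>The terms are O(n^(-a-1)). This is the majorant behind the later interchanges with these
  coefficients.\<close>

lemma summable_bincoeff:
  assumes "a > 0" shows "summable (\<lambda>n. \<bar>bincoeff a n\<bar> / (real n + 1))"
proof -
  obtain C where C: "C \<ge> 0" "\<And>n. n \<ge> 1 \<Longrightarrow> \<bar>bincoeff a (Suc n)\<bar> \<le> C * real n powr (- a)"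
    using bincoeff_bound[of a] by metis
  have "summable (\<lambda>n. C * real n powr (- a - 1))"
    using assms by (intro summable_mult) (simp add: summable_real_powr_iff)
  then have "summable (\<lambda>n. \<bar>bincoeff a (Suc n)\<bar> / (real (Suc n) + 1))"
  proof (rule summable_comparison_test'[where N=1])
    fix n :: nat assume n: "n \<ge> 1"
    have "\<bar>bincoeff a (Suc n)\<bar> / (real (Suc n) + 1) \<le> C * real n powr (- a) / real n"
      using C(2)[OF n] n C(1) by (intro frac_le) auto
    also have "\<dots> = C * real n powr (- a - 1)" using n by (simp add: powr_diff)
    finally show "norm (\<bar>bincoeff a (Suc n)\<bar> / (real (Suc n) + 1)) \<le> C * real n powr (- a - 1)"
      by simp
  qed
  then show ?thesis using summable_Suc_iff[of "\<lambda>n. \<bar>bincoeff a n\<bar> / (real n + 1)"] by blast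
qed

text \<open>Termwise integration of the binomial series. The moments of v against |h| decay like
  1/(n + 1), which together with \<open>summable_bincoeff\<close> gives absolute convergence. It is
  applied to v = x on (0, 1) and to v = 1/s on (1, \<infinity>).\<close>

lemma
  fixes v h :: "'a \<Rightarrow> real"
  assumes [measurable]: "v \<in> borel_measurable M" "h \<in> borel_measurable M"
    and v: "\<And>x. x \<in> space M \<Longrightarrow> 0 \<le> v x \<and> v x < 1"
    and int: "\<And>n::nat. integrable M (\<lambda>x. v x ^ n * h x)"
    and K: "\<And>n::nat. (\<integral>x. v x ^ n * \<bar>h x\<bar> \<partial>M) \<le> K / (real n + 1)"
    and a: "a > 0"
  shows integrable_bincoeff: "integrable M (\<lambda>x. (1 - v x) powr (a - 1) * h x)"
    and integral_bincoeff_sums: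
      "(\<lambda>n. bincoeff a n * (\<integral>x. v x ^ n * h x \<partial>M)) sums (\<integral>x. (1 - v x) powr (a - 1) * h x \<partial>M)"
proof -
  let ?f = "\<lambda>n x. bincoeff a n * (v x ^ n * h x)"
  have int': "integrable M (?f n)" for n using int by simp
  have eq: "(\<lambda>n. ?f n x) sums ((1 - v x) powr (a - 1) * h x)" if "x \<in> space M" for x
    using sums_mult2[OF bincoeff_sums[of "v x" a], of "h x"] v[OF that] by (simp add: mult_ac)
  \<comment> \<open>A power series convergent at some y > v x converges absolutely at v x.\<close>
  have abs: "summable (\<lambda>n. norm (?f n x))" if x: "x \<in> space M" for x
  proof -
    obtain y where y: "v x < y" "y < 1" using v[OF x] dense by blast
    have "summable (\<lambda>n. bincoeff a n * y ^ n)"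
      using bincoeff_sums[of y a] v[OF x] y by (auto simp: sums_iff)
    then have "summable (\<lambda>n. norm (bincoeff a n * v x ^ n))"
      using v[OF x] y by (intro powser_insidea[of _ y]) auto
    from summable_mult2[OF this, of "\<bar>h x\<bar>"] show ?thesis by (simp add: abs_mult mult_ac)
  qed
  have "summable (\<lambda>n. \<integral>x. norm (?f n x) \<partial>M)"
  proof (rule summable_comparison_test')
    show "summable (\<lambda>n. K * (\<bar>bincoeff a n\<bar> / (real n + 1)))"
      using a by (intro summable_mult summable_bincoeff)
    fix n :: nat
    have "(\<integral>x. norm (?f n x) \<partial>M) = (\<integral>x. \<bar>bincoeff a n\<bar> * (v x ^ n * \<bar>h x\<bar>) \<partial>M)"
      using v by (intro Bochner_Integration.integral_cong) (auto simp: abs_mult)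
    also have "\<dots> = \<bar>bincoeff a n\<bar> * (\<integral>x. v x ^ n * \<bar>h x\<bar> \<partial>M)" by simp
    also have "\<dots> \<le> \<bar>bincoeff a n\<bar> * (K / (real n + 1))"
      by (intro mult_left_mono K) auto
    finally show "norm (\<integral>x. norm (?f n x) \<partial>M) \<le> K * (\<bar>bincoeff a n\<bar> / (real n + 1))"
      by (simp add: mult_ac)
  qed
  note S = int' AE_I2[OF abs] this
  have 1: "(\<integral>x. (\<Sum>n. ?f n x) \<partial>M) = (\<integral>x. (1 - v x) powr (a - 1) * h x \<partial>M)"
    using eq by (intro Bochner_Integration.integral_cong) (auto simp: sums_iff)
  have 2: "integrable M (\<lambda>x. \<Sum>n. ?f n x) \<longleftrightarrow> integrable M (\<lambda>x. (1 - v x) powr (a - 1) * h x)"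
    using eq by (intro Bochner_Integration.integrable_cong) (auto simp: sums_iff)
  show "integrable M (\<lambda>x. (1 - v x) powr (a - 1) * h x)"
    using integrable_suminf[OF S] 2 by blast
  show "(\<lambda>n. bincoeff a n * (\<integral>x. v x ^ n * h x \<partial>M)) sums (\<integral>x. (1 - v x) powr (a - 1) * h x \<partial>M)"
    using sums_integral[OF S] unfolding 1 by simp
qed

section \<open>Gamma integrals and incomplete Gamma functions\<close>

lemma has_bochner_integral_of_has_integral:
  fixes f :: "real \<Rightarrow> real"
  assumes f: "(f has_integral I) S" and [measurable]: "S \<in> sets borel" "f \<in> borel_measurable borel"
    and nn: "\<And>x. x \<in> S \<Longrightarrow> 0 \<le> f x"
  shows "has_bochner_integral lborel (\<lambda>x. indicator S x * f x) I"
proof -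
  have "(\<lambda>x. if x \<in> S then f x else 0) = (\<lambda>x. indicator S x * f x)"
    by (auto simp: indicator_def)
  with f have "((\<lambda>x. indicator S x * f x) has_integral I) UNIV"
    by (metis has_integral_restrict_UNIV)
  moreover have "I \<ge> 0" using f nn by (rule has_integral_nonneg)
  ultimately show ?thesis using nn
    by (intro has_bochner_integral_nn_integral nn_integral_has_integral_lborel) (auto simp: indicator_def)
qed

lemma nn_integral_Gamma_kernel:
  assumes \<sigma>: "\<sigma> > 0" and z: "z > 0"
  shows "(\<integral>\<^sup>+s. ennreal (indicator {0..} s * (s powr (\<sigma> - 1) * exp (- z * s))) \<partial>lborel) = ennreal (Gamma \<sigma> / z powr \<sigma>)"
    (is "?I = _")
proof -
  let ?g = "\<lambda>t::real. indicator {0..} t * (t powr (\<sigma> - 1) / exp t)"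
  have "has_bochner_integral lborel ?g (Gamma \<sigma>)"
    by (intro has_bochner_integral_of_has_integral Gamma_integral_real[OF \<sigma>]) auto
  then have "ennreal (Gamma \<sigma>) = (\<integral>\<^sup>+t. ennreal (?g t) \<partial>lborel)"
    by (subst nn_integral_eq_integral) (auto simp: has_bochner_integral_iff)
  also have "\<dots> = \<bar>z\<bar> * (\<integral>\<^sup>+s. ennreal (?g (0 + z * s)) \<partial>lborel)"
    using z by (intro nn_integral_real_affine) auto
  also have "(\<integral>\<^sup>+s. ennreal (?g (0 + z * s)) \<partial>lborel)
      = (\<integral>\<^sup>+s. ennreal (z powr (\<sigma> - 1)) * ennreal (indicator {0..} s * (s powr (\<sigma> - 1) * exp (- z * s))) \<partial>lborel)"
    using z by (intro nn_integral_cong)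
       (auto simp: indicator_def powr_mult exp_minus field_simps zero_le_mult_iff simp flip: ennreal_mult)
  also have "\<dots> = ennreal (z powr (\<sigma> - 1)) * ?I"
    by (rule nn_integral_cmult) auto
  also have "\<bar>z\<bar> * (ennreal (z powr (\<sigma> - 1)) * ?I) = ennreal (z powr \<sigma>) * ?I"
    using z by (simp add: powr_diff mult.assoc[symmetric] flip: ennreal_mult)
  finally have "ennreal (Gamma \<sigma>) / ennreal (z powr \<sigma>) = ennreal (z powr \<sigma>) * ?I / ennreal (z powr \<sigma>)"
    by simp
  also have "\<dots> = ?I" using z by (subst mult.commute) (simp add: ennreal_mult_divide_eq)
  finally show ?thesis using z \<sigma> by (simp add: divide_ennreal)
qed

lemma Gamma_kernel_has_integral:
  fixes \<sigma> z :: real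
  assumes "\<sigma> > 0" "z > 0"
  shows "has_bochner_integral lborel (\<lambda>s. indicator {0..} s * (s powr (\<sigma> - 1) * exp (- z * s))) (Gamma \<sigma> / z powr \<sigma>)"
  using assms nn_integral_Gamma_kernel[OF assms]
  by (intro has_bochner_integral_nn_integral) auto

text \<open>On s > 1 the exponent may be raised to max \<sigma> 1 - 1, so the complete Gamma
  integrand dominates even when \<sigma> is not positive.\<close>

lemma integrable_incomplete_Gamma:
  assumes z: "(z::real) > 0"
  shows "set_integrable lborel {1<..} (\<lambda>s. s powr (\<sigma> - 1) * exp (- z * s))"
proof -
  have "integrable lborel (\<lambda>s. indicator {0..} s * (s powr (max \<sigma> 1 - 1) * exp (- z * s)))"
    using Gamma_kernel_has_integral[of "max \<sigma> 1" z] z by (auto simp: has_bochner_integral_iff)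
  then show ?thesis unfolding set_integrable_def
    by (rule Bochner_Integration.integrable_bound)
       (auto simp: indicator_def intro!: powr_mono AE_I2 mult_right_mono)
qed

text \<open>The upper incomplete Gamma function \<Gamma>(\<sigma>, z) divided by z^\<sigma>. The
  scaling puts z into the exponential only, so that the lower limit is always 1.\<close>

definition incomplete_Gamma :: "real \<Rightarrow> real \<Rightarrow> real" where
  "incomplete_Gamma \<sigma> z = (LINT s:{1<..}|lborel. s powr (\<sigma> - 1) * exp (- z * s))"

lemma has_bochner_integral_powr_0_1:
  assumes "p > (0::real)"
  shows "has_bochner_integral lborel (\<lambda>s. indicator {0..1} s * s powr (p - 1)) (1 / p)"
proof -
  have "((\<lambda>s. s powr (p - 1)) has_integral 1 / p) {0..1}"
    using has_integral_powr_from_0[of "p - 1" 1] assms by simp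
  then show ?thesis by (rule has_bochner_integral_of_has_integral) auto
qed

text \<open>Expand the exponential and integrate s^(\<sigma>+k-1) over [0, 1]. Since 1/(\<sigma> +
  k) is at most 1/\<sigma>, the exponential series dominates.\<close>

lemma lower_incomplete_Gamma_sums:
  assumes \<sigma>: "\<sigma> > 0" and z: "z > 0"
  shows "(\<lambda>k. (- z) ^ k / (fact k * (\<sigma> + real k))) sums
    (LINT s:{0..1}|lborel. s powr (\<sigma> - 1) * exp (- z * s))"
proof -
  let ?c = "\<lambda>k. (- z) ^ k / fact k"
  let ?f = "\<lambda>k s. ?c k * (indicator {0..1} s * s powr (\<sigma> + real k - 1))"
  have p: "has_bochner_integral lborel (\<lambda>s. indicator {0..1} s * s powr (\<sigma> + real k - 1)) (1 / (\<sigma> + real k))" for k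
    using \<sigma> by (intro has_bochner_integral_powr_0_1) auto
  then have i: "integrable lborel (?f k)" for k by (auto simp: has_bochner_integral_iff)
  have eq: "(\<lambda>k. ?f k s) sums (indicator {0..1} s * (s powr (\<sigma> - 1) * exp (- z * s)))" for s
  proof (cases "s > 0")
    case True
    have "(\<lambda>k. (indicator {0..1} s * s powr (\<sigma> - 1)) * ((- z * s) ^ k /\<^sub>R fact k)) sums
      ((indicator {0..1} s * s powr (\<sigma> - 1)) * exp (- z * s))"
      by (intro sums_mult exp_converges)
    moreover have "s powr (\<sigma> + real k - 1) = s powr (\<sigma> - 1) * s ^ k" for k
      using True powr_add[of s "\<sigma> - 1" "real k"] by (simp add: powr_realpow algebra_simps)
    moreover have "(- z * s) ^ k = (- z) ^ k * s ^ k" for k by (rule power_mult_distrib)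
    ultimately show ?thesis by (simp only: real_scaleR_def divide_inverse mult_ac)
  qed (auto simp: indicator_def)
  have n: "norm (?f k s) = \<bar>?c k\<bar> * (indicator {0..1} s * s powr (\<sigma> + real k - 1))" for k s
    by (auto simp: abs_mult indicator_def)
  have "summable (\<lambda>k. norm (?f k s))" for s
  proof (rule summable_comparison_test'[where N=0 and g="\<lambda>k. (norm (- z) ^ k /\<^sub>R fact k) * s powr (\<sigma> - 1)"])
    show "summable (\<lambda>k. norm (- z) ^ k /\<^sub>R fact k * s powr (\<sigma> - 1))"
      by (intro summable_mult2 summable_exp_generic)
    fix k show "norm (norm (?f k s)) \<le> norm (- z) ^ k /\<^sub>R fact k * s powr (\<sigma> - 1)"
    proof (cases "0 < s \<and> s \<le> 1")
      case True
      then have "s powr (\<sigma> + real k - 1) \<le> s powr (\<sigma> - 1)" by (intro powr_mono') auto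
      then show ?thesis using True
        by (auto simp: abs_mult power_abs field_simps mult_left_mono)
    qed (auto simp: indicator_def)
  qed
  moreover have "summable (\<lambda>k. \<integral>s. norm (?f k s) \<partial>lborel)"
  proof (rule summable_comparison_test'[where N=0 and g="\<lambda>k. (norm (- z) ^ k /\<^sub>R fact k) * (1 / \<sigma>)"])
    show "summable (\<lambda>k. norm (- z) ^ k /\<^sub>R fact k * (1 / \<sigma>))"
      by (intro summable_mult2 summable_exp_generic)
    fix k
    have "(\<integral>s. norm (?f k s) \<partial>lborel) = \<bar>?c k\<bar> * (1 / (\<sigma> + real k))"
      unfolding n using p[of k] by (simp add: has_bochner_integral_iff)
    also have "\<dots> \<le> \<bar>?c k\<bar> * (1 / \<sigma>)" using \<sigma> by (intro mult_left_mono) (auto simp: field_simps)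
    finally have "(\<integral>s. norm (?f k s) \<partial>lborel) \<le> norm (- z) ^ k /\<^sub>R fact k * (1 / \<sigma>)"
      by (simp add: power_abs field_simps)
    then show "norm (\<integral>s. norm (?f k s) \<partial>lborel) \<le> norm (- z) ^ k /\<^sub>R fact k * (1 / \<sigma>)"
      by simp
  qed
  ultimately have "(\<lambda>k. \<integral>s. ?f k s \<partial>lborel) sums (\<integral>s. (\<Sum>k. ?f k s) \<partial>lborel)"
    using i by (intro sums_integral) auto
  moreover have "(\<integral>s. ?f k s \<partial>lborel) = (- z) ^ k / (fact k * (\<sigma> + real k))" for k
    using p[of k] by (simp add: has_bochner_integral_iff)
  moreover have "(\<integral>s. (\<Sum>k. ?f k s) \<partial>lborel) = (LINT s:{0..1}|lborel. s powr (\<sigma> - 1) * exp (- z * s))"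
    using eq unfolding set_lebesgue_integral_def by (intro Bochner_Integration.integral_cong) (auto simp: sums_iff)
  ultimately show ?thesis by simp
qed

text \<open>Integration by parts, read off from the derivative of - s^\<sigma> exp(-z s) on [1,
  \<infinity>). For \<sigma> < 0 both summands of the derivative are nonnegative, so the fundamental
  theorem for nonnegative integrals yields integrability as well.\<close>

lemma incomplete_Gamma_recurrence:
  assumes \<sigma>: "\<sigma> < 0" and z: "z > 0"
  shows "\<sigma> * incomplete_Gamma \<sigma> z = z * incomplete_Gamma (\<sigma> + 1) z - exp (- z)"
proof -
  let ?h = "\<lambda>\<sigma> s. indicator {1<..} s * (s powr (\<sigma> - 1) * exp (- z * s))"
  let ?f = "\<lambda>s. - \<sigma> * (s powr (\<sigma> - 1) * exp (- z * s)) + z * (s powr \<sigma> * exp (- z * s))"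
  have i: "integrable lborel (?h \<sigma>)" for \<sigma>
    using integrable_incomplete_Gamma[OF z, of \<sigma>] by (simp add: set_integrable_def)
  have F: "((\<lambda>s. - (s powr \<sigma> * exp (- z * s))) has_real_derivative ?f s) (at s)" if "1 \<le> s" for s
    using that by (auto intro!: derivative_eq_intros has_real_derivative_powr simp: algebra_simps)
  have "((\<lambda>s. s powr \<sigma> * exp (- z * s)) \<longlongrightarrow> 0 * 0) at_top"
  proof (intro tendsto_mult tendsto_neg_powr \<sigma> filterlim_ident)
    have "filterlim (\<lambda>s. z * s) at_top at_top"
      using z by (intro filterlim_tendsto_pos_mult_at_top[OF tendsto_const _ filterlim_ident]) auto
    then show "((\<lambda>s. exp (- z * s)) \<longlongrightarrow> 0) at_top"
      by (intro filterlim_compose[OF exp_at_bot]) (simp add: filterlim_uminus_at_bot)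
  qed
  from tendsto_minus[OF this] have lim: "((\<lambda>s. - (s powr \<sigma> * exp (- z * s))) \<longlongrightarrow> 0) at_top"
    by simp
  have "(\<integral>\<^sup>+s. ennreal (?f s) * indicator {1..} s \<partial>lborel) = ennreal (0 - (- (1 powr \<sigma> * exp (- z * 1))))"
  proof (rule nn_integral_FTC_atLeast[OF _ F _ lim])
    show "0 \<le> ?f s" for s using \<sigma> z by (intro add_nonneg_nonneg mult_nonneg_nonneg) auto
  qed simp_all
  moreover have "(\<integral>\<^sup>+s. ennreal (?f s) * indicator {1..} s \<partial>lborel)
      = (\<integral>\<^sup>+s. ennreal (- \<sigma> * ?h \<sigma> s + z * ?h (\<sigma> + 1) s) \<partial>lborel)"
  proof (rule nn_integral_cong_AE, rule eventually_mono[OF AE_lborel_singleton[of 1]])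
    fix s :: real assume "s \<noteq> 1"
    then show "ennreal (?f s) * indicator {1..} s = ennreal (- \<sigma> * ?h \<sigma> s + z * ?h (\<sigma> + 1) s)"
      by (cases "s > 1") simp_all
  qed
  ultimately have nn: "(\<integral>\<^sup>+s. ennreal (- \<sigma> * ?h \<sigma> s + z * ?h (\<sigma> + 1) s) \<partial>lborel) = ennreal (exp (- z))"
    by simp
  have "0 \<le> - \<sigma> * ?h \<sigma> s + z * ?h (\<sigma> + 1) s" for s
    using \<sigma> z by (intro add_nonneg_nonneg mult_nonneg_nonneg) auto
  then have "has_bochner_integral lborel (\<lambda>s. - \<sigma> * ?h \<sigma> s + z * ?h (\<sigma> + 1) s) (exp (- z))"
    by (intro has_bochner_integral_nn_integral AE_I2 nn) simp_all
  then have "(\<integral>s. - \<sigma> * ?h \<sigma> s + z * ?h (\<sigma> + 1) s \<partial>lborel) = exp (- z)"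
    by (simp only: has_bochner_integral_iff)
  moreover have "(\<integral>s. - \<sigma> * ?h \<sigma> s + z * ?h (\<sigma> + 1) s \<partial>lborel) =
      - \<sigma> * incomplete_Gamma \<sigma> z + z * incomplete_Gamma (\<sigma> + 1) z"
    unfolding incomplete_Gamma_def set_lebesgue_integral_def real_scaleR_def
    using Bochner_Integration.integral_add[OF integrable_mult_right[OF i[of \<sigma>], of "- \<sigma>"] integrable_mult_right[OF i[of "\<sigma> + 1"], of z]]
    by simp
  ultimately show ?thesis by linarith
qed

text \<open>For \<sigma> > 0 the series is the integral over [0, 1], the complement of the upper
  part. Both sides obey the same recurrence between \<sigma> and \<sigma> + 1, so the identity
  descends one unit strip at a time; a non-integer \<sigma> never meets a zero denominator.\<close>

lemma incomplete_Gamma_sums: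
  assumes \<sigma>: "\<sigma> \<notin> \<int>" and z: "z > 0"
  shows "(\<lambda>k. (- z) ^ k / (fact k * (\<sigma> + real k))) sums (Gamma \<sigma> / z powr \<sigma> - incomplete_Gamma \<sigma> z)"
proof -
  have "(\<lambda>k. (- z) ^ k / (fact k * (\<sigma> + real k))) sums (Gamma \<sigma> / z powr \<sigma> - incomplete_Gamma \<sigma> z)"
    if "\<sigma> \<notin> \<int>" "\<sigma> > - real n" for n \<sigma>
    using that
  proof (induction n arbitrary: \<sigma>)
    case (0 \<sigma>)
    then have \<sigma>: "\<sigma> > 0" by simp
    have "Gamma \<sigma> / z powr \<sigma> = (LINT s:{0..}|lborel. s powr (\<sigma> - 1) * exp (- z * s))"
      using Gamma_kernel_has_integral[OF \<sigma> z] by (simp add: has_bochner_integral_iff set_lebesgue_integral_def)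
    also have "{0..} = {0..1} \<union> {1::real<..}" by auto
    also have "(LINT s:{0..1} \<union> {1<..}|lborel. s powr (\<sigma> - 1) * exp (- z * s))
      = (LINT s:{0..1}|lborel. s powr (\<sigma> - 1) * exp (- z * s)) + incomplete_Gamma \<sigma> z"
      unfolding incomplete_Gamma_def
    proof (rule set_integral_Un)
      have "set_integrable lborel {0..} (\<lambda>s. s powr (\<sigma> - 1) * exp (- z * s))"
        using Gamma_kernel_has_integral[OF \<sigma> z] by (simp add: has_bochner_integral_iff set_integrable_def)
      then show "set_integrable lborel {0..1} (\<lambda>s. s powr (\<sigma> - 1) * exp (- z * s))"
        by (rule set_integrable_subset) auto
    qed (use integrable_incomplete_Gamma[OF z] in auto)
    finally show ?case using lower_incomplete_Gamma_sums[OF \<sigma> z] by simp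
  next
    case (Suc n \<sigma>)
    show ?case
    proof (cases "\<sigma> > 0")
      case True
      then show ?thesis using Suc.IH[of \<sigma>] Suc.prems by auto
    next
      case False
      then have neg: "\<sigma> < 0" using Suc.prems(1) by (cases "\<sigma> = 0") auto
      have nz: "\<sigma> + real k \<noteq> 0" for k
      proof
        assume "\<sigma> + real k = 0"
        then have "\<sigma> = - real k" by simp
        then show False using Suc.prems(1) by simp
      qed
      have "\<sigma> + 1 \<notin> \<int>" using Suc.prems(1) Ints_diff[of "\<sigma> + 1" 1] by auto
      then have IH: "(\<lambda>k. (- z) ^ k / (fact k * (\<sigma> + 1 + real k))) sums
          (Gamma (\<sigma> + 1) / z powr (\<sigma> + 1) - incomplete_Gamma (\<sigma> + 1) z)"
        using Suc.prems by (intro Suc.IH) auto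
      \<comment> \<open>Since k/(\<sigma> + k) = 1 - \<sigma>/(\<sigma> + k), the wanted series is
        (exp(-z) - sum of \<open>?g\<close>) / \<sigma>, while \<open>?g\<close> shifted by one is
        -z times the series for \<sigma> + 1.\<close>
      let ?g = "\<lambda>k. real k * (- z) ^ k / (fact k * (\<sigma> + real k))"
      have "(\<lambda>k. ?g (Suc k)) sums (- z * (Gamma (\<sigma> + 1) / z powr (\<sigma> + 1) - incomplete_Gamma (\<sigma> + 1) z))"
      proof -
        have "?g (Suc k) = - z * ((- z) ^ k / (fact k * (\<sigma> + 1 + real k)))" for k
        proof -
          have "1 + real k \<noteq> 0" by linarith
          then show ?thesis using nz[of "Suc k"] by (simp add: divide_simps add_ac)
        qed
        then have "(\<lambda>k. ?g (Suc k)) = (\<lambda>k. - z * ((- z) ^ k / (fact k * (\<sigma> + 1 + real k))))" by (rule ext)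
        with sums_mult[OF IH, of "- z"] show ?thesis by (simp only:)
      qed
      \<comment> \<open>\<open>?g 0 = 0\<close>, so undoing the shift adds nothing.\<close>
      then have g: "?g sums (- z * (Gamma (\<sigma> + 1) / z powr (\<sigma> + 1) - incomplete_Gamma (\<sigma> + 1) z))"
        by (subst (asm) sums_Suc_iff) simp
      have "(\<lambda>k. (- z) ^ k / fact k) sums exp (- z)"
        using exp_converges[of "- z"] by (simp add: field_simps)
      from sums_divide[OF sums_diff[OF this g], of \<sigma>]
      have "(\<lambda>k. ((- z) ^ k / fact k - ?g k) / \<sigma>) sums
        ((exp (- z) + z * (Gamma (\<sigma> + 1) / z powr (\<sigma> + 1) - incomplete_Gamma (\<sigma> + 1) z)) / \<sigma>)" by simp
      moreover have "((- z) ^ k / fact k - ?g k) / \<sigma> = (- z) ^ k / (fact k * (\<sigma> + real k))" for k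
        using nz[of k] neg by (simp add: divide_simps) (simp add: algebra_simps)
      moreover have "(exp (- z) + z * (Gamma (\<sigma> + 1) / z powr (\<sigma> + 1) - incomplete_Gamma (\<sigma> + 1) z)) / \<sigma>
          = Gamma \<sigma> / z powr \<sigma> - incomplete_Gamma \<sigma> z"
      proof -
        have "\<sigma> \<notin> \<int>\<^sub>\<le>\<^sub>0" using Suc.prems(1) nonpos_Ints_Int by blast
        then have "Gamma (\<sigma> + 1) = \<sigma> * Gamma \<sigma>" by (rule Gamma_plus1)
        moreover have "z powr (\<sigma> + 1) = z powr \<sigma> * z" using z by (simp add: powr_add)
        moreover have "incomplete_Gamma \<sigma> z = (z * incomplete_Gamma (\<sigma> + 1) z - exp (- z)) / \<sigma>"
          using incomplete_Gamma_recurrence[OF neg z] neg by (simp add: field_simps)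
        moreover have "z * (\<sigma> * Gamma \<sigma> / (z powr \<sigma> * z) - incomplete_Gamma (\<sigma> + 1) z) =
            \<sigma> * (Gamma \<sigma> / z powr \<sigma>) - z * incomplete_Gamma (\<sigma> + 1) z"
          using z by (simp add: right_diff_distrib)
        ultimately show ?thesis using neg by (simp add: add_divide_distrib diff_divide_distrib)
      qed
      ultimately show ?thesis by simp
    qed
  qed
  moreover obtain n where "- \<sigma> < real n" using reals_Archimedean2 by blast
  ultimately show ?thesis using \<sigma> by (metis minus_less_iff)
qed

section \<open>Partial-fraction series summed by Beta values\<close>

lemma not_Ints_add_of_nat: "(s::real) \<notin> \<int> \<Longrightarrow> s + real n \<noteq> 0"
  by (metis Ints_minus Ints_of_nat add.inverse_inverse add_eq_0_iff)

text \<open>Write 1/(n + s) as the integral of x^(n+s-1) over (0, 1) and sum under the integral: the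
  binomial series turns it into Beta(s, a).\<close>

lemma bincoeff_beta_sums_pos:
  assumes s: "s > (0::real)" and a: "a > 0"
  shows "(\<lambda>n. bincoeff a n / (real n + s)) sums (Gamma s * Gamma a * rGamma (s + a))"
proof -
  \<comment> \<open>The interval is open because the termwise lemma asks for v < 1 at every
    point.\<close>
  let ?M = "restrict_space lborel {0<..<1::real}"
  have I: "has_bochner_integral ?M (\<lambda>x. x ^ n * x powr (s - 1)) (1 / (real n + s))" for n
  proof -
    have "has_bochner_integral lborel (\<lambda>x. indicator {0..1} x * x powr (real n + s - 1)) (1 / (real n + s))"
      using s by (intro has_bochner_integral_powr_0_1) auto
    also have "?this \<longleftrightarrow> has_bochner_integral lborel (\<lambda>x. indicator {0<..<1} x * (x ^ n * x powr (s - 1))) (1 / (real n + s))"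
    proof (rule has_bochner_integral_cong_AE)
      show "AE x in lborel. indicator {0..1} x * x powr (real n + s - 1) = indicator {0<..<1} x * (x ^ n * x powr (s - 1))"
      proof (rule eventually_mono[OF eventually_conj[OF AE_lborel_singleton[of 0] AE_lborel_singleton[of 1]]])
        fix x :: real assume x: "x \<noteq> 0 \<and> x \<noteq> 1"
        show "indicator {0..1} x * x powr (real n + s - 1) = indicator {0<..<1} x * (x ^ n * x powr (s - 1))"
        proof (cases "0 < x \<and> x < 1")
          case True
          then show ?thesis using powr_add[of x "real n" "s - 1"]
            by (simp add: powr_realpow add_diff_eq)
        qed (use x in \<open>auto simp: indicator_def\<close>)
      qed
    qed simp_all
    finally show ?thesis by (simp add: has_bochner_integral_restrict_space)
  qed
  have "(\<lambda>n. bincoeff a n * (\<integral>x. x ^ n * x powr (s - 1) \<partial>?M)) sums (\<integral>x. (1 - x) powr (a - 1) * x powr (s - 1) \<partial>?M)"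
  \<comment> \<open>1/(n + s) is at most 1/(n + 1) for s \<ge> 1, and at most (1/s)/(n + 1) for s <
    1.\<close>
  proof (rule integral_bincoeff_sums[where K="max 1 (1 / s)"])
    fix n :: nat
    show "integrable ?M (\<lambda>x. x ^ n * x powr (s - 1))" using I by (simp add: has_bochner_integral_iff)
    have "1 / (real n + s) \<le> max 1 (1 / s) / (real n + 1)"
    proof (cases "s \<ge> 1")
      case True
      then have "1 / (real n + s) \<le> 1 / (real n + 1)" by (intro divide_left_mono) auto
      also have "\<dots> \<le> max 1 (1 / s) / (real n + 1)" by (intro divide_right_mono) auto
      finally show ?thesis .
    next
      case False
      then have "1 / (real n + s) \<le> (1 / s) / (real n + 1)"
        using s by (simp add: divide_simps) (simp add: algebra_simps mult_left_le_one_le)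
      also have "\<dots> \<le> max 1 (1 / s) / (real n + 1)" by (intro divide_right_mono) auto
      finally show ?thesis .
    qed
    moreover have "(\<integral>x. x ^ n * x powr (s - 1) \<partial>?M) = 1 / (real n + s)"
      using I[of n] by (simp only: has_bochner_integral_iff)
    ultimately show "(\<integral>x. x ^ n * \<bar>x powr (s - 1)\<bar> \<partial>?M) \<le> max 1 (1 / s) / (real n + 1)" by simp
  qed (use a in \<open>auto simp: space_restrict_space intro!: measurable_restrict_space1\<close>)
  moreover have "(\<integral>x. x ^ n * x powr (s - 1) \<partial>?M) = 1 / (real n + s)" for n
    using I[of n] by (simp only: has_bochner_integral_iff)
  moreover have "(\<integral>x. (1 - x) powr (a - 1) * x powr (s - 1) \<partial>?M) = Gamma s * Gamma a * rGamma (s + a)"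
  proof -
    have "((\<lambda>t. t powr (s - 1) * (1 - t) powr (a - 1)) has_integral Beta s a) {0<..<1}"
      using has_integral_Beta_real[OF s a] has_integral_open_interval[of "\<lambda>t. t powr (s - 1) * (1 - t) powr (a - 1)" "Beta s a" 0 1]
      by (simp add: box_real)
    then have "has_bochner_integral lborel (\<lambda>t. indicator {0<..<1} t * (t powr (s - 1) * (1 - t) powr (a - 1))) (Beta s a)"
      by (rule has_bochner_integral_of_has_integral) auto
    then have "has_bochner_integral ?M (\<lambda>t. t powr (s - 1) * (1 - t) powr (a - 1)) (Beta s a)"
      by (simp add: has_bochner_integral_restrict_space)
    then show ?thesis by (simp add: has_bochner_integral_iff Beta_altdef mult_ac)
  qed
  ultimately show ?thesis by simp
qed

text \<open>
  The Beta integral gives the case \<open>s > 0\<close>; both sides then satisfy \<open>s T(s) = (s + a) T(s + 1)\<close>, the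
  series because its terms telescope.  The reciprocal Gamma function covers the poles at \<open>s + a\<close>.
\<close>

lemma bincoeff_beta_sums:
  assumes s: "s \<notin> \<int>" and a: "a > 0"
  shows "(\<lambda>n. bincoeff a n / (real n + s)) sums (Gamma s * Gamma a * rGamma (s + a))"
proof -
  have "(\<lambda>n. bincoeff a n / (real n + s)) sums (Gamma s * Gamma a * rGamma (s + a))"
    if "s \<notin> \<int>" "s > - real m" for m s
    using that
  proof (induction m arbitrary: s)
    case 0
    then show ?case using bincoeff_beta_sums_pos a by simp
  next
    case (Suc m s)
    have nz: "real n + s \<noteq> 0" for n using not_Ints_add_of_nat[OF Suc.prems(1), of n] by (simp add: add.commute)
    have s1: "s + 1 \<notin> \<int>" using Suc.prems(1) Ints_diff[of "s + 1" 1] by auto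
    then have IH: "(\<lambda>n. bincoeff a n / (real n + (s + 1))) sums (Gamma (s + 1) * Gamma a * rGamma (s + 1 + a))"
      using Suc.prems by (intro Suc.IH) auto
    \<comment> \<open>Chosen so that s c_n/(n + s) = c_n - d_n and (s + a) c_n/(n + s + 1) = c_n -
      d_(n+1), with c_n the binomial coefficient. The differences of d sum to 0, since d_0 = 0 and
      d_n tends to 0 because c_n does.\<close>
    let ?d = "\<lambda>n. bincoeff a n * (real n / (real n + s))"
    have "(\<lambda>n. real n / (real n + s)) \<longlonglongrightarrow> 1" by real_asymp
    then have "?d \<longlonglongrightarrow> 0 * 1" by (intro tendsto_mult bincoeff_tendsto_0 a)
    then have "(\<lambda>n. ?d (Suc n) - ?d n) sums (0 - ?d 0)" by (intro telescope_sums) simp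
    from sums_divide[OF sums_add[OF sums_mult[OF IH, of "s + a"] this], of s]
    have "(\<lambda>n. ((s + a) * (bincoeff a n / (real n + (s + 1))) + (?d (Suc n) - ?d n)) / s) sums
      ((s + a) * (Gamma (s + 1) * Gamma a * rGamma (s + 1 + a)) / s)" by simp
    moreover have "((s + a) * (bincoeff a n / (real n + (s + 1))) + (?d (Suc n) - ?d n)) / s = bincoeff a n / (real n + s)" for n
    proof -
      have nz1: "real n + (s + 1) \<noteq> 0" using nz[of "Suc n"] by (simp add: add_ac)
      have "?d (Suc n) = bincoeff a n * (real n + 1 - a) / (real n + (s + 1))"
        using bincoeff_Suc[of a n] by (simp add: add_ac)
      moreover have "(s + a) * (bincoeff a n / (real n + (s + 1))) + bincoeff a n * (real n + 1 - a) / (real n + (s + 1)) = bincoeff a n"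
        using nz1 by (simp add: divide_simps) (simp add: algebra_simps)
      moreover have "bincoeff a n - ?d n = s * (bincoeff a n / (real n + s))"
        using nz[of n] by (simp add: divide_simps) (simp add: algebra_simps)
      ultimately show ?thesis using nz[of 0] by (simp add: add_diff_eq)
    qed
    moreover have "(s + a) * (Gamma (s + 1) * Gamma a * rGamma (s + 1 + a)) / s = Gamma s * Gamma a * rGamma (s + a)"
    proof -
      have "s \<notin> \<int>\<^sub>\<le>\<^sub>0" using Suc.prems(1) nonpos_Ints_Int by blast
      then have "Gamma (s + 1) = s * Gamma s" by (rule Gamma_plus1)
      moreover have "rGamma (s + a) = (s + a) * rGamma (s + 1 + a)"
        using rGamma_plus1[of "s + a"] by (simp add: add_ac)
      ultimately show ?thesis using nz[of 0] by simp
    qed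
    ultimately show ?case by simp
  qed
  moreover obtain n where "- s < real n" using reals_Archimedean2 by blast
  ultimately show ?thesis using s by (metis minus_less_iff)
qed

section \<open>Double series, Gamma shifts and the Kummer function\<close>

text \<open>A summable product majorant makes the double series absolutely convergent; the exchange
  is termwise integration against counting measure.\<close>

lemma suminf_swap:
  fixes f :: "nat \<Rightarrow> nat \<Rightarrow> real"
  assumes bd: "\<And>n k. \<bar>f n k\<bar> \<le> A n * B k" and A: "summable A" and B: "summable B"
  shows "(\<lambda>n. \<Sum>k. f n k) sums (\<Sum>k. \<Sum>n. f n k)"
    and "summable (\<lambda>k. \<Sum>n. f n k)"
proof -
  let ?M = "count_space (UNIV :: nat set)"
  have S: "summable (\<lambda>k. \<bar>f n k\<bar>)" for n
    by (rule summable_comparison_test'[OF summable_mult[OF B, of "A n"]]) (use bd in auto)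
  have S': "summable (\<lambda>n. \<bar>f n k\<bar>)" for k
    by (rule summable_comparison_test'[OF summable_mult2[OF A, of "B k"]]) (use bd in auto)
  have i: "integrable ?M (f n)" for n using S by (simp add: integrable_count_space_nat_iff)
  have "(\<integral>k. norm (f n k) \<partial>?M) \<le> A n * suminf B" for n
  proof -
    have "integrable ?M (\<lambda>k. norm (f n k))" using i by simp
    then have "(\<integral>k. norm (f n k) \<partial>?M) = (\<Sum>k. \<bar>f n k\<bar>)" by (simp add: integral_count_space_nat)
    also have "\<dots> \<le> (\<Sum>k. A n * B k)" using bd by (intro suminf_le S summable_mult B) auto
    also have "\<dots> = A n * suminf B" by (rule suminf_mult[OF B])
    finally show ?thesis .
  qed
  then have n: "summable (\<lambda>n. \<integral>k. norm (f n k) \<partial>?M)"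
    by (intro summable_comparison_test'[OF summable_mult2[OF A, of "suminf B"]]) auto
  have S'': "AE k in ?M. summable (\<lambda>n. norm (f n k))" using S' by simp
  have i2: "integrable ?M (\<lambda>k. \<Sum>n. f n k)" by (rule integrable_suminf[OF i S'' n])
  then show "summable (\<lambda>k. \<Sum>n. f n k)"
    by (auto simp: integrable_count_space_nat_iff intro: summable_rabs_cancel)
  have "(\<lambda>n. \<integral>k. f n k \<partial>?M) sums (\<integral>k. (\<Sum>n. f n k) \<partial>?M)" by (rule sums_integral[OF i S'' n])
  then show "(\<lambda>n. \<Sum>k. f n k) sums (\<Sum>k. \<Sum>n. f n k)"
    using i i2 by (simp add: integral_count_space_nat)
qed

text \<open>The functional equation run downwards. For the reciprocal Gamma function it holds at
  every real x, poles of Gamma included.\<close>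

lemma rGamma_diff_of_nat:
  "rGamma (x - real n) = (- 1) ^ n * pochhammer (1 - x) n * rGamma (x::real)"
proof (induction n)
  case (Suc n)
  have "rGamma (x - real (Suc n)) = (x - real (Suc n)) * rGamma (x - real n)"
    using rGamma_plus1[of "x - real (Suc n)"] by simp
  then show ?case unfolding Suc.IH by (simp add: pochhammer_Suc algebra_simps)
qed simp

lemma Gamma_diff_of_nat:
  assumes "(x::real) \<notin> \<int>"
  shows "Gamma (x - real n) = (- 1) ^ n * Gamma x / pochhammer (1 - x) n"
proof -
  have "inverse (rGamma (x - real n)) = inverse ((- 1) ^ n) * inverse (rGamma x) * inverse (pochhammer (1 - x) n)"
    unfolding rGamma_diff_of_nat by simp
  then show ?thesis by (simp add: rGamma_inverse_Gamma divide_inverse power_inverse[symmetric])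
qed

lemma kummer_M_abs_summable:
  "summable (\<lambda>j. norm (pochhammer a j / pochhammer b j * (x ^ j / fact j) :: real))" (is "summable (\<lambda>j. norm (?f j))")
\<comment> \<open>If b is a nonpositive integer, division by zero makes all but finitely many terms
  0; otherwise the ratio test applies.\<close>
proof (cases "\<exists>m. pochhammer b m = 0")
  case True
  then obtain m where "pochhammer b m = 0" by blast
  then have "pochhammer b j = 0" if "j \<ge> m" for j
    using that by (metis pochhammer_eq_0_mono)
  then show ?thesis by (intro summable_finite[of "{..<m}"]) auto
next
  case False
  have "(\<lambda>n. \<bar>x\<bar> * \<bar>a + real n\<bar> / (\<bar>b + real n\<bar> * (real n + 1))) \<longlonglongrightarrow> 0" by real_asymp
  then have "\<forall>\<^sub>F n in sequentially. \<bar>x\<bar> * \<bar>a + real n\<bar> / (\<bar>b + real n\<bar> * (real n + 1)) < 1/2"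
    by (rule order_tendstoD) simp
  then obtain N where N: "\<And>n. n \<ge> N \<Longrightarrow> \<bar>x\<bar> * \<bar>a + real n\<bar> / (\<bar>b + real n\<bar> * (real n + 1)) < 1/2"
    by (auto simp: eventually_sequentially)
  show ?thesis
  proof (rule summable_ratio_test[of "1/2" N])
    fix n assume n: "n \<ge> N"
    have "?f (Suc n) = ?f n * (x * (a + real n) / ((b + real n) * (real n + 1)))"
      unfolding pochhammer_Suc fact_Suc of_nat_Suc by (simp add: divide_simps)
    then have "norm (?f (Suc n)) = norm (?f n) * (\<bar>x\<bar> * \<bar>a + real n\<bar> / (\<bar>b + real n\<bar> * (real n + 1)))"
      by (simp add: abs_mult)
    also have "\<dots> \<le> norm (?f n) * (1/2)" using N[OF n] by (intro mult_left_mono) auto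
    finally show "norm (norm (?f (Suc n))) \<le> 1/2 * norm (norm (?f n))" by simp
  qed simp
qed

lemma kummer_M_sums:
  "(\<lambda>j. pochhammer a j / pochhammer b j * (x ^ j / fact j)) sums kummer_M a b x"
  unfolding kummer_M_def by (rule summable_sums[OF summable_norm_cancel[OF kummer_M_abs_summable]])

text \<open>Multiply the series on the right by that of exp z: the coefficient of z^n in the Cauchy
  product is evaluated by the Chu-Vandermonde identity
  \<open>pochhammer_binomial_sum\<close>.\<close>

lemma kummer_transformation:
  assumes b: "b \<notin> \<int>"
  shows "kummer_M a b z = exp z * kummer_M (b - a) b (- z)"
proof -
  have nz: "pochhammer b n \<noteq> 0" for n
    using not_Ints_add_of_nat[OF b] by (auto simp: pochhammer_eq_0_iff eq_neg_iff_add_eq_0)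
  let ?f = "\<lambda>i. pochhammer (b - a) i / pochhammer b i * ((- z) ^ i / fact i)"
  let ?g = "\<lambda>i. z ^ i / fact i"
  have g: "?g sums exp z" using exp_converges[of z] by (simp add: field_simps)
  have ga: "summable (\<lambda>i. norm (?g i))"
    using summable_norm_exp[of z] by (simp add: field_simps)
  have "(\<lambda>n. \<Sum>i\<le>n. ?f i * ?g (n - i)) sums (suminf ?f * suminf ?g)"
    by (rule Cauchy_product_sums[OF kummer_M_abs_summable ga])
  moreover have "(\<Sum>i\<le>n. ?f i * ?g (n - i)) = pochhammer a n / pochhammer b n * (z ^ n / fact n)" for n
  proof -
    \<comment> \<open>Reversing the last n - i factors of \<open>pochhammer b n\<close> replaces 1 /
      \<open>pochhammer b i\<close> by a rising factorial of 1 - b - n in the numerator, which is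
      the shape Chu-Vandermonde needs.\<close>
    have 1: "pochhammer (b - a) i / pochhammer b i * (- 1) ^ i * (real (n choose i)) =
        (- 1) ^ n / pochhammer b n * (real (n choose i) * pochhammer (b - a) i * pochhammer (1 - b - real n) (n - i))" if i: "i \<le> n" for i
    proof -
      have "pochhammer (1 - b - real n) (n - i) = (- 1) ^ (n - i) * pochhammer (b + real i) (n - i)"
        using pochhammer_minus'[of "b + real n - 1" "n - i"] i by (simp add: of_nat_diff algebra_simps)
      moreover have "pochhammer b n = pochhammer b i * pochhammer (b + real i) (n - i)"
        using i by (rule pochhammer_product)
      moreover have "(- 1 :: real) ^ n = (- 1) ^ i * (- 1) ^ (n - i)" using i by (simp flip: power_add)
      moreover have "(- 1 :: real) ^ (n - i) * (- 1) ^ (n - i) = 1" by (simp flip: power_mult_distrib)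
      ultimately show ?thesis using nz[of n] nz[of i] by (simp add: field_simps)
    qed
    have "(\<Sum>i\<le>n. ?f i * ?g (n - i)) = (\<Sum>i\<le>n. (pochhammer (b - a) i / pochhammer b i * (- 1) ^ i * (real (n choose i))) * (z ^ n / fact n))"
    proof (intro sum.cong refl)
      fix i assume "i \<in> {..n}"
      then have i: "i \<le> n" by simp
      have "z ^ n = z ^ i * z ^ (n - i)" using i by (simp flip: power_add)
      moreover have "real (n choose i) = fact n / (fact i * fact (n - i))" using binomial_fact[OF i, where ?'a=real] .
      moreover have "(- z) ^ i = (- 1) ^ i * z ^ i" by (rule power_minus)
      ultimately show "?f i * ?g (n - i) = (pochhammer (b - a) i / pochhammer b i * (- 1) ^ i * (real (n choose i))) * (z ^ n / fact n)"
        by simp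
    qed
    also have "\<dots> = (- 1) ^ n / pochhammer b n * (\<Sum>i\<le>n. real (n choose i) * pochhammer (b - a) i * pochhammer (1 - b - real n) (n - i)) * (z ^ n / fact n)"
      unfolding sum_distrib_left sum_distrib_right using 1 by (intro sum.cong) auto
    also have "(\<Sum>i\<le>n. real (n choose i) * pochhammer (b - a) i * pochhammer (1 - b - real n) (n - i)) = pochhammer (1 - a - real n) n"
      using pochhammer_binomial_sum[of "b - a" "1 - b - real n" n] by (simp add: algebra_simps)
    also have "pochhammer (1 - a - real n) n = (- 1) ^ n * pochhammer a n"
      using pochhammer_minus'[of "a + real n - 1" n] by (simp add: algebra_simps)
    also have "(- 1) ^ n / pochhammer b n * ((- 1) ^ n * pochhammer a n) = ((- 1) ^ n * (- 1) ^ n) * pochhammer a n / pochhammer b n" by simp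
    also have "(- 1 :: real) ^ n * (- 1) ^ n = 1" by (simp flip: power_mult_distrib)
    finally show ?thesis by simp
  qed
  ultimately have "(\<lambda>n. pochhammer a n / pochhammer b n * (z ^ n / fact n)) sums (kummer_M (b - a) b (- z) * exp z)"
    using g by (simp add: sums_iff kummer_M_def)
  then show ?thesis using kummer_M_sums[of a b z] sums_unique2 by (metis mult.commute)
qed

section \<open>The kernel and the representation for non-integer b\<close>

lemma power_le_fact_mult_exp:
  assumes "(x::real) \<ge> 0" shows "x ^ n \<le> fact n * exp x"
proof -
  have s: "(\<lambda>n. x ^ n / fact n) sums exp x" using exp_converges[of x] by (simp add: field_simps)
  have "(\<Sum>k\<in>{n}. x ^ k / fact k) \<le> (\<Sum>k. x ^ k / fact k)"
    using assms s by (intro sum_le_suminf) (auto simp: sums_iff)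
  with s show ?thesis by (simp add: sums_iff field_simps)
qed

text \<open>
  The integrand \<open>t\<^bsup>a-1\<^esup> (1 + t)\<^bsup>b-a-1\<^esup> e\<^bsup>-zt\<^esup>\<close> at \<open>t = s - 1\<close>, up to the factor \<open>e\<^bsup>z\<^esup>\<close>.
\<close>

definition tricomi_kernel :: "real \<Rightarrow> real \<Rightarrow> real \<Rightarrow> real \<Rightarrow> real" where
  "tricomi_kernel a b z s = (1 - 1 / s) powr (a - 1) * (s powr (b - 2) * exp (- z * s))"

text \<open>Take v = 1/s and h(s) = s^(b-2) exp(-z s) in the termwise lemma: v^n h is the integrand
  of \<open>incomplete_Gamma (b - 1 - n) z\<close>, and h(s) \<le> K s^(-2) makes the n-th moment at
  most K/(n + 1).\<close>

lemma
  assumes a: "a > 0" and z: "z > 0"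
  shows integrable_tricomi_kernel: "set_integrable lborel {1<..} (tricomi_kernel a b z)"
    and tricomi_kernel_sums: "(\<lambda>n. bincoeff a n * incomplete_Gamma (b - 1 - real n) z) sums
      (LINT s:{1<..}|lborel. tricomi_kernel a b z s)"
proof -
  let ?M = "restrict_space lborel {1::real<..}"
  let ?h = "\<lambda>s. s powr (b - 2) * exp (- z * s)"
  have sp: "space ?M = {1<..}" by (simp add: space_restrict_space)
  have eq: "(1 / s) ^ n * ?h s = s powr (b - 1 - real n - 1) * exp (- z * s)" if "s > 1" for s n
  proof -
    have "s powr (b - 2) = s powr (b - 1 - real n - 1) * s ^ n"
      using that powr_add[of s "b - 1 - real n - 1" "real n"] by (simp add: powr_realpow)
    then show ?thesis using that by (simp add: power_one_over)
  qed
  have int: "integrable ?M (\<lambda>s. (1 / s) ^ n * ?h s)" for n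
  proof -
    have "integrable ?M (\<lambda>s. s powr (b - 1 - real n - 1) * exp (- z * s))"
      using integrable_incomplete_Gamma[OF z, of "b - 1 - real n"]
      by (simp add: integrable_restrict_space set_integrable_def)
    then show ?thesis by (subst Bochner_Integration.integrable_cong[OF refl eq]) (simp_all add: sp)
  qed
  \<comment> \<open>For s > 1, s^b \<le> s^N, and one term of the exponential series gives s^N \<le>
    (N! / z^N) exp(z s); this is the constant K.\<close>
  obtain N :: nat where N: "b < real N" using reals_Archimedean2 by blast
  define K where "K = fact N / z ^ N"
  have K: "?h s \<le> K * s powr (- 2)" if s: "s > 1" for s
  proof -
    have "(z * s) ^ N \<le> fact N * exp (z * s)" using z s by (intro power_le_fact_mult_exp) auto
    then have "s ^ N * exp (- z * s) \<le> K"
      using z by (simp add: K_def exp_minus power_mult_distrib divide_simps) (simp add: algebra_simps)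
    moreover have "s powr b \<le> s ^ N" using s N by (simp add: powr_mono flip: powr_realpow)
    ultimately have "s powr b * exp (- z * s) \<le> K"
      by (meson exp_ge_zero mult_right_mono order_trans)
    then have "s powr b * exp (- z * s) * s powr (- 2) \<le> K * s powr (- 2)"
      by (rule mult_right_mono) simp
    moreover have "s powr (b - 2) = s powr b * s powr (- 2)" by (simp flip: powr_add)
    ultimately show ?thesis by (simp add: mult_ac)
  qed
  have Kb: "(\<integral>s. (1 / s) ^ n * \<bar>?h s\<bar> \<partial>?M) \<le> K / (real n + 1)" for n :: nat
  proof -
    have I: "has_bochner_integral ?M (\<lambda>s. s powr (- 2 - real n)) (1 / (real n + 1))"
    proof -
      have "((\<lambda>s. s powr (- 2 - real n)) has_integral (1 / (real n + 1))) {1..}"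
      proof -
        have "- (1 powr (- 2 - real n + 1)) / (- 2 - real n + 1) = 1 / (real n + 1)"
          by (simp add: divide_simps)
        then show ?thesis using has_integral_powr_to_inf[of "- 2 - real n" 1] by simp
      qed
      then have "has_bochner_integral lborel (\<lambda>s. indicator {1..} s * s powr (- 2 - real n)) (1 / (real n + 1))"
        by (rule has_bochner_integral_of_has_integral) auto
      also have "?this \<longleftrightarrow> has_bochner_integral lborel (\<lambda>s. indicator {1<..} s * s powr (- 2 - real n)) (1 / (real n + 1))"
      proof (rule has_bochner_integral_cong_AE)
        show "AE s in lborel. indicator {1..} s * s powr (- 2 - real n) = indicator {1<..} s * s powr (- 2 - real n)"
          by (rule eventually_mono[OF AE_lborel_singleton[of 1]]) (auto simp: indicator_def)
      qed simp_all
      finally show ?thesis by (simp add: has_bochner_integral_restrict_space)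
    qed
    have "(\<integral>s. (1 / s) ^ n * \<bar>?h s\<bar> \<partial>?M) \<le> (\<integral>s. K * s powr (- 2 - real n) \<partial>?M)"
    proof (rule integral_mono)
      have "integrable ?M (\<lambda>s. \<bar>(1 / s) ^ n * ?h s\<bar>)" using int by simp
      then show "integrable ?M (\<lambda>s. (1 / s) ^ n * \<bar>?h s\<bar>)"
        by (subst (asm) Bochner_Integration.integrable_cong[OF refl]) (auto simp: sp abs_mult)
      show "integrable ?M (\<lambda>s. K * s powr (- 2 - real n))"
        using I by (auto simp: has_bochner_integral_iff)
      fix s assume "s \<in> space ?M"
      then have s: "s > 1" by (simp add: sp)
      have "(1 / s) ^ n * \<bar>?h s\<bar> \<le> (1 / s) ^ n * (K * s powr (- 2))"
        using K[OF s] s by (intro mult_left_mono) auto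
      also have "\<dots> = K * s powr (- 2 - real n)"
        using s by (simp add: powr_diff powr_realpow power_one_over)
      finally show "(1 / s) ^ n * \<bar>?h s\<bar> \<le> K * s powr (- 2 - real n)" .
    qed
    also have "\<dots> = K / (real n + 1)" using I by (simp add: has_bochner_integral_iff)
    finally show ?thesis .
  qed
  have m: "(\<lambda>s. 1 / s) \<in> borel_measurable ?M" "?h \<in> borel_measurable ?M"
    by (auto intro!: measurable_restrict_space1)
  have v: "0 \<le> 1 / s \<and> 1 / s < 1" if "s \<in> space ?M" for s :: real using that by (simp add: sp)
  show "set_integrable lborel {1<..} (tricomi_kernel a b z)"
    using integrable_bincoeff[OF m v int Kb a]
    by (simp add: integrable_restrict_space set_integrable_def tricomi_kernel_def)
  have "(\<integral>s. (1 / s) ^ n * ?h s \<partial>?M) = incomplete_Gamma (b - 1 - real n) z" for n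
  proof -
    have "(\<integral>s. (1 / s) ^ n * ?h s \<partial>?M) = (\<integral>s. s powr (b - 1 - real n - 1) * exp (- z * s) \<partial>?M)"
      by (intro Bochner_Integration.integral_cong refl eq) (simp add: sp)
    then show ?thesis unfolding incomplete_Gamma_def set_lebesgue_integral_def
      by (simp add: integral_restrict_space)
  qed
  moreover have "(\<integral>s. (1 - 1 / s) powr (a - 1) * ?h s \<partial>?M) = (LINT s:{1<..}|lborel. tricomi_kernel a b z s)"
    unfolding set_lebesgue_integral_def tricomi_kernel_def by (simp add: integral_restrict_space)
  ultimately show "(\<lambda>n. bincoeff a n * incomplete_Gamma (b - 1 - real n) z) sums
      (LINT s:{1<..}|lborel. tricomi_kernel a b z s)"
    using integral_bincoeff_sums[OF m v int Kb a] by simp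
qed

text \<open>Since the integers form a closed set, |b - n + k| is at least some e > 0, and it grows
  with n up to an error linear in k. The bound separates the indices: 1/(n + 1) is what
  \<open>summable_bincoeff\<close> requires, and k + 1 is harmless beside z^k / k!.\<close>

lemma not_Ints_diff_bound:
  assumes "(b::real) \<notin> \<int>"
  shows "\<exists>C\<ge>0. \<forall>n k. 1 / \<bar>b - real n + real k\<bar> \<le> C * (real k + 1) / (real n + 1)"
proof -
  have "open (- (\<int> :: real set))" using closed_Ints by (rule open_Compl)
  then obtain e where e: "e > 0" "ball b e \<subseteq> - \<int>"
    using assms by (auto elim!: openE)
  have d: "\<bar>b - real n + real k\<bar> \<ge> e" for n k
  proof (rule ccontr)
    assume "\<not> e \<le> \<bar>b - real n + real k\<bar>"
    then have "real n - real k \<in> ball b e" by (auto simp: dist_real_def)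
    then show False using e(2) by auto
  qed
  let ?C = "1 + (\<bar>b\<bar> + 1) / e"
  have "1 / \<bar>b - real n + real k\<bar> \<le> ?C * (real k + 1) / (real n + 1)" for n k
  proof -
    let ?D = "\<bar>b - real n + real k\<bar>"
    have "real n + 1 \<le> ?D + (\<bar>b\<bar> + 1 + real k)" by linarith
    also have "\<dots> \<le> ?D * (real k + 1) + (\<bar>b\<bar> + 1) * (real k + 1) * (?D / e)"
    proof (rule add_mono)
      show "?D \<le> ?D * (real k + 1)" by (simp add: distrib_left)
      have "\<bar>b\<bar> + 1 + real k \<le> (\<bar>b\<bar> + 1) * (real k + 1)" by (simp add: algebra_simps)
      also have "\<dots> \<le> (\<bar>b\<bar> + 1) * (real k + 1) * (?D / e)"
        using mult_left_mono[of 1 "?D / e" "(\<bar>b\<bar> + 1) * (real k + 1)"] d[of n k] e(1) by simp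
      finally show "\<bar>b\<bar> + 1 + real k \<le> (\<bar>b\<bar> + 1) * (real k + 1) * (?D / e)" .
    qed
    also have "\<dots> = ?C * (real k + 1) * ?D"
    proof -
      have "D * K + B * K * (D / e) = (1 + B / e) * K * D" for D K B :: real
        by (simp add: algebra_simps)
      then show ?thesis .
    qed
    finally have "real n + 1 \<le> ?C * (real k + 1) * ?D" .
    moreover have "?D > 0" using d[of n k] e(1) by linarith
    ultimately show ?thesis by (simp add: divide_simps mult_ac)
  qed
  moreover have "?C \<ge> 0" using e(1) by simp
  ultimately show ?thesis by blast
qed

text \<open>Both parts of the expansion produce Kummer series at -z; the factor exp z and Kummer's
  transformation carry them to argument z.\<close>

lemma tricomi_U_nonint_integral:
  assumes a: "a > 0" and b: "b \<notin> \<int>" and z: "z > 0"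
  shows "tricomi_U_nonint a b z = exp z * rGamma a * (LINT s:{1<..}|lborel. tricomi_kernel a b z s)"
proof -
  let ?I = "LINT s:{1<..}|lborel. tricomi_kernel a b z s"
  have b1: "b - 1 \<notin> \<int>" using b Ints_add[of "b - 1" 1] by auto
  have bn: "b - 1 - real n \<notin> \<int>" for n using b1 Ints_add[of "b - 1 - real n" "real n"] by auto
  have b1': "1 - b \<notin> \<int>" using b Ints_diff[of 1 "1 - b"] by auto
  have b1k: "1 - b - real k \<notin> \<int>" for k using b1' Ints_add[of "1 - b - real k" "real k"] by auto
  let ?f = "\<lambda>n k. bincoeff a n * ((- z) ^ k / (fact k * (b - 1 - real n + real k)))"
  have J: "incomplete_Gamma (b - 1 - real n) z =
      Gamma (b - 1 - real n) / z powr (b - 1 - real n) - (\<Sum>k. (- z) ^ k / (fact k * (b - 1 - real n + real k)))"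
    and J': "summable (\<lambda>k. (- z) ^ k / (fact k * (b - 1 - real n + real k)))" for n
    using incomplete_Gamma_sums[OF bn z, of n] by (auto simp: sums_iff)

  \<comment> \<open>The complete Gamma parts: lowering the argument b - 1 by n divides by
    \<open>pochhammer (2 - b) n\<close>, the denominator of the first Kummer series.\<close>
  have S1: "(\<lambda>n. bincoeff a n * (Gamma (b - 1 - real n) / z powr (b - 1 - real n))) sums
      (Gamma (b - 1) * z powr (1 - b) * kummer_M (1 - a) (2 - b) (- z))"
  proof -
    have "bincoeff a n * (Gamma (b - 1 - real n) / z powr (b - 1 - real n)) =
       Gamma (b - 1) * z powr (1 - b) * (pochhammer (1 - a) n / pochhammer (2 - b) n * ((- z) ^ n / fact n))" for n
    proof -
      have "z powr (1 - b) * z ^ n = z powr (- (b - 1 - real n))"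
        using z powr_add[of z "1 - b" "real n"] by (simp add: powr_realpow algebra_simps)
      then have "z powr (1 - b) * z ^ n = inverse (z powr (b - 1 - real n))"
        by (simp only: powr_minus)
      moreover have "(- z) ^ n = (- 1) ^ n * z ^ n" by (rule power_minus)
      ultimately show ?thesis
        unfolding Gamma_diff_of_nat[OF b1] bincoeff_def
        by (simp add: divide_inverse mult_ac)
    qed
    then show ?thesis using sums_mult[OF kummer_M_sums[of "1 - a" "2 - b" "- z"], of "Gamma (b - 1) * z powr (1 - b)"]
      by simp
  qed

  obtain C where C: "C \<ge> 0" "\<And>n k. 1 / \<bar>b - 1 - real n + real k\<bar> \<le> C * (real k + 1) / (real n + 1)"
    using not_Ints_diff_bound[OF b1] by auto
  have "\<bar>?f n k\<bar> \<le> (\<bar>bincoeff a n\<bar> / (real n + 1)) * (C * ((real k + 1) * (z ^ k / fact k)))" for n k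
  proof -
    have "\<bar>?f n k\<bar> = \<bar>bincoeff a n\<bar> * (z ^ k / fact k) * (1 / \<bar>b - 1 - real n + real k\<bar>)"
      using z by (simp add: abs_mult power_abs)
    also have "\<dots> \<le> \<bar>bincoeff a n\<bar> * (z ^ k / fact k) * (C * (real k + 1) / (real n + 1))"
      using z by (intro mult_left_mono C) auto
    finally show ?thesis by (simp add: mult_ac)
  qed
  moreover have "summable (\<lambda>k. C * ((real k + 1) * (z ^ k / fact k)))"
  proof -
    \<comment> \<open>(2)_k / (1)_k = k + 1, so the majorant is itself a Kummer series.\<close>
    have "summable (\<lambda>k. norm (pochhammer 2 k / pochhammer 1 k * (z ^ k / fact k) :: real))"
      by (rule kummer_M_abs_summable)
    moreover have "pochhammer 2 k = (fact k * (real k + 1) :: real)" for k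
      by (induction k) (simp_all add: pochhammer_Suc algebra_simps)
    ultimately have "summable (\<lambda>k. (real k + 1) * (z ^ k / fact k))"
      using z by (simp add: pochhammer_fact[symmetric] abs_mult)
    then show ?thesis by (rule summable_mult)
  qed
  ultimately have S2: "(\<lambda>n. \<Sum>k. ?f n k) sums (\<Sum>k. \<Sum>n. ?f n k)"
    by (intro suminf_swap(1)[OF _ summable_bincoeff[OF a]])
  \<comment> \<open>After the exchange, the sum over n is the Beta series at s = 1 - b - k. Lowering
    both Gamma arguments by k yields the factors of the second Kummer series, and the two signs
    (-1)^k cancel.\<close>
  have inner: "(\<Sum>n. ?f n k) = - (Gamma (1 - b) * Gamma a * rGamma (a - b + 1)) *
      (pochhammer (b - a) k / pochhammer b k * ((- z) ^ k / fact k))" for k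
  proof -
    have "(\<lambda>n. bincoeff a n / (real n + (1 - b - real k))) sums (Gamma (1 - b - real k) * Gamma a * rGamma (1 - b - real k + a))"
      by (rule bincoeff_beta_sums[OF b1k a])
    from sums_mult[OF this, of "- ((- z) ^ k / fact k)"]
    have "(\<lambda>n. - ((- z) ^ k / fact k) * (bincoeff a n / (real n + (1 - b - real k)))) sums
      (- ((- z) ^ k / fact k) * (Gamma (1 - b - real k) * Gamma a * rGamma (1 - b - real k + a)))" .
    moreover have "- ((- z) ^ k / fact k) * (bincoeff a n / (real n + (1 - b - real k))) = ?f n k" for n
    proof -
      have "b - 1 - real n + real k = - (real n + (1 - b - real k))" by simp
      then show ?thesis by (simp only: mult_minus_right divide_minus_right) (simp add: mult_ac)
    qed
    ultimately have "(\<lambda>n. ?f n k) sums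
      (- ((- z) ^ k / fact k) * (Gamma (1 - b - real k) * Gamma a * rGamma (1 - b - real k + a)))"
      by (simp only:)
    then have S: "(\<Sum>n. ?f n k) = - ((- z) ^ k / fact k) * (Gamma (1 - b - real k) * Gamma a * rGamma (1 - b - real k + a))"
      by (rule sums_unique[symmetric])
    have 1: "Gamma (1 - b - real k) = (- 1) ^ k * Gamma (1 - b) / pochhammer b k"
      using Gamma_diff_of_nat[OF b1', of k] by simp
    have 2: "rGamma (1 - b - real k + a) = (- 1) ^ k * pochhammer (b - a) k * rGamma (a - b + 1)"
    proof -
      have "1 - b - real k + a = (a - b + 1) - real k" "1 - (a - b + 1) = b - a" by simp_all
      then show ?thesis using rGamma_diff_of_nat[of "a - b + 1" k] by (simp only:)
    qed
    have 3: "(- 1 :: real) ^ k * (- 1) ^ k = 1" by (simp flip: power_mult_distrib)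
    have "(\<Sum>n. ?f n k) = ((- 1) ^ k * (- 1) ^ k) * (- (Gamma (1 - b) * Gamma a * rGamma (a - b + 1)) *
      (pochhammer (b - a) k / pochhammer b k * ((- z) ^ k / fact k)))"
    proof -
      have "- Z * ((m * G / P) * A * (m * B * R)) = (m * m) * (- (G * A * R) * (B / P * Z))"
        for m Z G P A B R :: real by simp
      then show ?thesis unfolding S 1 2 by this
    qed
    then show ?thesis unfolding 3 by simp
  qed
  have "(\<Sum>k. \<Sum>n. ?f n k) = - (Gamma (1 - b) * Gamma a * rGamma (a - b + 1)) * kummer_M (b - a) b (- z)"
    unfolding inner using sums_mult[OF kummer_M_sums[of "b - a" b "- z"]] by (rule sums_unique[symmetric])
  with sums_diff[OF S1 S2]
  have "(\<lambda>n. bincoeff a n * (Gamma (b - 1 - real n) / z powr (b - 1 - real n)) - (\<Sum>k. ?f n k)) sums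
    (Gamma (b - 1) * z powr (1 - b) * kummer_M (1 - a) (2 - b) (- z) +
      Gamma (1 - b) * Gamma a * rGamma (a - b + 1) * kummer_M (b - a) b (- z))" by simp
  moreover have "bincoeff a n * (Gamma (b - 1 - real n) / z powr (b - 1 - real n)) - (\<Sum>k. ?f n k)
      = bincoeff a n * incomplete_Gamma (b - 1 - real n) z" for n
    unfolding J suminf_mult[OF J'] by (simp add: right_diff_distrib)
  ultimately have "?I = Gamma (b - 1) * z powr (1 - b) * kummer_M (1 - a) (2 - b) (- z) +
      Gamma (1 - b) * Gamma a * rGamma (a - b + 1) * kummer_M (b - a) b (- z)"
    using tricomi_kernel_sums[OF a z, of b] sums_unique2 by simp
  moreover have "kummer_M a b z = exp z * kummer_M (b - a) b (- z)" by (rule kummer_transformation[OF b])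
  moreover have "kummer_M (a - b + 1) (2 - b) z = exp z * kummer_M (1 - a) (2 - b) (- z)"
  proof -
    have "2 - b \<notin> \<int>" using b Ints_diff[of 2 "2 - b"] by auto
    from kummer_transformation[OF this, of "a - b + 1" z] show ?thesis by (simp add: algebra_simps)
  qed
  moreover have "rGamma a * Gamma a = 1" using less_imp_neq[OF Gamma_real_pos[OF a]] by (simp add: rGamma_inverse_Gamma)
  ultimately show ?thesis
    unfolding tricomi_U_nonint_def by (simp add: algebra_simps)
qed


section \<open>The symmetry of U and integer second parameters\<close>

text \<open>The two Kummer terms trade places under a \<mapsto> a - b + 1, b \<mapsto> 2 - b. For
  U(1 - \<alpha>, 2 - \<alpha> - \<beta>, z) the new first parameter is \<beta>, positive in the use
  below.\<close>

lemma tricomi_U_nonint_swap: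
  assumes "z > 0"
  shows "tricomi_U_nonint a b z = z powr (1 - b) * tricomi_U_nonint (a - b + 1) (2 - b) z"
proof -
  have "a - b + 1 - (2 - b) + 1 = a" "2 - (2 - b) = b" "1 - (2 - b) = b - 1" "2 - b - 1 = 1 - b" by simp_all
  moreover have "z powr (1 - b) * z powr (b - 1) = 1" using assms by (simp flip: powr_add)
  then have "z powr (1 - b) * (X * z powr (b - 1) * Y + W) = X * Y + z powr (1 - b) * W" for X Y W
    by (simp add: distrib_left mult_ac)
  ultimately show ?thesis unfolding tricomi_U_nonint_def by (simp only:) simp
qed

text \<open>In the swapped form the kernel is (s - 1)^(a-\<beta>) s^(-a) exp(-z s), where \<beta>
  enters one power only. That power is monotone in \<beta> on each side of s = 2, so the kernels at
  b - d and b + d together dominate all those between.\<close>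

lemma tendsto_integral_tricomi_kernel:
  assumes b: "a - b + 1 > 0" and z: "z > 0"
  shows "((\<lambda>\<beta>. LINT s:{1<..}|lborel. tricomi_kernel (a - \<beta> + 1) (2 - \<beta>) z s) \<longlongrightarrow>
    (LINT s:{1<..}|lborel. tricomi_kernel (a - b + 1) (2 - b) z s)) (at b)"
proof -
  let ?k = "\<lambda>\<beta> s. indicator {1<..} s *\<^sub>R tricomi_kernel (a - \<beta> + 1) (2 - \<beta>) z s"
  \<comment> \<open>Half of a - b + 1, so that a - \<beta> + 1 is still positive, namely d, at the
    right end \<beta> = b + d.\<close>
  define d where "d = (a - b + 1) / 2"
  have d: "d > 0" using b by (simp add: d_def)
  let ?w = "\<lambda>s. ?k (b - d) s + ?k (b + d) s"
  have k: "?k \<beta> s = indicator {1<..} s * ((s - 1) powr (a - \<beta>) * s powr (- a) * exp (- z * s))" for \<beta> s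
  proof (cases "s > 1")
    case True
    have "(1 - 1 / s) powr (a - \<beta>) = (s - 1) powr (a - \<beta>) * s powr (\<beta> - a)"
    proof -
      have "1 - 1 / s = (s - 1) / s" using True by (simp add: field_simps)
      then have "(1 - 1 / s) powr (a - \<beta>) = (s - 1) powr (a - \<beta>) / s powr (a - \<beta>)"
        using True by (simp add: powr_divide)
      then show ?thesis using powr_minus_divide[of s "a - \<beta>"] by simp
    qed
    moreover have "s powr (\<beta> - a) * s powr (- \<beta>) = s powr (- a)" by (simp flip: powr_add)
    ultimately show ?thesis using True by (simp add: tricomi_kernel_def mult.assoc)
  qed simp
  have ki: "integrable lborel (?k \<beta>)" if "a - \<beta> + 1 > 0" for \<beta>
    using integrable_tricomi_kernel[OF that z, of "2 - \<beta>"] by (simp add: set_integrable_def)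
  have bound: "norm (?k \<beta> s) \<le> ?w s" if \<beta>: "\<bar>\<beta> - b\<bar> < d" for \<beta> s
  proof (cases "s > 1")
    case True
    have "(s - 1) powr (a - \<beta>) \<le> (s - 1) powr (a - (b - d)) + (s - 1) powr (a - (b + d))"
    proof (cases "s \<ge> 2")
      case True
      then have "(s - 1) powr (a - \<beta>) \<le> (s - 1) powr (a - (b - d))" using \<beta> by (intro powr_mono) auto
      then show ?thesis by (simp add: add_increasing2)
    next
      case False
      then have "(s - 1) powr (a - \<beta>) \<le> (s - 1) powr (a - (b + d))" using \<beta> \<open>s > 1\<close> by (intro powr_mono') auto
      then show ?thesis by (simp add: add_increasing)
    qed
    then have "(s - 1) powr (a - \<beta>) * (s powr (- a) * exp (- z * s)) \<le>
      ((s - 1) powr (a - (b - d)) + (s - 1) powr (a - (b + d))) * (s powr (- a) * exp (- z * s))"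
      by (rule mult_right_mono) simp
    moreover have "norm (?k \<beta> s) = (s - 1) powr (a - \<beta>) * (s powr (- a) * exp (- z * s))"
      unfolding k using True by (simp add: abs_mult)
    moreover have "?w s = ((s - 1) powr (a - (b - d)) + (s - 1) powr (a - (b + d))) * (s powr (- a) * exp (- z * s))"
      unfolding k using True by (simp add: distrib_right)
    ultimately show ?thesis by (simp only:)
  qed simp
  show ?thesis unfolding set_lebesgue_integral_def tendsto_at_iff_sequentially o_def
  proof (intro allI impI)
    fix X :: "nat \<Rightarrow> real" assume "X \<longlonglongrightarrow> b"
    moreover from this have "\<forall>\<^sub>F n in sequentially. dist (X n) b < d"
      using d by (simp add: tendstoD)
    then obtain N where N: "\<And>n. n \<ge> N \<Longrightarrow> \<bar>X n - b\<bar> < d"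
      by (auto simp: eventually_sequentially dist_real_def)
    ultimately have X: "(\<lambda>n. X (n + N)) \<longlonglongrightarrow> b" by (intro LIMSEQ_ignore_initial_segment)
    have "(\<lambda>n. \<integral>s. ?k (X (n + N)) s \<partial>lborel) \<longlonglongrightarrow> (\<integral>s. ?k b s \<partial>lborel)"
    proof (rule integral_dominated_convergence[where w="?w"])
      show "integrable lborel ?w" using b by (intro Bochner_Integration.integrable_add ki) (auto simp: d_def field_simps)
      show "AE s in lborel. (\<lambda>n. ?k (X (n + N)) s) \<longlonglongrightarrow> ?k b s"
      proof (rule AE_I2)
        fix s :: real
        show "(\<lambda>n. ?k (X (n + N)) s) \<longlonglongrightarrow> ?k b s"
        proof (cases "s > 1")
          case True
          then show ?thesis unfolding k by (intro tendsto_intros X) auto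
        qed simp
      qed
      show "AE s in lborel. norm (?k (X (n + N)) s) \<le> ?w s" for n
        by (intro AE_I2 bound N) simp
      show "?k b \<in> borel_measurable lborel" unfolding k by measurable
      show "?k (X (n + N)) \<in> borel_measurable lborel" for n unfolding k by measurable
    qed
    then show "(\<lambda>n. \<integral>s. ?k (X n) s \<partial>lborel) \<longlonglongrightarrow> (\<integral>s. ?k b s \<partial>lborel)"
      by (rule LIMSEQ_offset)
  qed
qed

text \<open>For integer b, the right-hand side is continuous in \<beta> at b and agrees with the
  non-integer formula nearby, so it is the limit that defines U there.\<close>

theorem tricomi_U_integral:
  assumes b: "a - b + 1 > 0" and z: "z > 0"
  shows "tricomi_U a b z = z powr (1 - b) * (exp z * rGamma (a - b + 1) *
    (LINT s:{1<..}|lborel. tricomi_kernel (a - b + 1) (2 - b) z s))" (is "_ = ?F b")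
proof -
  have nonint: "tricomi_U_nonint a \<beta> z = ?F \<beta>" if "a - \<beta> + 1 > 0" "\<beta> \<notin> \<int>" for \<beta>
  proof -
    have "2 - \<beta> \<notin> \<int>" using that(2) Ints_diff[of 2 "2 - \<beta>"] by auto
    then show ?thesis using tricomi_U_nonint_swap[OF z, of a \<beta>] tricomi_U_nonint_integral[OF that(1) _ z] by simp
  qed
  show ?thesis
  proof (cases "b \<in> \<int>")
    case False
    then show ?thesis using nonint[OF b] by (simp add: tricomi_U_def)
  next
    case True
    have "((\<lambda>\<beta>. rGamma (a - \<beta> + 1)) \<longlongrightarrow> rGamma (a - b + 1)) (at b)"
      using isCont_rGamma[of b "\<lambda>\<beta>. a - \<beta> + 1"] by (simp add: isCont_def tendsto_intros)
    then have "(?F \<longlongrightarrow> ?F b) (at b)"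
      using z by (intro tendsto_intros tendsto_integral_tricomi_kernel b) auto
    moreover have "\<forall>\<^sub>F \<beta> in at b. ?F \<beta> = tricomi_U_nonint a \<beta> z"
    proof -
      \<comment> \<open>Radius at most 1 excludes all other integers; radius at most a - b + 1 keeps
        a - \<beta> + 1 positive.\<close>
      have "?F \<beta> = tricomi_U_nonint a \<beta> z" if "\<beta> \<noteq> b" "dist \<beta> b < min 1 (a - b + 1)" for \<beta>
      proof (rule nonint[symmetric])
        show "a - \<beta> + 1 > 0" using that(2) by (auto simp: dist_real_def)
        show "\<beta> \<notin> \<int>"
        proof
          assume "\<beta> \<in> \<int>"
          with True have "\<beta> - b \<in> \<int>" by (rule Ints_diff[rotated])
          then show False using that Ints_nonzero_abs_less1[of "\<beta> - b"] by (auto simp: dist_real_def)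
        qed
      qed
      then show ?thesis unfolding eventually_at using b
        by (intro exI[of _ "min 1 (a - b + 1)"]) auto
    qed
    ultimately have "((\<lambda>\<beta>. tricomi_U_nonint a \<beta> z) \<longlongrightarrow> ?F b) (at b)"
      by (rule Lim_transform_eventually)
    then have "Lim (at b) (\<lambda>\<beta>. tricomi_U_nonint a \<beta> z) = ?F b"
      by (intro tendsto_Lim) auto
    then show ?thesis using True by (simp add: tricomi_U_def)
  qed
qed

section \<open>Gamma densities\<close>

lemma suminf_swap_ennreal:
  fixes f :: "nat \<Rightarrow> nat \<Rightarrow> ennreal"
  shows "(\<Sum>i. \<Sum>j. f i j) = (\<Sum>j. \<Sum>i. f i j)"
  using nn_integral_suminf[of "\<lambda>j i. f i j" "count_space UNIV"]
  by (simp add: nn_integral_count_space_nat)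

text \<open>Summation along the diagonals i + j = k. It gives both the convolution of Poisson
  weights and the order of summation in \<open>summand_density\<close>.\<close>

lemma suminf_triangle_ennreal:
  fixes f :: "nat \<Rightarrow> nat \<Rightarrow> ennreal"
  shows "(\<Sum>i. \<Sum>j. f i j) = (\<Sum>k. \<Sum>j\<le>k. f (k - j) j)"
proof -
  let ?g = "\<lambda>j k. if j \<le> k then f (k - j) j else 0"
  have "(\<Sum>i. f i j) = (\<Sum>k. ?g j k)" for j
    using suminf_offset[of "?g j" j] by simp
  then have "(\<Sum>i. \<Sum>j. f i j) = (\<Sum>k. \<Sum>j. ?g j k)"
    by (subst (1 2) suminf_swap_ennreal) simp
  also have "(\<lambda>k. \<Sum>j. ?g j k) = (\<lambda>k. \<Sum>j\<le>k. f (k - j) j)"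
    by (rule ext, subst suminf_finite[of "{..k}" for k]) auto
  finally show ?thesis .
qed

lemma nn_integral_suminf_mult_suminf:
  fixes f g :: "nat \<Rightarrow> 'a \<Rightarrow> ennreal"
  assumes [measurable]: "\<And>i. f i \<in> borel_measurable M" "\<And>i. g i \<in> borel_measurable M"
  shows "(\<integral>\<^sup>+x. (\<Sum>i. f i x) * (\<Sum>j. g j x) \<partial>M) = (\<Sum>i. \<Sum>j. \<integral>\<^sup>+x. f i x * g j x \<partial>M)"
proof -
  have "(\<integral>\<^sup>+x. (\<Sum>i. f i x) * (\<Sum>j. g j x) \<partial>M) = (\<integral>\<^sup>+x. (\<Sum>i. \<Sum>j. f i x * g j x) \<partial>M)"
    by simp
  also have "\<dots> = (\<Sum>i. \<Sum>j. \<integral>\<^sup>+x. f i x * g j x \<partial>M)"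
    by (subst nn_integral_suminf, measurable, subst nn_integral_suminf) auto
  finally show ?thesis .
qed

section \<open>Sums and differences of Gamma variables\<close>

definition gamma_density :: "real \<Rightarrow> real \<Rightarrow> real \<Rightarrow> real" where
  "gamma_density \<alpha> r x = (if 0 < x then r powr \<alpha> * x powr (\<alpha> - 1) * exp (- r * x) / Gamma \<alpha> else 0)"

lemma gamma_density_measurable [measurable]: "gamma_density \<alpha> r \<in> borel_measurable borel"
  unfolding gamma_density_def by measurable

lemma gamma_density_nonneg: "\<alpha> > 0 \<Longrightarrow> 0 \<le> gamma_density \<alpha> r x"
  by (simp add: gamma_density_def Gamma_real_pos less_imp_le)

lemma nn_integral_gamma_density:
  assumes "\<alpha> > 0" "r > 0"
  shows "(\<integral>\<^sup>+x. gamma_density \<alpha> r x \<partial>lborel) = 1"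
proof -
  have "(\<integral>\<^sup>+x. gamma_density \<alpha> r x \<partial>lborel) = (\<integral>\<^sup>+x. ennreal (r powr \<alpha> / Gamma \<alpha>) *
      ennreal (indicator {0..} x * (x powr (\<alpha> - 1) * exp (- r * x))) \<partial>lborel)"
    using assms by (intro nn_integral_cong)
      (auto simp: gamma_density_def indicator_def Gamma_real_pos less_imp_le simp flip: ennreal_mult)
  also have "\<dots> = ennreal (r powr \<alpha> / Gamma \<alpha>) * ennreal (Gamma \<alpha> / r powr \<alpha>)"
    by (subst nn_integral_cmult) (auto simp: nn_integral_Gamma_kernel[OF assms, simplified])
  also have "\<dots> = ennreal ((r powr \<alpha> / Gamma \<alpha>) * (Gamma \<alpha> / r powr \<alpha>))"
    using assms by (intro ennreal_mult[symmetric]) (auto simp: Gamma_real_pos less_imp_le)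
  also have "(r powr \<alpha> / Gamma \<alpha>) * (Gamma \<alpha> / r powr \<alpha>) = 1"
    using assms less_imp_neq[OF Gamma_real_pos[OF assms(1)]] by simp
  finally show ?thesis by simp
qed

text \<open>For x > 0 the exponentials combine to exp(-r x), and y = x t leaves a Beta integral over
  t in [0, 1].\<close>

lemma gamma_density_convolution:
  assumes \<alpha>: "\<alpha> > 0" and \<beta>: "\<beta> > 0" and r: "r > 0"
  shows "(\<integral>\<^sup>+y. ennreal (gamma_density \<alpha> r (x - y)) * ennreal (gamma_density \<beta> r y) \<partial>lborel)
    = ennreal (gamma_density (\<alpha> + \<beta>) r x)"
proof (cases "x > 0")
  case False
  have "gamma_density \<alpha> r (x - y) = 0 \<or> gamma_density \<beta> r y = 0" for y
    using False by (auto simp: gamma_density_def)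
  then have "ennreal (gamma_density \<alpha> r (x - y)) * ennreal (gamma_density \<beta> r y) = 0" for y
    by (metis ennreal_0 mult_zero_left mult_zero_right)
  then show ?thesis using False by (simp only:) (simp add: gamma_density_def)
next
  case x: True
  define c where "c = r powr (\<alpha> + \<beta>) * x powr (\<alpha> + \<beta> - 2) * exp (- r * x) / (Gamma \<alpha> * Gamma \<beta>)"
  have c: "c \<ge> 0" using \<alpha> \<beta> by (simp add: c_def Gamma_real_pos less_imp_le)
  let ?b = "\<lambda>t. indicator {0..1} t * (t powr (\<beta> - 1) * (1 - t) powr (\<alpha> - 1)) :: real"
  have eq: "ennreal (gamma_density \<alpha> r (x - (0 + x * t))) * ennreal (gamma_density \<beta> r (0 + x * t)) = ennreal c * ennreal (?b t)" for t
  proof (cases "0 < t \<and> t < 1")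
    case t: True
    have 1: "x - x * t = x * (1 - t)" by (simp add: algebra_simps)
    have "exp (- r * (x * (1 - t))) * exp (- r * (x * t)) = exp (- r * x)"
      by (simp add: algebra_simps flip: exp_add)
    moreover have "x powr (\<alpha> - 1) * x powr (\<beta> - 1) = x powr (\<alpha> + \<beta> - 2)" by (simp flip: powr_add)
    moreover have "r powr \<alpha> * r powr \<beta> = r powr (\<alpha> + \<beta>)" by (simp flip: powr_add)
    moreover have "(A * (xa * u) * e1 / Ga) * (B * (xb * w) * e2 / Gb) =
      (A * B * (xa * xb) * (e1 * e2) / (Ga * Gb)) * (w * u)"
      for A B xa xb w e1 e2 Ga Gb u :: real by simp
    moreover have "gamma_density \<alpha> r (x * (1 - t)) =
        r powr \<alpha> * (x powr (\<alpha> - 1) * (1 - t) powr (\<alpha> - 1)) * exp (- r * (x * (1 - t))) / Gamma \<alpha>"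
      using x t by (simp add: gamma_density_def powr_mult)
    moreover have "gamma_density \<beta> r (x * t) =
        r powr \<beta> * (x powr (\<beta> - 1) * t powr (\<beta> - 1)) * exp (- r * (x * t)) / Gamma \<beta>"
      using x t by (simp add: gamma_density_def powr_mult)
    moreover have "?b t = t powr (\<beta> - 1) * (1 - t) powr (\<alpha> - 1)" using t by simp
    ultimately have "gamma_density \<alpha> r (x - x * t) * gamma_density \<beta> r (x * t) = c * ?b t"
      unfolding 1 c_def by (simp only:)
    then show ?thesis using c by (simp add: gamma_density_nonneg \<alpha> \<beta> flip: ennreal_mult)
  next
    case False
    then have "gamma_density \<alpha> r (x - x * t) = 0 \<or> gamma_density \<beta> r (x * t) = 0"
      using x by (auto simp: gamma_density_def zero_less_mult_iff not_less)
    moreover have "?b t = 0" using False by (auto simp: indicator_def)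
    ultimately show ?thesis by auto
  qed
  have "has_bochner_integral lborel ?b (Beta \<beta> \<alpha>)"
    by (intro has_bochner_integral_of_has_integral has_integral_Beta_real \<alpha> \<beta>) auto
  then have b: "(\<integral>\<^sup>+t. ennreal (?b t) \<partial>lborel) = ennreal (Beta \<beta> \<alpha>)"
    by (subst nn_integral_eq_integral) (auto simp: has_bochner_integral_iff)
  have "(\<integral>\<^sup>+y. ennreal (gamma_density \<alpha> r (x - y)) * ennreal (gamma_density \<beta> r y) \<partial>lborel)
    = ennreal \<bar>x\<bar> * (\<integral>\<^sup>+t. ennreal c * ennreal (?b t) \<partial>lborel)"
  proof -
    have "(\<integral>\<^sup>+y. ennreal (gamma_density \<alpha> r (x - y)) * ennreal (gamma_density \<beta> r y) \<partial>lborel)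
      = \<bar>x\<bar> * (\<integral>\<^sup>+t. ennreal (gamma_density \<alpha> r (x - (0 + x * t))) * ennreal (gamma_density \<beta> r (0 + x * t)) \<partial>lborel)"
      using x by (intro nn_integral_real_affine) auto
    then show ?thesis unfolding eq .
  qed
  also have "\<dots> = ennreal x * (ennreal c * ennreal (Beta \<beta> \<alpha>))"
    using x by (subst nn_integral_cmult) (simp_all add: b[simplified])
  also have "\<dots> = ennreal (x * (c * Beta \<beta> \<alpha>))"
  proof -
    have "Beta \<beta> \<alpha> \<ge> 0" using \<alpha> \<beta> by (simp add: Beta_def Gamma_real_pos less_imp_le add_pos_pos)
    then show ?thesis using x c by (simp add: ennreal_mult)
  qed
  also have "x * (c * Beta \<beta> \<alpha>) = gamma_density (\<alpha> + \<beta>) r x"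
  proof -
    have "x powr (\<alpha> + \<beta> - 1) = x * x powr (\<alpha> + \<beta> - 2)"
      using x powr_add[of x 1 "\<alpha> + \<beta> - 2"] by simp
    then show ?thesis using x Gamma_real_pos[OF \<alpha>] Gamma_real_pos[OF \<beta>]
      by (simp add: gamma_density_def c_def Beta_def add.commute)
  qed
  finally show ?thesis .
qed

text \<open>With y = x (t - 1), hence x + y = x t, the integrand is a constant times
  \<open>tricomi_kernel\<close> with parameters \<beta>, \<alpha> + \<beta> and z = (r + s) x. The
  factor (r + s)^(1-\<alpha>-\<beta>) offsets the power z^(\<alpha>+\<beta>-1) from the symmetry of
  U, and the sign of U follows from that of the kernel.\<close>

lemma gamma_density_difference:
  assumes \<alpha>: "\<alpha> > 0" and \<beta>: "\<beta> > 0" and r: "r > 0" and s: "s > 0" and x: "x > 0"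
  shows "(\<integral>\<^sup>+y. ennreal (gamma_density \<alpha> r (x + y)) * ennreal (gamma_density \<beta> s y) \<partial>lborel)
    = ennreal (r powr \<alpha> * s powr \<beta> * (r + s) powr (1 - \<alpha> - \<beta>) * exp (- r * x) / Gamma \<alpha> *
        tricomi_U (1 - \<alpha>) (2 - \<alpha> - \<beta>) ((r + s) * x))"
    and tricomi_U_nonneg: "tricomi_U (1 - \<alpha>) (2 - \<alpha> - \<beta>) ((r + s) * x) \<ge> 0"
proof -
  define z where "z = (r + s) * x"
  have z: "z > 0" using r s x by (simp add: z_def)
  let ?k = "\<lambda>t. indicator {1<..} t * tricomi_kernel \<beta> (\<alpha> + \<beta>) z t"
  define c where "c = r powr \<alpha> * s powr \<beta> * x powr (\<alpha> + \<beta> - 2) * exp (s * x) / (Gamma \<alpha> * Gamma \<beta>)"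
  have c: "c \<ge> 0" using \<alpha> \<beta> by (simp add: c_def Gamma_real_pos less_imp_le)
  have eq: "ennreal (gamma_density \<alpha> r (x + (- x + x * t))) * ennreal (gamma_density \<beta> s (- x + x * t)) = ennreal c * ennreal (?k t)" for t
  proof (cases "t > 1")
    case t: True
    have 1: "- x + x * t = x * t * (1 - 1 / t)" using t by (simp add: field_simps)
    have "exp (- r * (x * t)) * exp (- s * (- x + x * t)) = exp (s * x) * exp (- z * t)"
      by (simp add: z_def algebra_simps flip: exp_add)
    moreover have "gamma_density \<alpha> r (x * t) =
        r powr \<alpha> * (x powr (\<alpha> - 1) * t powr (\<alpha> - 1)) * exp (- r * (x * t)) / Gamma \<alpha>"
      using x t by (simp add: gamma_density_def powr_mult)
    moreover have "gamma_density \<beta> s (- x + x * t) = s powr \<beta> *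
        (x powr (\<beta> - 1) * t powr (\<beta> - 1) * (1 - 1 / t) powr (\<beta> - 1)) * exp (- s * (- x + x * t)) / Gamma \<beta>"
    proof -
      have "(- x + x * t) powr (\<beta> - 1) = x powr (\<beta> - 1) * t powr (\<beta> - 1) * (1 - 1 / t) powr (\<beta> - 1)"
        unfolding 1 using x t by (simp add: powr_mult)
      moreover have "- x + x * t > 0" using t x by simp
      ultimately show ?thesis unfolding gamma_density_def by (simp only: if_True)
    qed
    moreover have "?k t = (1 - 1 / t) powr (\<beta> - 1) * (t powr (\<alpha> + \<beta> - 2) * exp (- z * t))"
      using t by (simp add: tricomi_kernel_def)
    moreover have "x powr (\<alpha> - 1) * x powr (\<beta> - 1) = x powr (\<alpha> + \<beta> - 2)" by (simp flip: powr_add)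
    moreover have "t powr (\<alpha> - 1) * t powr (\<beta> - 1) = t powr (\<alpha> + \<beta> - 2)" by (simp flip: powr_add)
    moreover have "(A * (xa * ta) * e1 / Ga) * (B * (xb * tb * u) * e2 / Gb) =
      (A * B * (xa * xb) / (Ga * Gb)) * (u * (ta * tb) * (e1 * e2))"
      for A B xa xb ta tb e1 e2 Ga Gb u :: real by simp
    ultimately have "gamma_density \<alpha> r (x * t) * gamma_density \<beta> s (- x + x * t) = c * ?k t"
      unfolding c_def by (simp only:) simp
    then have "ennreal (gamma_density \<alpha> r (x * t)) * ennreal (gamma_density \<beta> s (- x + x * t)) = ennreal (c * ?k t)"
      by (metis ennreal_mult gamma_density_nonneg \<alpha> \<beta>)
    also have "\<dots> = ennreal c * ennreal (?k t)"
      using c by (intro ennreal_mult) (simp_all add: tricomi_kernel_def)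
    finally show ?thesis by simp
  next
    case False
    then have "\<not> - x + x * t > 0" using x by simp
    then show ?thesis using False by (simp add: gamma_density_def)
  qed
  have i: "integrable lborel ?k"
    using integrable_tricomi_kernel[OF \<beta> z, of "\<alpha> + \<beta>"] by (simp add: set_integrable_def)
  define I where "I = (LINT t:{1<..}|lborel. tricomi_kernel \<beta> (\<alpha> + \<beta>) z t)"
  have kn: "0 \<le> ?k t" for t by (simp add: tricomi_kernel_def)
  have I: "I \<ge> 0" unfolding I_def set_lebesgue_integral_def using kn by (intro Bochner_Integration.integral_nonneg) simp
  have k: "(\<integral>\<^sup>+t. ennreal (?k t) \<partial>lborel) = ennreal I"
    using i kn by (subst nn_integral_eq_integral) (auto simp: I_def set_lebesgue_integral_def)
  have U: "tricomi_U (1 - \<alpha>) (2 - \<alpha> - \<beta>) z = z powr (\<alpha> + \<beta> - 1) * (exp z * rGamma \<beta> * I)"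
  proof -
    have "1 - \<alpha> - (2 - \<alpha> - \<beta>) + 1 = \<beta>" "2 - (2 - \<alpha> - \<beta>) = \<alpha> + \<beta>" "1 - (2 - \<alpha> - \<beta>) = \<alpha> + \<beta> - 1" by simp_all
    then show ?thesis using tricomi_U_integral[of "1 - \<alpha>" "2 - \<alpha> - \<beta>" z] \<beta> z unfolding I_def by (simp only:)
  qed
  then show "tricomi_U (1 - \<alpha>) (2 - \<alpha> - \<beta>) ((r + s) * x) \<ge> 0"
    using I Gamma_real_pos[OF \<beta>] by (simp add: z_def[symmetric] rGamma_inverse_Gamma)
  have "(\<integral>\<^sup>+y. ennreal (gamma_density \<alpha> r (x + y)) * ennreal (gamma_density \<beta> s y) \<partial>lborel)
    = ennreal \<bar>x\<bar> * (\<integral>\<^sup>+t. ennreal c * ennreal (?k t) \<partial>lborel)"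
  proof -
    have "(\<integral>\<^sup>+y. ennreal (gamma_density \<alpha> r (x + y)) * ennreal (gamma_density \<beta> s y) \<partial>lborel)
      = \<bar>x\<bar> * (\<integral>\<^sup>+t. ennreal (gamma_density \<alpha> r (x + (- x + x * t))) * ennreal (gamma_density \<beta> s (- x + x * t)) \<partial>lborel)"
      using x by (intro nn_integral_real_affine) auto
    then show ?thesis unfolding eq .
  qed
  also have "\<dots> = ennreal \<bar>x\<bar> * (ennreal c * ennreal I)"
    using i by (subst nn_integral_cmult) (simp_all add: k[simplified])
  also have "\<dots> = ennreal (x * (c * I))" using x c I by (simp add: ennreal_mult)
  also have "x * (c * I) = r powr \<alpha> * s powr \<beta> * (r + s) powr (1 - \<alpha> - \<beta>) * exp (- r * x) / Gamma \<alpha> *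
        tricomi_U (1 - \<alpha>) (2 - \<alpha> - \<beta>) ((r + s) * x)"
  proof -
    have "(r + s) powr (1 - \<alpha> - \<beta>) * z powr (\<alpha> + \<beta> - 1) = x powr (\<alpha> + \<beta> - 1)"
    proof -
      have "z powr (\<alpha> + \<beta> - 1) = (r + s) powr (\<alpha> + \<beta> - 1) * x powr (\<alpha> + \<beta> - 1)"
        using r s x by (simp add: z_def powr_mult)
      moreover have "(r + s) powr (1 - \<alpha> - \<beta>) * (r + s) powr (\<alpha> + \<beta> - 1) = 1"
        using r s by (simp flip: powr_add)
      ultimately show ?thesis by (simp add: mult.assoc[symmetric])
    qed
    moreover have "x powr (\<alpha> + \<beta> - 1) = x * x powr (\<alpha> + \<beta> - 2)"
      using x powr_add[of x 1 "\<alpha> + \<beta> - 2"] by simp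
    moreover have "exp (s * x) = exp (- r * x) * exp z" by (simp add: z_def algebra_simps flip: exp_add)
    moreover have "x * (A * B * X * (e * E) / (Ga * Gb) * I) = A * B * R * e / Ga * (Z * (E * inverse Gb * I))"
      if "R * Z = x * X" for A B X e E Ga Gb R Z :: real
      using that[symmetric] by (simp add: divide_inverse)
    ultimately show ?thesis unfolding z_def[symmetric] U c_def rGamma_inverse_Gamma by simp
  qed
  finally show "(\<integral>\<^sup>+y. ennreal (gamma_density \<alpha> r (x + y)) * ennreal (gamma_density \<beta> s y) \<partial>lborel)
    = ennreal (r powr \<alpha> * s powr \<beta> * (r + s) powr (1 - \<alpha> - \<beta>) * exp (- r * x) / Gamma \<alpha> *
        tricomi_U (1 - \<alpha>) (2 - \<alpha> - \<beta>) ((r + s) * x))" .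
qed

section \<open>Noncentral chi-square laws with a real number of degrees of freedom\<close>

definition poisson_weight :: "real \<Rightarrow> nat \<Rightarrow> real" where
  "poisson_weight c i = exp (- c) * c ^ i / fact i"

lemma poisson_weight_nonneg: "c \<ge> 0 \<Longrightarrow> 0 \<le> poisson_weight c i"
  by (simp add: poisson_weight_def)

lemma suminf_poisson_weight: "c \<ge> 0 \<Longrightarrow> (\<Sum>i. ennreal (poisson_weight c i)) = 1"
proof -
  assume c: "c \<ge> 0"
  have "(\<lambda>i. exp (- c) * (c ^ i /\<^sub>R fact i)) sums (exp (- c) * exp c)"
    by (intro sums_mult exp_converges)
  moreover have "(\<lambda>i. exp (- c) * (c ^ i /\<^sub>R fact i)) = poisson_weight c"
    by (rule ext) (simp add: poisson_weight_def divide_inverse)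
  moreover have "exp (- c) * exp c = 1" by (simp flip: exp_add)
  ultimately have "poisson_weight c sums 1" by (simp only:)
  with poisson_weight_nonneg[OF c] have "(\<Sum>i. ennreal (poisson_weight c i)) = ennreal 1"
    by (rule suminf_ennreal_eq)
  then show ?thesis by (simp only: ennreal_1)
qed

text \<open>The binomial theorem for (d + c)^k.\<close>

lemma poisson_weight_convolution:
  "(\<Sum>j\<le>k. poisson_weight c (k - j) * poisson_weight d j) = poisson_weight (c + d) k"
proof -
  have "(\<Sum>j\<le>k. poisson_weight c (k - j) * poisson_weight d j) =
    (\<Sum>j\<le>k. exp (- c - d) / fact k * (of_nat (k choose j) * d ^ j * c ^ (k - j)))"
  proof (intro sum.cong refl)
    fix j assume "j \<in> {..k}"
    then have "real (k choose j) = fact k / (fact j * fact (k - j))" by (simp add: binomial_fact)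
    moreover have "exp (- c - d) = exp (- c) * exp (- d)" by (simp flip: exp_add)
    ultimately show "poisson_weight c (k - j) * poisson_weight d j =
        exp (- c - d) / fact k * (of_nat (k choose j) * d ^ j * c ^ (k - j))"
      by (simp add: poisson_weight_def) (simp add: mult_ac)
  qed
  also have "\<dots> = exp (- c - d) / fact k * (d + c) ^ k"
    by (simp add: binomial_ring sum_distrib_left)
  finally show ?thesis by (simp add: poisson_weight_def add.commute)
qed

text \<open>
  The density of \<open>1/(2r)\<close> times a noncentral chi-square variable with \<open>q\<close> degrees of freedom and
  noncentrality parameter \<open>2 q l\<close>.
\<close>

definition gamma_mixture :: "real \<Rightarrow> real \<Rightarrow> real \<Rightarrow> real \<Rightarrow> ennreal" where
  "gamma_mixture q l r x = (\<Sum>i. ennreal (poisson_weight (q * l) i) * ennreal (gamma_density (q / 2 + real i) r x))"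

lemma gamma_mixture_measurable [measurable]: "gamma_mixture q l r \<in> borel_measurable borel"
  unfolding gamma_mixture_def by measurable


lemma nn_integral_gamma_mixture:
  assumes l: "l \<ge> 0" and r: "r > 0" and q: "q > 0"
  shows "(\<integral>\<^sup>+x. gamma_mixture q l r x \<partial>lborel) = 1"
proof -
  have "(\<integral>\<^sup>+x. gamma_mixture q l r x \<partial>lborel) =
    (\<Sum>i. ennreal (poisson_weight (q * l) i) * (\<integral>\<^sup>+x. ennreal (gamma_density (q / 2 + real i) r x) \<partial>lborel))"
    unfolding gamma_mixture_def by (simp add: nn_integral_suminf nn_integral_cmult)
  also have "\<dots> = (\<Sum>i. ennreal (poisson_weight (q * l) i))"
    using q r by (simp add: nn_integral_gamma_density add_pos_nonneg)
  finally show ?thesis using suminf_poisson_weight[of "q * l"] q l by simp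
qed

text \<open>Components i and j convolve to a Gamma density depending on i + j only, so the weights
  on each diagonal form a Poisson convolution. The shape q/2 and the Poisson mean q l are both
  linear in q, which makes this a semigroup.\<close>

lemma gamma_mixture_convolution:
  assumes l: "l \<ge> 0" and r: "r > 0" and p: "p > 0" and q: "q > 0"
  shows "(\<integral>\<^sup>+y. gamma_mixture p l r (x - y) * gamma_mixture q l r y \<partial>lborel) = gamma_mixture (p + q) l r x"
proof -
  let ?g = "\<lambda>k. ennreal (gamma_density ((p + q) / 2 + real k) r x)"
  have "(\<integral>\<^sup>+y. ennreal (poisson_weight (p * l) i) * ennreal (gamma_density (p / 2 + real i) r (x - y)) *
      (ennreal (poisson_weight (q * l) j) * ennreal (gamma_density (q / 2 + real j) r y)) \<partial>lborel) =
      ennreal (poisson_weight (p * l) i * poisson_weight (q * l) j) * ?g (i + j)" (is "?L = _") for i j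
  proof -
    have "?L = (\<integral>\<^sup>+y. ennreal (poisson_weight (p * l) i * poisson_weight (q * l) j) *
      (ennreal (gamma_density (p / 2 + real i) r (x - y)) * ennreal (gamma_density (q / 2 + real j) r y)) \<partial>lborel)"
      using p q l by (intro nn_integral_cong) (simp add: ennreal_mult poisson_weight_nonneg mult_ac)
    also have "\<dots> = ennreal (poisson_weight (p * l) i * poisson_weight (q * l) j) *
      ennreal (gamma_density (p / 2 + real i + (q / 2 + real j)) r x)"
      using p q r by (subst nn_integral_cmult) (simp_all add: gamma_density_convolution add_pos_nonneg)
    also have "p / 2 + real i + (q / 2 + real j) = (p + q) / 2 + real (i + j)" by (simp add: field_simps)
    finally show ?thesis .
  qed
  then have "(\<integral>\<^sup>+y. gamma_mixture p l r (x - y) * gamma_mixture q l r y \<partial>lborel) =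
    (\<Sum>i. \<Sum>j. ennreal (poisson_weight (p * l) i * poisson_weight (q * l) j) * ?g (i + j))"
    unfolding gamma_mixture_def by (subst nn_integral_suminf_mult_suminf) simp_all
  also have "\<dots> = (\<Sum>k. \<Sum>j\<le>k. ennreal (poisson_weight (p * l) (k - j) * poisson_weight (q * l) j) * ?g (k - j + j))"
    by (rule suminf_triangle_ennreal)
  also have "\<dots> = (\<Sum>k. ennreal (\<Sum>j\<le>k. poisson_weight (p * l) (k - j) * poisson_weight (q * l) j) * ?g k)"
    using p q l by (simp add: poisson_weight_nonneg flip: sum_distrib_right)
  also have "\<dots> = gamma_mixture (p + q) l r x"
    unfolding poisson_weight_convolution gamma_mixture_def by (simp add: distrib_right)
  finally show ?thesis .
qed

lemma gamma_mixture_convolution_reflected: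
  assumes l: "l \<ge> 0" and r: "r > 0" and p: "p > 0" and q: "q > 0"
  shows "(\<integral>\<^sup>+y. gamma_mixture p l r (y - x) * gamma_mixture q l r (- y) \<partial>lborel) = gamma_mixture (p + q) l r (- x)"
  unfolding gamma_mixture_convolution[OF l r p q, symmetric]
  by (subst nn_integral_real_affine[of _ "- 1" 0]) (simp_all add: algebra_simps)

section \<open>The convolution semigroup of chi-square differences\<close>

lemma prob_space_gamma_mixture:
  assumes l: "l \<ge> 0" and r: "r > 0" and q: "q > 0"
  shows "prob_space (density lborel (gamma_mixture q l r))"
    and "prob_space (density lborel (\<lambda>x. gamma_mixture q l r (- x)))"
proof -
  show "prob_space (density lborel (gamma_mixture q l r))"
    by (rule prob_spaceI) (simp add: emeasure_density nn_integral_gamma_mixture q l r)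
  have "(\<integral>\<^sup>+x. gamma_mixture q l r (- x) \<partial>lborel) = (\<integral>\<^sup>+x. gamma_mixture q l r x \<partial>lborel)"
    by (subst nn_integral_real_affine[of _ "- 1" 0]) simp_all
  then show "prob_space (density lborel (\<lambda>x. gamma_mixture q l r (- x)))"
    by (intro prob_spaceI) (simp add: emeasure_density nn_integral_gamma_mixture q l r)
qed

lemma prob_space_convolution:
  assumes "prob_space M" "prob_space N" and s: "sets M = sets borel" "sets N = sets borel"
  shows "prob_space (M \<star> N :: real measure)"
proof -
  interpret M: prob_space M by fact
  interpret N: prob_space N by fact
  interpret P: pair_prob_space M N ..
  have "(\<lambda>(x, y). x + y) \<in> borel_measurable (M \<Otimes>\<^sub>M N)"
    using s by (simp cong: measurable_cong_sets sets_pair_measure_cong)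
  then show ?thesis unfolding convolution_def by (rule P.prob_space_distr)
qed

text \<open>The law of G - H for independent G and H with densities
  \<open>gamma_mixture q l r\<close> and \<open>gamma_mixture q m s\<close>; the reflected second
  density is that of -H.\<close>

definition chisq_difference :: "real \<Rightarrow> real \<Rightarrow> real \<Rightarrow> real \<Rightarrow> real \<Rightarrow> real measure" where
  "chisq_difference q l r m s = (density lborel (gamma_mixture q l r) \<star> density lborel (\<lambda>x. gamma_mixture q m s (- x)))"

lemma sets_chisq_difference [simp, measurable_cong]: "sets (chisq_difference q l r m s) = sets borel"
  by (simp add: chisq_difference_def)


lemma finite_gamma_mixture:
  assumes l: "l \<ge> 0" and r: "r > 0" and m: "m \<ge> 0" and s: "s > 0" and q: "q > 0"
  shows "finite_measure (density lborel (gamma_mixture q l r))"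
    and "finite_measure (density lborel (\<lambda>x. gamma_mixture q m s (- x)))"
  using prob_space_gamma_mixture(1)[OF l r q] prob_space_gamma_mixture(2)[OF m s q]
  by (simp_all add: prob_space_def)

lemma prob_space_chisq_difference:
  assumes l: "l \<ge> 0" and r: "r > 0" and m: "m \<ge> 0" and s: "s > 0" and q: "q > 0"
  shows "prob_space (chisq_difference q l r m s)"
  unfolding chisq_difference_def
  by (intro prob_space_convolution prob_space_gamma_mixture l r m s q) simp_all

text \<open>Associativity and commutativity of convolution bring the two positive parts together,
  and likewise the two reflected ones; each pair is then merged by its own semigroup law.\<close>

lemma chisq_difference_convolution:
  assumes l: "l \<ge> 0" and r: "r > 0" and m: "m \<ge> 0" and s: "s > 0" and p: "p > 0" and q: "q > 0"
  shows "(chisq_difference p l r m s \<star> chisq_difference q l r m s) = chisq_difference (p + q) l r m s"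
proof -
  let ?A = "\<lambda>q. density lborel (gamma_mixture q l r)" and ?B = "\<lambda>q. density lborel (\<lambda>x. gamma_mixture q m s (- x))"
  note f = finite_gamma_mixture[OF l r m s p] finite_gamma_mixture[OF l r m s q]
  have A: "(?A p \<star> ?A q) = ?A (p + q)"
    using f by (subst convolution_density) (simp_all add: gamma_mixture_convolution[OF l r p q])
  have B: "(?B p \<star> ?B q) = ?B (p + q)"
    using f by (subst convolution_density) (simp_all add: gamma_mixture_convolution_reflected[OF m s p q])
  have "((?A p \<star> ?B p) \<star> (?A q \<star> ?B q)) = (?A p \<star> (?B p \<star> (?A q \<star> ?B q)))"
    using f by (intro convolution_associative[symmetric] convolution_finite) simp_all
  also have "(?B p \<star> (?A q \<star> ?B q)) = ((?B p \<star> ?A q) \<star> ?B q)"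
    using f by (intro convolution_associative) simp_all
  also have "(?B p \<star> ?A q) = (?A q \<star> ?B p)" using f by (intro convolution_commutative) simp_all
  also have "((?A q \<star> ?B p) \<star> ?B q) = (?A q \<star> (?B p \<star> ?B q))"
    using f by (intro convolution_associative[symmetric]) simp_all
  also have "(?A p \<star> (?A q \<star> (?B p \<star> ?B q))) = ((?A p \<star> ?A q) \<star> (?B p \<star> ?B q))"
    using f by (intro convolution_associative convolution_finite) simp_all
  finally show ?thesis unfolding A B chisq_difference_def .
qed

lemma chisq_difference_density:
  assumes l: "l \<ge> 0" and r: "r > 0" and m: "m \<ge> 0" and s: "s > 0" and q: "q > 0"
  shows "chisq_difference q l r m s = density lborel (\<lambda>x. \<integral>\<^sup>+y. gamma_mixture q l r (x + y) * gamma_mixture q m s y \<partial>lborel)"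
proof -
  have "chisq_difference q l r m s =
      density lborel (\<lambda>x. \<integral>\<^sup>+y. gamma_mixture q l r (x - y) * gamma_mixture q m s (- y) \<partial>lborel)"
    unfolding chisq_difference_def using finite_gamma_mixture[OF l r m s q] by (intro convolution_density) simp_all
  also have "(\<lambda>x. \<integral>\<^sup>+y. gamma_mixture q l r (x - y) * gamma_mixture q m s (- y) \<partial>lborel)
      = (\<lambda>x. \<integral>\<^sup>+y. gamma_mixture q l r (x + y) * gamma_mixture q m s y \<partial>lborel)"
    by (rule ext, subst nn_integral_real_affine[of _ "- 1" 0]) simp_all
  finally show ?thesis .
qed

text \<open>The induction starts at one summand: the empty sum would correspond to q = 0, where the
  mixture is not a probability density.\<close>

lemma (in prob_space) distr_sum_chisq_difference:
  fixes U :: "'i \<Rightarrow> 'a \<Rightarrow> real"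
  assumes l: "l \<ge> 0" and r: "r > 0" and m: "m \<ge> 0" and s: "s > 0" and q: "q > 0"
    and I: "finite I" "I \<noteq> {}" and ind: "indep_vars (\<lambda>_. borel) U I"
    and U: "\<And>i. i \<in> I \<Longrightarrow> distr M borel (U i) = chisq_difference q l r m s"
  shows "distr M borel (\<lambda>\<omega>. \<Sum>i\<in>I. U i \<omega>) = chisq_difference (real (card I) * q) l r m s"
  using I ind U
proof (induction I rule: finite_ne_induct)
  case (singleton i)
  then show ?case by simp
next
  case (insert i I)
  have rv: "random_variable borel (U j)" if "j \<in> insert i I" for j
    using insert.prems(1) that by (auto simp: indep_vars_def)
  have IH: "distr M borel (\<lambda>\<omega>. \<Sum>i\<in>I. U i \<omega>) = chisq_difference (real (card I) * q) l r m s"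
    using insert.prems by (intro insert.IH) (auto intro: indep_vars_subset)
  have "distr M borel (\<lambda>\<omega>. \<Sum>i\<in>insert i I. U i \<omega>) = distr M borel (\<lambda>\<omega>. U i \<omega> + (\<Sum>i\<in>I. U i \<omega>))"
    using insert.hyps by simp
  also have "\<dots> = (distr M borel (U i) \<star> distr M borel (\<lambda>\<omega>. \<Sum>i\<in>I. U i \<omega>))"
    using insert.hyps insert.prems(1) rv by (intro sum_indep_random_variable indep_vars_sum borel_measurable_sum) auto
  also have "\<dots> = (chisq_difference q l r m s \<star> chisq_difference (real (card I) * q) l r m s)"
    unfolding IH using insert.prems(2) by simp
  also have "\<dots> = chisq_difference (q + real (card I) * q) l r m s"
    using insert.hyps q l r m s by (intro chisq_difference_convolution) (simp_all add: card_gt_0_iff)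
  also have "q + real (card I) * q = real (card (insert i I)) * q"
    using insert.hyps by (simp add: algebra_simps)
  finally show ?case .
qed

section \<open>The product of two correlated normal variables\<close>

text \<open>It turns i! \<Gamma>(1/2 + i) into a multiple of (2 i)!, so that a Poisson mixture with
  shapes 1/2 + i becomes a cosh series.\<close>

lemma Gamma_of_nat_plus_half: "Gamma (1 / 2 + real i) = fact (2 * i) * sqrt pi / (4 ^ i * fact i)"
proof (induction i)
  case 0
  then show ?case by (simp add: Gamma_one_half_real)
next
  case (Suc i)
  have "1 / 2 + real i \<notin> \<int>\<^sub>\<le>\<^sub>0" by (auto dest: nonpos_Ints_nonpos)
  then have "Gamma (1 / 2 + real (Suc i)) = (1 / 2 + real i) * Gamma (1 / 2 + real i)"
    using Gamma_plus1[of "1 / 2 + real i"] by (simp add: add_ac)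
  also have "\<dots> = (1 / 2 + real i) * (fact (2 * i) * sqrt pi / (4 ^ i * fact i))" by (simp only: Suc.IH)
  also have "\<dots> = fact (2 * Suc i) * sqrt pi / (4 ^ Suc i * fact (Suc i))"
  proof -
    have "2 * Suc i = Suc (Suc (2 * i))" by simp
    then have f: "fact (2 * Suc i) = 2 * (real i + 1) * (2 * real i + 1) * fact (2 * i)"
      by (simp only: fact_Suc of_nat_Suc of_nat_mult of_nat_numeral) (simp add: algebra_simps)
    have f': "fact (Suc i) = (real i + 1) * fact i"
      by (simp only: fact_Suc of_nat_Suc add.commute)
    have "real i + 1 \<noteq> 0" by linarith
    then show ?thesis unfolding f f' power_Suc by (simp add: divide_simps) (simp add: algebra_simps)
  qed
  finally show ?case .
qed

lemma even_powers_sums_cosh: "(\<lambda>i. x ^ (2 * i) / fact (2 * i)) sums cosh (x :: real)"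
proof -
  have "strict_mono (\<lambda>n::nat. 2 * n)" by (auto simp: strict_mono_def)
  from sums_mono_reindex[OF this, of "\<lambda>n. if even n then x ^ n /\<^sub>R fact n else 0" "cosh x"]
  moreover have "n \<notin> range (\<lambda>n::nat. 2 * n) \<Longrightarrow> (if even n then x ^ n /\<^sub>R fact n else 0) = 0" for n
    by (auto elim!: evenE)
  ultimately have "(\<lambda>n. if even (2 * n) then x ^ (2 * n) /\<^sub>R fact (2 * n) else 0) sums cosh x"
    using cosh_converges[of x] by blast
  then show ?thesis by (simp add: divide_inverse mult.commute)
qed

text \<open>The density of \<kappa> P^2 for normal P, pulled back to p with Jacobian 2 \<kappa> p; p
  and -p are the two preimages. The sum of the two normal densities is a Gaussian factor times
  cosh(p \<mu> / v), whose Taylor terms are exactly the terms of the mixture.\<close>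

lemma gamma_mixture_square:
  fixes \<mu> v \<kappa> p :: real
  assumes v: "v > 0" and \<kappa>: "\<kappa> > 0" and p: "p > 0"
  shows "gamma_mixture 1 (\<mu>\<^sup>2 / (2 * v)) (1 / (2 * v * \<kappa>)) (\<kappa> * p\<^sup>2) * ennreal (2 * \<kappa> * p) =
    ennreal (normal_density \<mu> (sqrt v) p) + ennreal (normal_density \<mu> (sqrt v) (- p))"
proof -
  define l where "l = \<mu>\<^sup>2 / (2 * v)"
  define r where "r = 1 / (2 * v * \<kappa>)"
  \<comment> \<open>The factor for which the two normal densities add up to E cosh X.\<close>
  define E where "E = 2 * exp (- l) * exp (- (p\<^sup>2 / (2 * v))) / (sqrt (2 * v) * sqrt pi)"
  define X where "X = p * \<mu> / v"
  have l: "l \<ge> 0" using v by (simp add: l_def)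
  have r: "r > 0" using v \<kappa> by (simp add: r_def)
  have t: "poisson_weight l i * gamma_density (1 / 2 + real i) r (\<kappa> * p\<^sup>2) * (2 * \<kappa> * p) = E * (X ^ (2 * i) / fact (2 * i))" for i
  proof -
    let ?y = "\<kappa> * p\<^sup>2"
    have y: "?y > 0" using \<kappa> p by simp
    have "r powr (1 / 2 + real i) * ?y powr (1 / 2 + real i - 1) * (\<kappa> * p) = (p\<^sup>2 / (2 * v)) ^ i / sqrt (2 * v)"
    proof -
      have "\<kappa> * p = sqrt ?y * sqrt \<kappa>" using \<kappa> p by (simp add: real_sqrt_mult)
      moreover have "?y powr (1 / 2 + real i - 1) * sqrt ?y = ?y ^ i"
        using y powr_add[of ?y "1 / 2 + real i - 1" "1 / 2"] by (simp add: powr_half_sqrt powr_realpow)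
      moreover have "r powr (1 / 2 + real i) = sqrt r * r ^ i"
        using r powr_add[of r "1 / 2" "real i"] by (simp add: powr_half_sqrt powr_realpow)
      moreover have "sqrt r * sqrt \<kappa> = 1 / sqrt (2 * v)"
      proof -
        have "r * \<kappa> = 1 / (2 * v)" using \<kappa> v by (simp add: r_def)
        then show ?thesis by (simp add: real_sqrt_divide flip: real_sqrt_mult)
      qed
      moreover have "r ^ i * ?y ^ i = (p\<^sup>2 / (2 * v)) ^ i"
      proof -
        have "r * ?y = p\<^sup>2 / (2 * v)" using \<kappa> v by (simp add: r_def)
        then show ?thesis by (simp only: power_mult_distrib[symmetric])
      qed
      moreover have "(sr * ri) * yp * (sy * sk) = (ri * (yp * sy)) * (sr * sk)" for sr ri yp sy sk :: real by simp
      ultimately show ?thesis by (simp only: mult_1_right times_divide_eq_right)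
    qed
    then have 1: "gamma_density (1 / 2 + real i) r ?y * (2 * \<kappa> * p) =
       2 * ((p\<^sup>2 / (2 * v)) ^ i / sqrt (2 * v)) * exp (- r * ?y) / Gamma (1 / 2 + real i)"
    proof -
      have "R * Y * e / G * (2 * \<kappa> * p) = 2 * (R * Y * (\<kappa> * p)) * e / G" for R Y e G :: real by simp
      moreover have "gamma_density (1 / 2 + real i) r ?y =
          r powr (1 / 2 + real i) * ?y powr (1 / 2 + real i - 1) * exp (- r * ?y) / Gamma (1 / 2 + real i)"
        using y unfolding gamma_density_def by (simp only: if_True)
      ultimately show ?thesis using \<open>_ = (p\<^sup>2 / (2 * v)) ^ i / sqrt (2 * v)\<close> by (simp only:)
    qed
    have 2: "exp (- r * ?y) = exp (- (p\<^sup>2 / (2 * v)))" using \<kappa> v by (simp add: r_def)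
    have "l ^ i * (p\<^sup>2 / (2 * v)) ^ i * 4 ^ i = X ^ (2 * i)"
    proof -
      have "l * (p\<^sup>2 / (2 * v)) * 4 = X\<^sup>2" using v by (simp add: l_def X_def power2_eq_square)
      then show ?thesis by (simp only: power_mult_distrib[symmetric] power_mult)
    qed
    then have "E * (X ^ (2 * i) / fact (2 * i)) = E * (l ^ i * (p\<^sup>2 / (2 * v)) ^ i * 4 ^ i / fact (2 * i))" by simp
    also have "\<dots> = poisson_weight l i * (2 * ((p\<^sup>2 / (2 * v)) ^ i / sqrt (2 * v)) * exp (- (p\<^sup>2 / (2 * v))) / Gamma (1 / 2 + real i))"
      unfolding poisson_weight_def Gamma_of_nat_plus_half E_def by simp (simp add: mult_ac)
    also have "\<dots> = poisson_weight l i * (gamma_density (1 / 2 + real i) r ?y * (2 * \<kappa> * p))"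
      unfolding 1 2 ..
    finally show ?thesis by (simp only: mult.assoc)
  qed
  have E: "E \<ge> 0" using v by (simp add: E_def)
  have "gamma_mixture 1 l r (\<kappa> * p\<^sup>2) * ennreal (2 * \<kappa> * p) =
      (\<Sum>i. ennreal (poisson_weight l i) * ennreal (gamma_density (1 / 2 + real i) r (\<kappa> * p\<^sup>2)) * ennreal (2 * \<kappa> * p))"
    unfolding gamma_mixture_def by simp
  also have "\<dots> = (\<Sum>i. ennreal (E * (X ^ (2 * i) / fact (2 * i))))"
    unfolding t[symmetric] using l \<kappa> p
    by (simp add: ennreal_mult poisson_weight_nonneg gamma_density_nonneg)
  also have "\<dots> = ennreal (E * cosh X)"
    using E by (intro suminf_ennreal_eq sums_mult even_powers_sums_cosh) simp
  also have "E * cosh X = normal_density \<mu> (sqrt v) p + normal_density \<mu> (sqrt v) (- p)"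
  proof -
    have "exp (- (p - \<mu>)\<^sup>2 / (2 * v)) = exp (- l) * exp (- (p\<^sup>2 / (2 * v))) * exp X"
      using v by (simp add: l_def X_def power2_eq_square field_simps flip: exp_add)
    moreover have "exp (- (- p - \<mu>)\<^sup>2 / (2 * v)) = exp (- l) * exp (- (p\<^sup>2 / (2 * v))) * exp (- X)"
      using v by (simp add: l_def X_def power2_eq_square field_simps flip: exp_add)
    moreover have "sqrt (2 * pi * v) = sqrt (2 * v) * sqrt pi"
      by (simp flip: real_sqrt_mult add: mult_ac)
    ultimately show ?thesis using v
      unfolding normal_density_def E_def cosh_def by (simp add: add_divide_distrib distrib_left)
  qed
  finally show ?thesis by (simp add: l_def r_def)
qed

text \<open>Substitution on the bounded intervals [0, n], then a monotone limit expressed through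
  continuity of measures from below. The degenerate interval n = 0 is handled as a null set.\<close>

lemma nn_integral_square_substitution:
  fixes f :: "real \<Rightarrow> ennreal"
  assumes [measurable]: "f \<in> borel_measurable borel" and \<kappa>: "\<kappa> > 0"
  shows "(\<integral>\<^sup>+x. f x * indicator {0..} x \<partial>lborel) = (\<integral>\<^sup>+p. f (\<kappa> * p\<^sup>2) * ennreal (2 * \<kappa> * p) * indicator {0..} p \<partial>lborel)"
proof -
  let ?g = "\<lambda>p. f (\<kappa> * p\<^sup>2) * ennreal (2 * \<kappa> * p)"
  let ?A = "\<lambda>n::nat. {0..\<kappa> * (real n)\<^sup>2}" and ?B = "\<lambda>n::nat. {0..real n}"
  have "emeasure (density lborel f) (?A n) = emeasure (density lborel ?g) (?B n)" for n
  proof (cases "n = 0")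
    case True
    have "AE x in lborel. x \<noteq> (0 :: real)" by (rule AE_lborel_singleton)
    then have "emeasure (density lborel f) {0} = 0" "emeasure (density lborel ?g) {0} = 0"
      by (auto intro!: nn_integral_zero' elim!: eventually_mono simp: emeasure_density)
    then show ?thesis using True by simp
  next
    case False
    have "(\<integral>\<^sup>+x. f x * indicator {\<kappa> * 0\<^sup>2..\<kappa> * (real n)\<^sup>2} x \<partial>lborel) = (\<integral>\<^sup>+x. f (\<kappa> * x\<^sup>2) * ennreal (2 * \<kappa> * x) * indicator {0..real n} x \<partial>lborel)"
      using False \<kappa> by (intro nn_integral_substitution_aux) (auto intro!: derivative_eq_intros continuous_intros)
    then show ?thesis by (simp add: emeasure_density)
  qed
  moreover have "(SUP n. emeasure (density lborel f) (?A n)) = emeasure (density lborel f) (\<Union>n. ?A n)"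
    using \<kappa> by (intro SUP_emeasure_incseq) (auto simp: incseq_def intro: order_trans mult_left_mono power_mono)
  moreover have "(SUP n. emeasure (density lborel ?g) (?B n)) = emeasure (density lborel ?g) (\<Union>n. ?B n)"
    by (intro SUP_emeasure_incseq) (auto simp: incseq_def)
  moreover have "(\<Union>n. ?B n) = {0..}" using real_arch_simple by auto
  moreover have "(\<Union>n. ?A n) = {0..}"
  proof (intro equalityI subsetI)
    fix x :: real assume x: "x \<in> {0..}"
    obtain n where n: "sqrt (x / \<kappa>) \<le> real n" using real_arch_simple by blast
    then have "x / \<kappa> \<le> (real n)\<^sup>2" by (rule sqrt_le_D)
    then show "x \<in> (\<Union>n. ?A n)" using x \<kappa> by (auto simp: field_simps)
  qed auto
  ultimately have "emeasure (density lborel f) {0..} = emeasure (density lborel ?g) {0..}" by simp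
  then show ?thesis by (simp add: emeasure_density)
qed

lemma nn_integral_real_fold:
  fixes f :: "real \<Rightarrow> ennreal"
  assumes [measurable]: "f \<in> borel_measurable borel"
  shows "(\<integral>\<^sup>+x. f x \<partial>lborel) = (\<integral>\<^sup>+x. (f x + f (- x)) * indicator {0..} x \<partial>lborel)"
proof -
  have "(\<integral>\<^sup>+x. f x \<partial>lborel) = (\<integral>\<^sup>+x. f x * indicator {0..} x + f x * indicator {..<0} x \<partial>lborel)"
    by (intro nn_integral_cong) (simp add: indicator_def)
  also have "\<dots> = (\<integral>\<^sup>+x. f x * indicator {0..} x \<partial>lborel) + (\<integral>\<^sup>+x. f x * indicator {..<0} x \<partial>lborel)"
    by (rule nn_integral_add) auto
  also have "(\<integral>\<^sup>+x. f x * indicator {..<0} x \<partial>lborel) = (\<integral>\<^sup>+x. f (- x) * indicator {..<0} (- x) \<partial>lborel)"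
    by (subst nn_integral_real_affine[of _ "- 1" 0]) simp_all
  also have "\<dots> = (\<integral>\<^sup>+x. f (- x) * indicator {0..} x \<partial>lborel)"
  proof (rule nn_integral_cong_AE, rule eventually_mono[OF AE_lborel_singleton[of 0]])
    fix x :: real assume "x \<noteq> 0"
    then show "f (- x) * indicator {..<0} (- x) = f (- x) * indicator {0..} x"
      by (cases "x > 0") simp_all
  qed
  also have "(\<integral>\<^sup>+x. f x * indicator {0..} x \<partial>lborel) + \<dots> = (\<integral>\<^sup>+x. f x * indicator {0..} x + f (- x) * indicator {0..} x \<partial>lborel)"
    by (rule nn_integral_add[symmetric]) auto
  finally show ?thesis by (simp add: distrib_right)
qed

text \<open>The law of \<kappa> P^2 tested against an arbitrary h, so that h may itself be an
  integral over a second variable.\<close>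

lemma nn_integral_normal_square:
  fixes h :: "real \<Rightarrow> ennreal"
  assumes [measurable]: "h \<in> borel_measurable borel" and v: "v > 0" and \<kappa>: "\<kappa> > 0"
  shows "(\<integral>\<^sup>+p. ennreal (normal_density \<mu> (sqrt v) p) * h (\<kappa> * p\<^sup>2) \<partial>lborel) =
    (\<integral>\<^sup>+x. gamma_mixture 1 (\<mu>\<^sup>2 / (2 * v)) (1 / (2 * v * \<kappa>)) x * h x \<partial>lborel)"
proof -
  let ?m = "gamma_mixture 1 (\<mu>\<^sup>2 / (2 * v)) (1 / (2 * v * \<kappa>))"
  let ?n = "\<lambda>p. ennreal (normal_density \<mu> (sqrt v) p)"
  have "?m x = 0" if "x < 0" for x using that by (simp add: gamma_mixture_def gamma_density_def)
  then have "(\<integral>\<^sup>+x. ?m x * h x \<partial>lborel) = (\<integral>\<^sup>+x. ?m x * h x * indicator {0..} x \<partial>lborel)"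
    by (intro nn_integral_cong) (simp add: indicator_def)
  also have "\<dots> = (\<integral>\<^sup>+p. ?m (\<kappa> * p\<^sup>2) * h (\<kappa> * p\<^sup>2) * ennreal (2 * \<kappa> * p) * indicator {0..} p \<partial>lborel)"
    by (intro nn_integral_square_substitution \<kappa>) measurable
  also have "\<dots> = (\<integral>\<^sup>+p. (?n p * h (\<kappa> * p\<^sup>2) + ?n (- p) * h (\<kappa> * (- p)\<^sup>2)) * indicator {0..} p \<partial>lborel)"
  proof (rule nn_integral_cong_AE, rule eventually_mono[OF AE_lborel_singleton[of 0]])
    fix p :: real assume "p \<noteq> 0"
    show "?m (\<kappa> * p\<^sup>2) * h (\<kappa> * p\<^sup>2) * ennreal (2 * \<kappa> * p) * indicator {0..} p =
        (?n p * h (\<kappa> * p\<^sup>2) + ?n (- p) * h (\<kappa> * (- p)\<^sup>2)) * indicator {0..} p"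
    proof (cases "p > 0")
      case True
      have "?m (\<kappa> * p\<^sup>2) * h (\<kappa> * p\<^sup>2) * ennreal (2 * \<kappa> * p) = (?m (\<kappa> * p\<^sup>2) * ennreal (2 * \<kappa> * p)) * h (\<kappa> * p\<^sup>2)"
        by (simp only: mult_ac)
      also have "\<dots> = (?n p + ?n (- p)) * h (\<kappa> * p\<^sup>2)"
        by (simp only: gamma_mixture_square[OF v \<kappa> True])
      finally show ?thesis by (simp only: distrib_right power2_minus)
    qed (use \<open>p \<noteq> 0\<close> in simp)
  qed
  also have "\<dots> = (\<integral>\<^sup>+p. ?n p * h (\<kappa> * p\<^sup>2) \<partial>lborel)"
    by (rule nn_integral_real_fold[symmetric]) measurable
  finally show ?thesis ..
qed


section \<open>Rotation to independent sum and difference\<close>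

text \<open>The standardized variables have equal variance, so their sum and difference are
  uncorrelated, with variances 2(1 + \<rho>) and 2(1 - \<rho>), and the cross term in the exponent
  cancels. The factor in front is the Jacobian of the linear change of variables.\<close>

lemma bivariate_normal_density_rotate:
  fixes \<mu>\<^sub>X \<mu>\<^sub>Y \<sigma>\<^sub>X \<sigma>\<^sub>Y \<rho> p d :: real
  assumes X: "0 < \<sigma>\<^sub>X" and Y: "0 < \<sigma>\<^sub>Y" and \<rho>: "-1 < \<rho>" "\<rho> < 1"
  shows "\<sigma>\<^sub>X * \<sigma>\<^sub>Y / 2 * bivariate_normal_density \<mu>\<^sub>X \<mu>\<^sub>Y \<sigma>\<^sub>X \<sigma>\<^sub>Y \<rho> (\<sigma>\<^sub>X * (p + d) / 2, \<sigma>\<^sub>Y * (p - d) / 2) =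
    normal_density (\<mu>\<^sub>X / \<sigma>\<^sub>X + \<mu>\<^sub>Y / \<sigma>\<^sub>Y) (sqrt (2 * (1 + \<rho>))) p *
    normal_density (\<mu>\<^sub>X / \<sigma>\<^sub>X - \<mu>\<^sub>Y / \<sigma>\<^sub>Y) (sqrt (2 * (1 - \<rho>))) d"
proof -
  define P where "P = p - (\<mu>\<^sub>X / \<sigma>\<^sub>X + \<mu>\<^sub>Y / \<sigma>\<^sub>Y)"
  define D where "D = d - (\<mu>\<^sub>X / \<sigma>\<^sub>X - \<mu>\<^sub>Y / \<sigma>\<^sub>Y)"
  have r: "1 + \<rho> > 0" "1 - \<rho> > 0" using \<rho> by simp_all
  have r2: "1 - \<rho>\<^sup>2 = (1 + \<rho>) * (1 - \<rho>)" by (simp add: power2_eq_square algebra_simps)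
  have x: "(\<sigma>\<^sub>X * (p + d) / 2 - \<mu>\<^sub>X) / \<sigma>\<^sub>X = (P + D) / 2" using X by (simp add: P_def D_def diff_divide_distrib)
  have y: "(\<sigma>\<^sub>Y * (p - d) / 2 - \<mu>\<^sub>Y) / \<sigma>\<^sub>Y = (P - D) / 2" using Y by (simp add: P_def D_def diff_divide_distrib)
  have "- 1 / (2 * (1 - \<rho>\<^sup>2)) * (((P + D) / 2)\<^sup>2 - 2 * \<rho> * ((P + D) / 2) * ((P - D) / 2) + ((P - D) / 2)\<^sup>2)
    = - (P\<^sup>2 * (1 - \<rho>) + D\<^sup>2 * (1 + \<rho>)) / (4 * ((1 + \<rho>) * (1 - \<rho>)))"
    unfolding r2[symmetric] by (simp add: power2_eq_square divide_simps) (simp add: algebra_simps)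
  also have "\<dots> = - P\<^sup>2 / (2 * (2 * (1 + \<rho>))) + - D\<^sup>2 / (2 * (2 * (1 - \<rho>)))"
    using r by (simp add: divide_simps) (simp add: algebra_simps)
  finally have e: "exp (- 1 / (2 * (1 - \<rho>\<^sup>2)) * (((P + D) / 2)\<^sup>2 - 2 * \<rho> * ((P + D) / 2) * ((P - D) / 2) + ((P - D) / 2)\<^sup>2))
    = exp (- P\<^sup>2 / (2 * (2 * (1 + \<rho>)))) * exp (- D\<^sup>2 / (2 * (2 * (1 - \<rho>))))" by (simp only: exp_add)
  have s: "sqrt (2 * pi * (2 * (1 + \<rho>))) * sqrt (2 * pi * (2 * (1 - \<rho>))) = 4 * pi * sqrt (1 - \<rho>\<^sup>2)"
  proof -
    have "sqrt (2 * pi * (2 * (1 + \<rho>))) * sqrt (2 * pi * (2 * (1 - \<rho>))) = sqrt ((4 * pi)\<^sup>2 * ((1 + \<rho>) * (1 - \<rho>)))"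
      unfolding real_sqrt_mult[symmetric] by (rule arg_cong[of _ _ sqrt]) (simp add: power2_eq_square algebra_simps)
    also have "\<dots> = 4 * pi * sqrt ((1 + \<rho>) * (1 - \<rho>))"
      unfolding real_sqrt_mult[of "(4 * pi)\<^sup>2"] real_sqrt_abs by simp
    finally show ?thesis unfolding r2 .
  qed
  have "normal_density (\<mu>\<^sub>X / \<sigma>\<^sub>X + \<mu>\<^sub>Y / \<sigma>\<^sub>Y) (sqrt (2 * (1 + \<rho>))) p *
    normal_density (\<mu>\<^sub>X / \<sigma>\<^sub>X - \<mu>\<^sub>Y / \<sigma>\<^sub>Y) (sqrt (2 * (1 - \<rho>))) d =
    1 / (4 * pi * sqrt (1 - \<rho>\<^sup>2)) * (exp (- P\<^sup>2 / (2 * (2 * (1 + \<rho>)))) * exp (- D\<^sup>2 / (2 * (2 * (1 - \<rho>)))))"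
    using r unfolding normal_density_def P_def[symmetric] D_def[symmetric] s[symmetric] by simp
  also have "\<dots> = \<sigma>\<^sub>X * \<sigma>\<^sub>Y / 2 * bivariate_normal_density \<mu>\<^sub>X \<mu>\<^sub>Y \<sigma>\<^sub>X \<sigma>\<^sub>Y \<rho> (\<sigma>\<^sub>X * (p + d) / 2, \<sigma>\<^sub>Y * (p - d) / 2)"
    unfolding bivariate_normal_density_def prod.case x y e using X Y by simp
  finally show ?thesis ..
qed

lemma bivariate_normal_density_measurable [measurable]:
  "bivariate_normal_density \<mu>\<^sub>X \<mu>\<^sub>Y \<sigma>\<^sub>X \<sigma>\<^sub>Y \<rho> \<in> borel_measurable (borel \<Otimes>\<^sub>M borel)"
  unfolding bivariate_normal_density_def by measurable

lemma bivariate_normal_density_nonneg: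
  "0 < \<sigma>\<^sub>X \<Longrightarrow> 0 < \<sigma>\<^sub>Y \<Longrightarrow> -1 < \<rho> \<Longrightarrow> \<rho> < 1 \<Longrightarrow> 0 \<le> bivariate_normal_density \<mu>\<^sub>X \<mu>\<^sub>Y \<sigma>\<^sub>X \<sigma>\<^sub>Y \<rho> z"
  unfolding bivariate_normal_density_def by (auto simp: abs_square_le_1 split: prod.split)

text \<open>Two one-dimensional affine substitutions with Tonelli in between: y = b (p - x/a) at
  fixed x with factor b, then x = a (p + d)/2 at fixed p with factor a/2.\<close>

lemma nn_integral_plane_rotate:
  fixes F :: "real \<times> real \<Rightarrow> ennreal"
  assumes [measurable]: "F \<in> borel_measurable (borel \<Otimes>\<^sub>M borel)" and a: "a > 0" and b: "b > 0"
  shows "(\<integral>\<^sup>+z. F z \<partial>(lborel \<Otimes>\<^sub>M lborel)) =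
    (\<integral>\<^sup>+p. \<integral>\<^sup>+d. ennreal (a * b / 2) * F (a * (p + d) / 2, b * (p - d) / 2) \<partial>lborel \<partial>lborel)"
proof -
  have "(\<integral>\<^sup>+z. F z \<partial>(lborel \<Otimes>\<^sub>M lborel)) = (\<integral>\<^sup>+x. \<integral>\<^sup>+y. F (x, y) \<partial>lborel \<partial>lborel)"
    by (rule lborel.nn_integral_fst[symmetric]) measurable
  also have "\<dots> = (\<integral>\<^sup>+x. \<integral>\<^sup>+p. ennreal b * F (x, b * (p - x / a)) \<partial>lborel \<partial>lborel)"
  proof (rule nn_integral_cong)
    fix x :: real
    have "(\<integral>\<^sup>+y. F (x, y) \<partial>lborel) = \<bar>b\<bar> * (\<integral>\<^sup>+p. F (x, - b * x / a + b * p) \<partial>lborel)"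
      using b by (intro nn_integral_real_affine) simp_all
    also have "\<dots> = (\<integral>\<^sup>+p. ennreal b * F (x, - b * x / a + b * p) \<partial>lborel)"
      using b by (subst nn_integral_cmult) simp_all
    also have "(\<lambda>p. - b * x / a + b * p) = (\<lambda>p. b * (p - x / a))" by (simp add: fun_eq_iff algebra_simps)
    then have "(\<lambda>p. ennreal b * F (x, - b * x / a + b * p)) = (\<lambda>p. ennreal b * F (x, b * (p - x / a)))"
      by (simp add: fun_eq_iff)
    finally show "(\<integral>\<^sup>+y. F (x, y) \<partial>lborel) = (\<integral>\<^sup>+p. ennreal b * F (x, b * (p - x / a)) \<partial>lborel)" .
  qed
  also have "\<dots> = (\<integral>\<^sup>+p. \<integral>\<^sup>+x. ennreal b * F (x, b * (p - x / a)) \<partial>lborel \<partial>lborel)"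
    by (rule lborel_pair.Fubini'[symmetric]) measurable
  also have "\<dots> = (\<integral>\<^sup>+p. \<integral>\<^sup>+d. ennreal (a * b / 2) * F (a * (p + d) / 2, b * (p - d) / 2) \<partial>lborel \<partial>lborel)"
  proof (rule nn_integral_cong)
    fix p :: real
    have "(\<integral>\<^sup>+x. ennreal b * F (x, b * (p - x / a)) \<partial>lborel) =
      \<bar>a / 2\<bar> * (\<integral>\<^sup>+d. ennreal b * F (a * p / 2 + a / 2 * d, b * (p - (a * p / 2 + a / 2 * d) / a)) \<partial>lborel)"
      using a by (intro nn_integral_real_affine) simp_all
    also have "\<dots> = (\<integral>\<^sup>+d. ennreal \<bar>a / 2\<bar> * (ennreal b * F (a * p / 2 + a / 2 * d, b * (p - (a * p / 2 + a / 2 * d) / a))) \<partial>lborel)"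
      by (subst nn_integral_cmult) simp_all
    also have "\<dots> = (\<integral>\<^sup>+d. ennreal (a * b / 2) * F (a * (p + d) / 2, b * (p - d) / 2) \<partial>lborel)"
    proof (rule nn_integral_cong)
      fix d :: real
      have "a * p / 2 + a / 2 * d = a * (p + d) / 2" by (simp add: algebra_simps)
      moreover have "b * (p - (a * (p + d) / 2) / a) = b * (p - d) / 2" using a by (simp add: field_simps)
      moreover have "ennreal \<bar>a / 2\<bar> * ennreal b = ennreal (a * b / 2)" using a b by (simp flip: ennreal_mult)
      ultimately show "ennreal \<bar>a / 2\<bar> * (ennreal b * F (a * p / 2 + a / 2 * d, b * (p - (a * p / 2 + a / 2 * d) / a))) =
          ennreal (a * b / 2) * F (a * (p + d) / 2, b * (p - d) / 2)"
        by (simp only: mult.assoc[symmetric])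
    qed
    finally show "(\<integral>\<^sup>+x. ennreal b * F (x, b * (p - x / a)) \<partial>lborel) =
      (\<integral>\<^sup>+d. ennreal (a * b / 2) * F (a * (p + d) / 2, b * (p - d) / 2) \<partial>lborel)" .
  qed
  finally show ?thesis .
qed

text \<open>With \<kappa> = \<open>\<sigma>\<^sub>X * \<sigma>\<^sub>Y / 4\<close> the product is
  \<kappa> p^2 - \<kappa> d^2. The variances v = 2(1 + \<rho>) and v = 2(1 - \<rho>) give the rates
  1/(2 v \<kappa>) and the mixture parameters, squared mean over 2 v.\<close>

theorem distr_product_bivariate_normal:
  fixes X Y :: "'a \<Rightarrow> real" and \<mu>\<^sub>X \<mu>\<^sub>Y \<sigma>\<^sub>X \<sigma>\<^sub>Y \<rho> :: real
  assumes X: "0 < \<sigma>\<^sub>X" and Y: "0 < \<sigma>\<^sub>Y" and \<rho>: "-1 < \<rho>" "\<rho> < 1"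
    and dens: "distributed M (lborel \<Otimes>\<^sub>M lborel) (\<lambda>\<omega>. (X \<omega>, Y \<omega>))
           (\<lambda>p. ennreal (bivariate_normal_density \<mu>\<^sub>X \<mu>\<^sub>Y \<sigma>\<^sub>X \<sigma>\<^sub>Y \<rho> p))"
  shows "distr M borel (\<lambda>\<omega>. X \<omega> * Y \<omega>) = chisq_difference 1
    ((\<mu>\<^sub>X / \<sigma>\<^sub>X + \<mu>\<^sub>Y / \<sigma>\<^sub>Y)\<^sup>2 / (4 * (1 + \<rho>))) (1 / (\<sigma>\<^sub>X * \<sigma>\<^sub>Y * (1 + \<rho>)))
    ((\<mu>\<^sub>X / \<sigma>\<^sub>X - \<mu>\<^sub>Y / \<sigma>\<^sub>Y)\<^sup>2 / (4 * (1 - \<rho>))) (1 / (\<sigma>\<^sub>X * \<sigma>\<^sub>Y * (1 - \<rho>)))"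
    (is "_ = chisq_difference 1 ?l ?r ?m ?s")
proof (rule measure_eqI)
  let ?\<kappa> = "\<sigma>\<^sub>X * \<sigma>\<^sub>Y / 4"
  let ?\<mu> = "\<mu>\<^sub>X / \<sigma>\<^sub>X + \<mu>\<^sub>Y / \<sigma>\<^sub>Y" and ?\<nu> = "\<mu>\<^sub>X / \<sigma>\<^sub>X - \<mu>\<^sub>Y / \<sigma>\<^sub>Y"
  let ?n = "\<lambda>p. ennreal (normal_density ?\<mu> (sqrt (2 * (1 + \<rho>))) p)"
  let ?k = "\<lambda>d. ennreal (normal_density ?\<nu> (sqrt (2 * (1 - \<rho>))) d)"
  fix A :: "real set" assume "A \<in> sets (distr M borel (\<lambda>\<omega>. X \<omega> * Y \<omega>))"
  then have A [measurable]: "A \<in> sets borel" by simp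
  have rv: "(\<lambda>\<omega>. (X \<omega>, Y \<omega>)) \<in> measurable M (borel \<Otimes>\<^sub>M borel)"
    using distributed_measurable[OF dens] by (simp cong: measurable_cong_sets sets_pair_measure_cong)
  have XY [measurable]: "X \<in> borel_measurable M" "Y \<in> borel_measurable M"
    using measurable_compose[OF rv measurable_fst] measurable_compose[OF rv measurable_snd] by simp_all
  let ?h = "indicator A :: real \<Rightarrow> ennreal"
  have \<kappa>: "1 / (4 * (1 + \<rho>) * ?\<kappa>) = ?r" "1 / (4 * (1 - \<rho>) * ?\<kappa>) = ?s"
    and l: "2 * (2 * (1 + \<rho>)) = 4 * (1 + \<rho>)" "2 * (2 * (1 - \<rho>)) = 4 * (1 - \<rho>)"
  proof -
    have "4 * t * ?\<kappa> = \<sigma>\<^sub>X * \<sigma>\<^sub>Y * t" for t by simp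
    then show "1 / (4 * (1 + \<rho>) * ?\<kappa>) = ?r" "1 / (4 * (1 - \<rho>) * ?\<kappa>) = ?s"
      by (simp_all only:)
  qed simp_all
  have v: "2 * (1 + \<rho>) > 0" "2 * (1 - \<rho>) > 0" "?\<kappa> > 0" using X Y \<rho> by simp_all
  have "emeasure (distr M borel (\<lambda>\<omega>. X \<omega> * Y \<omega>)) A = (\<integral>\<^sup>+z. ?h z \<partial>distr M borel (\<lambda>\<omega>. X \<omega> * Y \<omega>))"
    by simp
  also have "\<dots> = (\<integral>\<^sup>+\<omega>. ?h (case (X \<omega>, Y \<omega>) of (x, y) \<Rightarrow> x * y) \<partial>M)"
    by (subst nn_integral_distr) simp_all
  also have "\<dots> = (\<integral>\<^sup>+z. ennreal (bivariate_normal_density \<mu>\<^sub>X \<mu>\<^sub>Y \<sigma>\<^sub>X \<sigma>\<^sub>Y \<rho> z) * ?h (case z of (x, y) \<Rightarrow> x * y) \<partial>(lborel \<Otimes>\<^sub>M lborel))"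
    by (rule distributed_nn_integral[OF dens, symmetric]) measurable
  also have "\<dots> = (\<integral>\<^sup>+p. \<integral>\<^sup>+d. ennreal (\<sigma>\<^sub>X * \<sigma>\<^sub>Y / 2) * (ennreal (bivariate_normal_density \<mu>\<^sub>X \<mu>\<^sub>Y \<sigma>\<^sub>X \<sigma>\<^sub>Y \<rho> (\<sigma>\<^sub>X * (p + d) / 2, \<sigma>\<^sub>Y * (p - d) / 2)) *
      ?h (case (\<sigma>\<^sub>X * (p + d) / 2, \<sigma>\<^sub>Y * (p - d) / 2) of (x, y) \<Rightarrow> x * y)) \<partial>lborel \<partial>lborel)"
    by (rule nn_integral_plane_rotate[OF _ X Y]) measurable
  also have "\<dots> = (\<integral>\<^sup>+p. \<integral>\<^sup>+d. ?n p * (?k d * ?h (?\<kappa> * p\<^sup>2 - ?\<kappa> * d\<^sup>2)) \<partial>lborel \<partial>lborel)"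
  proof (intro nn_integral_cong)
    fix p d :: real
    have "ennreal (\<sigma>\<^sub>X * \<sigma>\<^sub>Y / 2) * ennreal (bivariate_normal_density \<mu>\<^sub>X \<mu>\<^sub>Y \<sigma>\<^sub>X \<sigma>\<^sub>Y \<rho> (\<sigma>\<^sub>X * (p + d) / 2, \<sigma>\<^sub>Y * (p - d) / 2)) = ?n p * ?k d"
      using bivariate_normal_density_rotate[OF X Y \<rho>, of \<mu>\<^sub>X \<mu>\<^sub>Y p d] bivariate_normal_density_nonneg[OF X Y \<rho>] X Y
      by (simp flip: ennreal_mult)
    moreover have "\<sigma>\<^sub>X * (p + d) / 2 * (\<sigma>\<^sub>Y * (p - d) / 2) = ?\<kappa> * p\<^sup>2 - ?\<kappa> * d\<^sup>2"
      by (simp add: power2_eq_square field_simps)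
    ultimately show "ennreal (\<sigma>\<^sub>X * \<sigma>\<^sub>Y / 2) * (ennreal (bivariate_normal_density \<mu>\<^sub>X \<mu>\<^sub>Y \<sigma>\<^sub>X \<sigma>\<^sub>Y \<rho> (\<sigma>\<^sub>X * (p + d) / 2, \<sigma>\<^sub>Y * (p - d) / 2)) *
      ?h (case (\<sigma>\<^sub>X * (p + d) / 2, \<sigma>\<^sub>Y * (p - d) / 2) of (x, y) \<Rightarrow> x * y)) = ?n p * (?k d * ?h (?\<kappa> * p\<^sup>2 - ?\<kappa> * d\<^sup>2))"
      by (simp only: prod.case mult.assoc[symmetric])
  qed
  also have "\<dots> = (\<integral>\<^sup>+p. ?n p * (\<integral>\<^sup>+d. ?k d * ?h (?\<kappa> * p\<^sup>2 - ?\<kappa> * d\<^sup>2) \<partial>lborel) \<partial>lborel)"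
    by (subst nn_integral_cmult) simp_all
  also have "\<dots> = (\<integral>\<^sup>+p. ?n p * (\<integral>\<^sup>+y. gamma_mixture 1 ?m ?s y * ?h (?\<kappa> * p\<^sup>2 - y) \<partial>lborel) \<partial>lborel)"
  proof (rule nn_integral_cong)
    fix p :: real
    have "(\<integral>\<^sup>+d. ?k d * ?h (?\<kappa> * p\<^sup>2 - ?\<kappa> * d\<^sup>2) \<partial>lborel) =
        (\<integral>\<^sup>+y. gamma_mixture 1 (?\<nu>\<^sup>2 / (2 * (2 * (1 - \<rho>)))) (1 / (2 * (2 * (1 - \<rho>)) * ?\<kappa>)) y * ?h (?\<kappa> * p\<^sup>2 - y) \<partial>lborel)"
      by (rule nn_integral_normal_square[where h="\<lambda>y. ?h (?\<kappa> * p\<^sup>2 - y)", OF _ v(2,3)]) measurable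
    then show "?n p * (\<integral>\<^sup>+d. ?k d * ?h (?\<kappa> * p\<^sup>2 - ?\<kappa> * d\<^sup>2) \<partial>lborel) = ?n p * (\<integral>\<^sup>+y. gamma_mixture 1 ?m ?s y * ?h (?\<kappa> * p\<^sup>2 - y) \<partial>lborel)"
      by (simp only: \<kappa> l)
  qed
  \<comment> \<open>Here h is the whole inner integral, as a function of \<kappa> p^2.\<close>
  also have "\<dots> = (\<integral>\<^sup>+x. gamma_mixture 1 (?\<mu>\<^sup>2 / (2 * (2 * (1 + \<rho>)))) (1 / (2 * (2 * (1 + \<rho>)) * ?\<kappa>)) x *
      (\<integral>\<^sup>+y. gamma_mixture 1 ?m ?s y * ?h (x - y) \<partial>lborel) \<partial>lborel)"
    by (rule nn_integral_normal_square[where h="\<lambda>x. \<integral>\<^sup>+y. gamma_mixture 1 ?m ?s y * ?h (x - y) \<partial>lborel", OF _ v(1,3)]) measurable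
  also have "\<dots> = (\<integral>\<^sup>+x. gamma_mixture 1 ?l ?r x * (\<integral>\<^sup>+y. gamma_mixture 1 ?m ?s (- y) * ?h (x + y) \<partial>lborel) \<partial>lborel)"
    unfolding l \<kappa>
  proof (rule nn_integral_cong)
    fix x :: real
    have "(\<integral>\<^sup>+y. gamma_mixture 1 ?m ?s y * ?h (x - y) \<partial>lborel) = (\<integral>\<^sup>+y. gamma_mixture 1 ?m ?s (- y) * ?h (x + y) \<partial>lborel)"
      by (subst nn_integral_real_affine[of _ "- 1" 0]) simp_all
    then show "gamma_mixture 1 ?l ?r x * (\<integral>\<^sup>+y. gamma_mixture 1 ?m ?s y * ?h (x - y) \<partial>lborel) =
        gamma_mixture 1 ?l ?r x * (\<integral>\<^sup>+y. gamma_mixture 1 ?m ?s (- y) * ?h (x + y) \<partial>lborel)"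
      by (simp only:)
  qed
  also have "\<dots> = emeasure (chisq_difference 1 ?l ?r ?m ?s) A"
  proof -
    have "?l \<ge> 0" "?r > 0" "?m \<ge> 0" "?s > 0" using X Y \<rho> by simp_all
    note f = finite_gamma_mixture[OF this, of 1, simplified]
    have "emeasure (chisq_difference 1 ?l ?r ?m ?s) A = (\<integral>\<^sup>+z. ?h z \<partial>chisq_difference 1 ?l ?r ?m ?s)" by simp
    also have "\<dots> = (\<integral>\<^sup>+x. \<integral>\<^sup>+y. ?h (x + y) \<partial>density lborel (\<lambda>x. gamma_mixture 1 ?m ?s (- x)) \<partial>density lborel (gamma_mixture 1 ?l ?r))"
      unfolding chisq_difference_def using f by (intro nn_integral_convolution) simp_all
    also have "\<dots> = (\<integral>\<^sup>+x. gamma_mixture 1 ?l ?r x * (\<integral>\<^sup>+y. gamma_mixture 1 ?m ?s (- y) * ?h (x + y) \<partial>lborel) \<partial>lborel)"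
      by (simp add: nn_integral_density)
    finally show ?thesis ..
  qed
  finally show "emeasure (distr M borel (\<lambda>\<omega>. X \<omega> * Y \<omega>)) A = emeasure (chisq_difference 1 ?l ?r ?m ?s) A" .
qed simp

section \<open>The density series\<close>

text \<open>The density at x > 0 of the difference of independent Gamma variables with shapes
  \<alpha>, \<beta> and rates r, s. Negative arguments are reached by exchanging the two
  variables.\<close>

definition gamma_difference_density :: "real \<Rightarrow> real \<Rightarrow> real \<Rightarrow> real \<Rightarrow> real \<Rightarrow> real" where
  "gamma_difference_density \<alpha> r \<beta> s x =
    r powr \<alpha> * s powr \<beta> * (r + s) powr (1 - \<alpha> - \<beta>) * exp (- r * x) / Gamma \<alpha> *
      tricomi_U (1 - \<alpha>) (2 - \<alpha> - \<beta>) ((r + s) * x)"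

lemma gamma_difference_density_nonneg:
  assumes "\<alpha> > 0" "\<beta> > 0" "r > 0" "s > 0" "x > 0"
  shows "gamma_difference_density \<alpha> r \<beta> s x \<ge> 0"
  using tricomi_U_nonneg[OF assms] Gamma_real_pos[OF assms(1)] assms
  by (simp add: gamma_difference_density_def)

lemma gamma_mixture_difference:
  assumes l: "l \<ge> 0" and r: "r > 0" and m: "m \<ge> 0" and s: "s > 0" and q: "q > 0" and x: "x > 0"
  shows "(\<integral>\<^sup>+y. gamma_mixture q l r (x + y) * gamma_mixture q m s y \<partial>lborel) =
    (\<Sum>i. \<Sum>j. ennreal (poisson_weight (q * l) i * poisson_weight (q * m) j *
      gamma_difference_density (q / 2 + real i) r (q / 2 + real j) s x))"
proof -
  have "(\<integral>\<^sup>+y. ennreal (poisson_weight (q * l) i) * ennreal (gamma_density (q / 2 + real i) r (x + y)) *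
      (ennreal (poisson_weight (q * m) j) * ennreal (gamma_density (q / 2 + real j) s y)) \<partial>lborel) =
      ennreal (poisson_weight (q * l) i * poisson_weight (q * m) j *
      gamma_difference_density (q / 2 + real i) r (q / 2 + real j) s x)" (is "?L = _") for i j
  proof -
    have pos: "q / 2 + real i > 0" "q / 2 + real j > 0" using q by simp_all
    have "?L = (\<integral>\<^sup>+y. ennreal (poisson_weight (q * l) i * poisson_weight (q * m) j) *
      (ennreal (gamma_density (q / 2 + real i) r (x + y)) * ennreal (gamma_density (q / 2 + real j) s y)) \<partial>lborel)"
      using q l m by (intro nn_integral_cong) (simp add: ennreal_mult poisson_weight_nonneg mult_ac)
    also have "\<dots> = ennreal (poisson_weight (q * l) i * poisson_weight (q * m) j) *
      ennreal (gamma_difference_density (q / 2 + real i) r (q / 2 + real j) s x)"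
      unfolding gamma_difference_density_def gamma_density_difference(1)[OF pos r s x, symmetric]
      by (subst nn_integral_cmult) simp_all
    also have "\<dots> = ennreal (poisson_weight (q * l) i * poisson_weight (q * m) j *
        gamma_difference_density (q / 2 + real i) r (q / 2 + real j) s x)"
      using q l m by (intro ennreal_mult[symmetric] gamma_difference_density_nonneg pos r s x mult_nonneg_nonneg poisson_weight_nonneg) auto
    finally show ?thesis .
  qed
  then show ?thesis
    unfolding gamma_mixture_def by (subst nn_integral_suminf_mult_suminf) simp_all
qed

text \<open>Translation of y by x. It reduces the density at x < 0 to the positive case with the two
  mixtures exchanged.\<close>

lemma gamma_mixture_difference_swap:
  "(\<integral>\<^sup>+y. gamma_mixture q l r (x + y) * gamma_mixture q m s y \<partial>lborel) =
    (\<integral>\<^sup>+y. gamma_mixture q m s (- x + y) * gamma_mixture q l r y \<partial>lborel)"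
  by (subst nn_integral_real_affine[of _ 1 "- x"]) (simp_all add: mult.commute)

section \<open>Matching the coefficients of the series\<close>

text \<open>Everything is expressed through r + s: the rates are r = (r + s)(1 - \<rho>)/2 and s =
  (r + s)(1 + \<rho>)/2. The powers of r + s collapse to one, and the remaining factors merge with
  the Poisson weights.\<close>

lemma summand_weight:
  fixes \<mu>\<^sub>X \<mu>\<^sub>Y \<sigma>\<^sub>X \<sigma>\<^sub>Y \<rho> q :: real and k j :: nat
  assumes X: "0 < \<sigma>\<^sub>X" and Y: "0 < \<sigma>\<^sub>Y" and \<rho>: "-1 < \<rho>" "\<rho> < 1" and j: "j \<le> k"
  defines "r \<equiv> 1 / (\<sigma>\<^sub>X * \<sigma>\<^sub>Y * (1 + \<rho>))" and "s \<equiv> 1 / (\<sigma>\<^sub>X * \<sigma>\<^sub>Y * (1 - \<rho>))"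
  shows "poisson_weight (q * ((\<mu>\<^sub>X / \<sigma>\<^sub>X + \<mu>\<^sub>Y / \<sigma>\<^sub>Y)\<^sup>2 / (4 * (1 + \<rho>)))) (k - j) *
      poisson_weight (q * ((\<mu>\<^sub>X / \<sigma>\<^sub>X - \<mu>\<^sub>Y / \<sigma>\<^sub>Y)\<^sup>2 / (4 * (1 - \<rho>)))) j *
      (r powr (q / 2 + real (k - j)) * s powr (q / 2 + real j) * (r + s) powr (1 - q - real k)) =
    (1 - \<rho>\<^sup>2) powr (q / 2 - 1) / (2 powr (q - 1) * \<sigma>\<^sub>X * \<sigma>\<^sub>Y) *
      exp (- q / (2 * (1 - \<rho>\<^sup>2)) *
        (\<mu>\<^sub>X\<^sup>2 / \<sigma>\<^sub>X\<^sup>2 + \<mu>\<^sub>Y\<^sup>2 / \<sigma>\<^sub>Y\<^sup>2 - 2 * \<rho> * \<mu>\<^sub>X * \<mu>\<^sub>Y / (\<sigma>\<^sub>X * \<sigma>\<^sub>Y))) *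
      ((q / 8) ^ k / fact k * real (k choose j) *
        ((1 + \<rho>) / (1 - \<rho>)) ^ j * (\<mu>\<^sub>X / \<sigma>\<^sub>X - \<mu>\<^sub>Y / \<sigma>\<^sub>Y) ^ (2 * j) *
        ((1 - \<rho>) / (1 + \<rho>)) ^ (k - j) * (\<mu>\<^sub>X / \<sigma>\<^sub>X + \<mu>\<^sub>Y / \<sigma>\<^sub>Y) ^ (2 * k - 2 * j))"
proof -
  define i where "i = k - j"
  have k: "k = i + j" using j by (simp add: i_def)
  define u where "u = \<mu>\<^sub>X / \<sigma>\<^sub>X + \<mu>\<^sub>Y / \<sigma>\<^sub>Y"
  define w where "w = \<mu>\<^sub>X / \<sigma>\<^sub>X - \<mu>\<^sub>Y / \<sigma>\<^sub>Y"
  define c where "c = \<sigma>\<^sub>X * \<sigma>\<^sub>Y"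
  have c: "c > 0" using X Y by (simp add: c_def)
  have p: "1 + \<rho> > 0" "1 - \<rho> > 0" using \<rho> by simp_all
  have p2: "1 - \<rho>\<^sup>2 = (1 + \<rho>) * (1 - \<rho>)" by (simp add: power2_eq_square algebra_simps)
  have p2pos: "1 - \<rho>\<^sup>2 > 0" unfolding p2 using p by simp
  have rs: "r + s = 2 / (c * (1 - \<rho>\<^sup>2))"
    unfolding r_def s_def c_def[symmetric] p2 using c p by (simp add: divide_simps)
  have "1 / (c * a) = 2 / (c * (a * b)) * (b / 2)" "1 / (c * b) = 2 / (c * (a * b)) * (a / 2)" if "a > 0" "b > 0" for a b
    using that by simp_all
  from this[OF p] have r: "r = (r + s) * ((1 - \<rho>) / 2)" and s: "s = (r + s) * ((1 + \<rho>) / 2)"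
    unfolding rs p2 by (simp_all only: r_def s_def c_def)
  have t: "r + s > 0" unfolding rs using c p2pos by simp

  have powers: "r powr (q / 2 + real i) * s powr (q / 2 + real j) * (r + s) powr (1 - q - real k) =
    (1 - \<rho>\<^sup>2) powr (q / 2 - 1) / (2 powr (q - 1) * c) * (((1 - \<rho>) / 2) ^ i * ((1 + \<rho>) / 2) ^ j)"
  proof -
    have r': "r powr (q / 2 + real i) = (r + s) powr (q / 2 + real i) * (((1 - \<rho>) / 2) powr (q / 2) * ((1 - \<rho>) / 2) ^ i)"
    proof -
      have "r powr (q / 2 + real i) = (r + s) powr (q / 2 + real i) * ((1 - \<rho>) / 2) powr (q / 2 + real i)"
        using t p by (subst r, subst powr_mult) simp_all
      then show ?thesis using p by (simp add: powr_add[of "(1 - \<rho>) / 2"] powr_realpow)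
    qed
    have s': "s powr (q / 2 + real j) = (r + s) powr (q / 2 + real j) * (((1 + \<rho>) / 2) powr (q / 2) * ((1 + \<rho>) / 2) ^ j)"
    proof -
      have "s powr (q / 2 + real j) = (r + s) powr (q / 2 + real j) * ((1 + \<rho>) / 2) powr (q / 2 + real j)"
        using t p by (subst s, subst powr_mult) simp_all
      then show ?thesis using p by (simp add: powr_add[of "(1 + \<rho>) / 2"] powr_realpow)
    qed
    \<comment> \<open>The exponents add up to 1 because k = i + j.\<close>
    have T: "(r + s) powr (q / 2 + real i) * (r + s) powr (q / 2 + real j) * (r + s) powr (1 - q - real k) = r + s"
      using t by (simp add: k flip: powr_add)
    have Q: "((1 - \<rho>) / 2) powr (q / 2) * ((1 + \<rho>) / 2) powr (q / 2) = (1 - \<rho>\<^sup>2) powr (q / 2) / 2 powr q"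
    proof -
      have "((1 - \<rho>) / 2) powr (q / 2) * ((1 + \<rho>) / 2) powr (q / 2) = ((1 - \<rho>\<^sup>2) / 4) powr (q / 2)"
        using p by (simp add: p2 mult.commute flip: powr_mult)
      also have "\<dots> = (1 - \<rho>\<^sup>2) powr (q / 2) / 4 powr (q / 2)" using p2pos by (simp add: powr_divide)
      also have "(4::real) powr (q / 2) = (2 powr 2) powr (q / 2)" by simp
      also have "\<dots> = 2 powr q" by (simp only: powr_powr) simp
      finally show ?thesis .
    qed
    \<comment> \<open>The remaining factor r + s = 2/(c (1 - \<rho>^2)) is what lowers the exponents
      to q/2 - 1 and q - 1.\<close>
    have R: "(r + s) * ((1 - \<rho>\<^sup>2) powr (q / 2) / 2 powr q) = (1 - \<rho>\<^sup>2) powr (q / 2 - 1) / (2 powr (q - 1) * c)"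
    proof -
      have "(1 - \<rho>\<^sup>2) powr (q / 2 - 1) = (1 - \<rho>\<^sup>2) powr (q / 2) / (1 - \<rho>\<^sup>2)" using p2pos by (simp add: powr_diff)
      moreover have "(2::real) powr (q - 1) = 2 powr q / 2" by (simp add: powr_diff)
      moreover have "2 / (c * N) * (A / B) = A / N / (B / 2 * c)" for N A B :: real by (simp add: mult_ac)
      ultimately show ?thesis by (simp only: rs)
    qed
    have "(ti * (ai * bi)) * (tj * (aj * bj)) * tk = (ti * tj * tk) * (ai * aj) * (bi * bj)"
      for ti tj tk ai aj bi bj :: real by simp
    then show ?thesis unfolding r' s' by (simp only: T Q R)
  qed

  have weights: "poisson_weight (q * (u\<^sup>2 / (4 * (1 + \<rho>)))) i * poisson_weight (q * (w\<^sup>2 / (4 * (1 - \<rho>)))) j *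
      (((1 - \<rho>) / 2) ^ i * ((1 + \<rho>) / 2) ^ j) =
    exp (- q / (2 * (1 - \<rho>\<^sup>2)) *
        (\<mu>\<^sub>X\<^sup>2 / \<sigma>\<^sub>X\<^sup>2 + \<mu>\<^sub>Y\<^sup>2 / \<sigma>\<^sub>Y\<^sup>2 - 2 * \<rho> * \<mu>\<^sub>X * \<mu>\<^sub>Y / (\<sigma>\<^sub>X * \<sigma>\<^sub>Y))) *
      ((q / 8) ^ k / fact k * real (k choose j) *
        ((1 + \<rho>) / (1 - \<rho>)) ^ j * w ^ (2 * j) * ((1 - \<rho>) / (1 + \<rho>)) ^ i * u ^ (2 * i))"
  proof -
    have e: "exp (- (q * (u\<^sup>2 / (4 * (1 + \<rho>))))) * exp (- (q * (w\<^sup>2 / (4 * (1 - \<rho>))))) =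
      exp (- q / (2 * (1 - \<rho>\<^sup>2)) *
        (\<mu>\<^sub>X\<^sup>2 / \<sigma>\<^sub>X\<^sup>2 + \<mu>\<^sub>Y\<^sup>2 / \<sigma>\<^sub>Y\<^sup>2 - 2 * \<rho> * \<mu>\<^sub>X * \<mu>\<^sub>Y / (\<sigma>\<^sub>X * \<sigma>\<^sub>Y)))"
    proof -
      define a where "a = \<mu>\<^sub>X / \<sigma>\<^sub>X"
      define b where "b = \<mu>\<^sub>Y / \<sigma>\<^sub>Y"
      have ab: "\<mu>\<^sub>X\<^sup>2 / \<sigma>\<^sub>X\<^sup>2 = a\<^sup>2" "\<mu>\<^sub>Y\<^sup>2 / \<sigma>\<^sub>Y\<^sup>2 = b\<^sup>2" "2 * \<rho> * \<mu>\<^sub>X * \<mu>\<^sub>Y / (\<sigma>\<^sub>X * \<sigma>\<^sub>Y) = 2 * \<rho> * a * b"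
        by (simp_all add: a_def b_def power_divide)
      have "(a + b)\<^sup>2 / (4 * (1 + \<rho>)) + (a - b)\<^sup>2 / (4 * (1 - \<rho>)) = (a\<^sup>2 + b\<^sup>2 - 2 * \<rho> * a * b) / (2 * (1 - \<rho>\<^sup>2))"
      proof -
        have "(a + b)\<^sup>2 / (4 * (1 + \<rho>)) + (a - b)\<^sup>2 / (4 * (1 - \<rho>)) =
            ((a + b)\<^sup>2 * (1 - \<rho>) + (a - b)\<^sup>2 * (1 + \<rho>)) / (4 * ((1 + \<rho>) * (1 - \<rho>)))"
          using p by (simp add: divide_simps) (simp add: algebra_simps)
        also have "(a + b)\<^sup>2 * (1 - \<rho>) + (a - b)\<^sup>2 * (1 + \<rho>) = 2 * (a\<^sup>2 + b\<^sup>2 - 2 * \<rho> * a * b)"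
          by (simp add: power2_eq_square algebra_simps)
        also have "2 * Q / (4 * P) = Q / (2 * P)" for Q P :: real by simp
        finally show ?thesis unfolding p2 .
      qed
      moreover have "q * u1 + q * u2 = q / d * n" if "u1 + u2 = n / d" for u1 u2 n d :: real
        unfolding distrib_left[symmetric] that by simp
      ultimately have "q * ((a + b)\<^sup>2 / (4 * (1 + \<rho>))) + q * ((a - b)\<^sup>2 / (4 * (1 - \<rho>))) = q / (2 * (1 - \<rho>\<^sup>2)) * (a\<^sup>2 + b\<^sup>2 - 2 * \<rho> * a * b)"
        by blast
      then show ?thesis
        unfolding ab u_def w_def a_def[symmetric] b_def[symmetric] exp_add[symmetric] by simp
    qed
    \<comment> \<open>The constant 8 is 4 from the Poisson mean times 2 from the ratio r/(r +
      s).\<close>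
    have U: "(q * (u\<^sup>2 / (4 * (1 + \<rho>)))) ^ i * ((1 - \<rho>) / 2) ^ i = (q / 8) ^ i * ((1 - \<rho>) / (1 + \<rho>)) ^ i * u ^ (2 * i)"
    proof -
      have "q * (u\<^sup>2 / (4 * (1 + \<rho>))) * ((1 - \<rho>) / 2) = (q / 8) * ((1 - \<rho>) / (1 + \<rho>)) * u\<^sup>2" by simp
      then show ?thesis by (simp only: power_mult_distrib[symmetric] power_mult)
    qed
    have W: "(q * (w\<^sup>2 / (4 * (1 - \<rho>)))) ^ j * ((1 + \<rho>) / 2) ^ j = (q / 8) ^ j * ((1 + \<rho>) / (1 - \<rho>)) ^ j * w ^ (2 * j)"
    proof -
      have "q * (w\<^sup>2 / (4 * (1 - \<rho>))) * ((1 + \<rho>) / 2) = (q / 8) * ((1 + \<rho>) / (1 - \<rho>)) * w\<^sup>2" by simp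
      then show ?thesis by (simp only: power_mult_distrib[symmetric] power_mult)
    qed
    have B: "real (k choose j) = fact k / (fact j * fact i)" using binomial_fact[OF j, where ?'a=real] by (simp add: i_def)
    have K: "(q / 8) ^ k = (q / 8) ^ i * (q / 8) ^ j" by (simp add: k power_add)
    have "(e1 * ui / fi) * (e2 * wj / fj) * (pi * pj) = (e1 * e2) * ((ui * pi) * (wj * pj) / (fi * fj))"
      for e1 e2 ui wj pi pj fi fj :: real by simp
    then have L: "poisson_weight (q * (u\<^sup>2 / (4 * (1 + \<rho>)))) i * poisson_weight (q * (w\<^sup>2 / (4 * (1 - \<rho>)))) j *
      (((1 - \<rho>) / 2) ^ i * ((1 + \<rho>) / 2) ^ j) = exp (- q / (2 * (1 - \<rho>\<^sup>2)) *
        (\<mu>\<^sub>X\<^sup>2 / \<sigma>\<^sub>X\<^sup>2 + \<mu>\<^sub>Y\<^sup>2 / \<sigma>\<^sub>Y\<^sup>2 - 2 * \<rho> * \<mu>\<^sub>X * \<mu>\<^sub>Y / (\<sigma>\<^sub>X * \<sigma>\<^sub>Y))) *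
        (((q / 8) ^ i * ((1 - \<rho>) / (1 + \<rho>)) ^ i * u ^ (2 * i)) * ((q / 8) ^ j * ((1 + \<rho>) / (1 - \<rho>)) ^ j * w ^ (2 * j)) / (fact i * fact j))"
      unfolding poisson_weight_def by (simp only: e U W)
    have g: "(qi * pi * ui) * (qj * pj * wj) / (fi * fj) = qi * qj / fk * (fk / (fj * fi)) * pj * wj * pi * ui"
      if "fk \<noteq> 0" for qi qj pi pj ui wj fi fj fk :: real using that by (simp add: mult_ac)
    show ?thesis unfolding L B K by (rule arg_cong[of _ _ "times _"], rule g) (rule fact_nonzero)
  qed
  have i2: "2 * k - 2 * j = 2 * i" by (simp add: k)
  have Q: "2 powr (q - 1) * \<sigma>\<^sub>X * \<sigma>\<^sub>Y = 2 powr (q - 1) * c" by (simp add: c_def)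
  have "x * y * (Q * P) = Q * e * R" if "x * y * P = e * R" for x y Q P e R :: real
    using that by (simp add: mult_ac)
  from this[OF weights] show ?thesis
    unfolding i2 i_def[symmetric] u_def[symmetric] w_def[symmetric] powers Q .
qed


text \<open>The series is the double Poisson mixture summed along k = i + j, with i = k - j the
  index of the positive part. \<open>a_index\<close> selects the shape of the part whose exponential
  survives: the positive part for x > 0, the negative one for x < 0.\<close>

lemma summand_density_eq:
  fixes \<mu>\<^sub>X \<mu>\<^sub>Y \<sigma>\<^sub>X \<sigma>\<^sub>Y \<rho> q x :: real
  assumes X: "0 < \<sigma>\<^sub>X" and Y: "0 < \<sigma>\<^sub>Y" and \<rho>: "-1 < \<rho>" "\<rho> < 1" and q: "q > 0" and x: "x \<noteq> 0"
  defines "r \<equiv> 1 / (\<sigma>\<^sub>X * \<sigma>\<^sub>Y * (1 + \<rho>))" and "s \<equiv> 1 / (\<sigma>\<^sub>X * \<sigma>\<^sub>Y * (1 - \<rho>))"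
    and "l \<equiv> (\<mu>\<^sub>X / \<sigma>\<^sub>X + \<mu>\<^sub>Y / \<sigma>\<^sub>Y)\<^sup>2 / (4 * (1 + \<rho>))" and "m \<equiv> (\<mu>\<^sub>X / \<sigma>\<^sub>X - \<mu>\<^sub>Y / \<sigma>\<^sub>Y)\<^sup>2 / (4 * (1 - \<rho>))"
  shows "summand_density \<mu>\<^sub>X \<mu>\<^sub>Y \<sigma>\<^sub>X \<sigma>\<^sub>Y \<rho> q x =
    enn2ereal (\<integral>\<^sup>+y. gamma_mixture q l r (x + y) * gamma_mixture q m s y \<partial>lborel)"
proof -
  have r: "r > 0" and s: "s > 0" and l: "l \<ge> 0" and m: "m \<ge> 0"
    using X Y \<rho> by (simp_all add: r_def s_def l_def m_def)
  define A where "A = (1 - \<rho>\<^sup>2) powr (q / 2 - 1) / (2 powr (q - 1) * \<sigma>\<^sub>X * \<sigma>\<^sub>Y)"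
  define E where "E = - q / (2 * (1 - \<rho>\<^sup>2)) *
        (\<mu>\<^sub>X\<^sup>2 / \<sigma>\<^sub>X\<^sup>2 + \<mu>\<^sub>Y\<^sup>2 / \<sigma>\<^sub>Y\<^sup>2 - 2 * \<rho> * \<mu>\<^sub>X * \<mu>\<^sub>Y / (\<sigma>\<^sub>X * \<sigma>\<^sub>Y))"
  define e where "e = \<bar>x\<bar> / (\<sigma>\<^sub>X * \<sigma>\<^sub>Y * (1 + \<rho> * sgn x))"
  define G where "G k j = Gamma (q / 2 + real (a_index j k x))" for k j
  define C where "C k j = (q / 8) ^ k / (fact k * G k j) * real (k choose j) *
          ((1 + \<rho>) / (1 - \<rho>)) ^ j * (\<mu>\<^sub>X / \<sigma>\<^sub>X - \<mu>\<^sub>Y / \<sigma>\<^sub>Y) ^ (2 * j) *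
          ((1 - \<rho>) / (1 + \<rho>)) ^ (k - j) * (\<mu>\<^sub>X / \<sigma>\<^sub>X + \<mu>\<^sub>Y / \<sigma>\<^sub>Y) ^ (2 * k - 2 * j)" for k j
  define U where "U k j = tricomi_U (1 - q / 2 - real (a_index j k x)) (2 - q - real k) ((r + s) * \<bar>x\<bar>)" for k j
  \<comment> \<open>The contribution of the pair (k - j, j) to the density; for x < 0 the two Gamma
    variables exchange roles.\<close>
  define T where "T k j = poisson_weight (q * l) (k - j) * poisson_weight (q * m) j *
     (if x > 0 then gamma_difference_density (q / 2 + real (k - j)) r (q / 2 + real j) s x
      else gamma_difference_density (q / 2 + real j) s (q / 2 + real (k - j)) r (- x))" for k j

  have arg: "2 * \<bar>x\<bar> / (\<sigma>\<^sub>X * \<sigma>\<^sub>Y * (1 - \<rho>\<^sup>2)) = (r + s) * \<bar>x\<bar>"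
  proof -
    have "1 - \<rho>\<^sup>2 = (1 + \<rho>) * (1 - \<rho>)" by (simp add: power2_eq_square algebra_simps)
    moreover have "2 * y / (c * ((1 + \<rho>) * (1 - \<rho>))) = (1 / (c * (1 + \<rho>)) + 1 / (c * (1 - \<rho>))) * y" if "c > 0" for c y
      using that \<rho> by (simp add: divide_simps)
    ultimately show ?thesis using X Y by (simp only: r_def s_def mult_pos_pos)
  qed
  have T_nonneg: "0 \<le> T k j" for k j
    using q l m r s x unfolding T_def
    by (auto intro!: mult_nonneg_nonneg poisson_weight_nonneg gamma_difference_density_nonneg)
  have term_eq: "A * exp (E - e) * (C k j * U k j) = T k j" if j: "j \<le> k" for k j
  proof -
    define W where "W = r powr (q / 2 + real (k - j)) * s powr (q / 2 + real j) * (r + s) powr (1 - q - real k)"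
    have pq: "1 - (q / 2 + real (k - j)) - (q / 2 + real j) = 1 - q - real k"
      "1 - (q / 2 + real j) - (q / 2 + real (k - j)) = 1 - q - real k"
      "2 - (q / 2 + real (k - j)) - (q / 2 + real j) = 2 - q - real k"
      "2 - (q / 2 + real j) - (q / 2 + real (k - j)) = 2 - q - real k"
      using j by (simp_all add: of_nat_diff)
    have T: "T k j = poisson_weight (q * l) (k - j) * poisson_weight (q * m) j * W * (exp (- e) / G k j * U k j)"
    proof (cases "x > 0")
      case True
      have "- r * x = - e" using True by (simp add: e_def r_def)
      moreover have q1: "1 - (q / 2 + real (k - j)) = 1 - q / 2 - real (k - j)" by simp
      ultimately show ?thesis using True
        unfolding T_def gamma_difference_density_def pq W_def U_def G_def unfolding q1 by (simp add: a_index_def)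
    next
      case False
      then have neg: "x < 0" using x by simp
      have "- s * (- x) = - e" using neg by (simp add: e_def s_def)
      moreover have q1: "1 - (q / 2 + real j) = 1 - q / 2 - real j" by simp
      ultimately show ?thesis using neg
        unfolding T_def gamma_difference_density_def pq W_def U_def G_def unfolding q1 by (simp add: a_index_def add.commute mult_ac)
    qed
    have "poisson_weight (q * l) (k - j) * poisson_weight (q * m) j * W = A * exp E * (C k j * G k j)"
    proof -
      have "G k j \<noteq> 0" using q by (simp add: G_def less_imp_neq[OF Gamma_real_pos, symmetric] add_pos_nonneg)
      then have "C k j * G k j = (q / 8) ^ k / fact k * real (k choose j) *
          ((1 + \<rho>) / (1 - \<rho>)) ^ j * (\<mu>\<^sub>X / \<sigma>\<^sub>X - \<mu>\<^sub>Y / \<sigma>\<^sub>Y) ^ (2 * j) *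
          ((1 - \<rho>) / (1 + \<rho>)) ^ (k - j) * (\<mu>\<^sub>X / \<sigma>\<^sub>X + \<mu>\<^sub>Y / \<sigma>\<^sub>Y) ^ (2 * k - 2 * j)"
        by (simp add: C_def)
      then show ?thesis
        using summand_weight[OF X Y \<rho> j, of q \<mu>\<^sub>X \<mu>\<^sub>Y] unfolding W_def l_def m_def r_def s_def A_def E_def by (simp only:)
    qed
    moreover have "exp (E - e) = exp E * exp (- e)" by (simp flip: exp_add)
    moreover have "G k j \<noteq> 0" using q by (simp add: G_def less_imp_neq[OF Gamma_real_pos, symmetric] add_pos_nonneg)
    ultimately show ?thesis unfolding T by simp
  qed
  have A: "A * exp (E - e) > 0"
  proof -
    have "1 - \<rho>\<^sup>2 > 0" using \<rho> by (simp add: abs_square_less_1 abs_less_iff)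
    then show ?thesis using X Y by (simp add: A_def)
  qed
  \<comment> \<open>Pulling the constant factor into the extended-real series requires nonnegative
    terms. Their sign is inherited from T after cancelling the positive prefactor.\<close>
  have CU: "0 \<le> (\<Sum>j\<le>k. C k j * U k j)" for k
  proof (rule sum_nonneg)
    fix j assume "j \<in> {..k}"
    then have "0 \<le> A * exp (E - e) * (C k j * U k j)" using term_eq T_nonneg by simp
    then show "0 \<le> C k j * U k j" using A by (simp only: zero_le_mult_iff) auto
  qed
  \<comment> \<open>This selects the finite branch of \<open>tricomi_U_ext\<close>.\<close>
  have "(r + s) * \<bar>x\<bar> \<noteq> 0" using r s x by simp
  then have "summand_density \<mu>\<^sub>X \<mu>\<^sub>Y \<sigma>\<^sub>X \<sigma>\<^sub>Y \<rho> q x =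
      ereal (A * exp (E - e)) * (\<Sum>k. ereal (\<Sum>j\<le>k. C k j * U k j))"
    unfolding summand_density_def arg tricomi_U_ext_def A_def E_def e_def C_def G_def U_def
    by (simp add: atLeast0AtMost)
  also have "\<dots> = (\<Sum>k. ereal (A * exp (E - e)) * ereal (\<Sum>j\<le>k. C k j * U k j))"
    using A CU by (intro suminf_cmult_ereal[symmetric]) auto
  also have "\<dots> = (\<Sum>k. enn2ereal (\<Sum>j\<le>k. ennreal (T k j)))"
  proof (rule suminf_cong)
    fix k
    have "A * exp (E - e) * (\<Sum>j\<le>k. C k j * U k j) = (\<Sum>j\<le>k. T k j)"
      unfolding sum_distrib_left by (intro sum.cong refl term_eq) simp
    then show "ereal (A * exp (E - e)) * ereal (\<Sum>j\<le>k. C k j * U k j) = enn2ereal (\<Sum>j\<le>k. ennreal (T k j))"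
      using T_nonneg by (simp add: sum_nonneg)
  qed
  also have "\<dots> = enn2ereal (\<Sum>k. \<Sum>j\<le>k. ennreal (T k j))" by (rule suminf_enn2ereal)
  also have "(\<Sum>k. \<Sum>j\<le>k. ennreal (T k j)) = (\<integral>\<^sup>+y. gamma_mixture q l r (x + y) * gamma_mixture q m s y \<partial>lborel)"
  proof (cases "x > 0")
    case True
    show ?thesis unfolding gamma_mixture_difference[OF l r m s q True] suminf_triangle_ennreal
      using True by (simp add: T_def)
  next
    case False
    then have neg: "x < 0" "- x > 0" using x by simp_all
    show ?thesis unfolding gamma_mixture_difference_swap[of q l r x] gamma_mixture_difference[OF m s l r q neg(2)]
      using neg by (subst suminf_swap_ennreal, subst suminf_triangle_ennreal) (simp add: T_def mult_ac)
  qed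
  finally show ?thesis .
qed

section \<open>The decomposition and infinite divisibility\<close>

theorem theorem2p12:
  fixes M :: "'a measure" and X Y Z :: "'a \<Rightarrow> real"
    and \<mu>\<^sub>X \<mu>\<^sub>Y \<sigma>\<^sub>X \<sigma>\<^sub>Y \<rho> :: real
  assumes "prob_space M"
    and "0 < \<sigma>\<^sub>X" and "0 < \<sigma>\<^sub>Y" and "-1 < \<rho>" and "\<rho> < 1"
    and "distributed M (lborel \<Otimes>\<^sub>M lborel) (\<lambda>\<omega>. (X \<omega>, Y \<omega>))
           (\<lambda>p. ennreal (bivariate_normal_density \<mu>\<^sub>X \<mu>\<^sub>Y \<sigma>\<^sub>X \<sigma>\<^sub>Y \<rho> p))"
    and "Z = (\<lambda>\<omega>. X \<omega> * Y \<omega>)"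
  shows "(\<forall>m::nat. 1 \<le> m \<longrightarrow>
            (\<exists>(N :: (nat \<Rightarrow> real) measure) U.
               prob_space N \<and>
               prob_space.indep_vars N (\<lambda>_. borel) U {1..m} \<and>
               (\<forall>i\<in>{1..m}.
                  has_pdf N (U i) (summand_density \<mu>\<^sub>X \<mu>\<^sub>Y \<sigma>\<^sub>X \<sigma>\<^sub>Y \<rho> (1 / real m))) \<and>
               distr M borel Z = distr N borel (\<lambda>\<omega>. \<Sum>i = 1..m. U i \<omega>)))
         \<and> infinitely_divisible (distr M borel Z)"
proof -
  define r where "r = 1 / (\<sigma>\<^sub>X * \<sigma>\<^sub>Y * (1 + \<rho>))"
  define s where "s = 1 / (\<sigma>\<^sub>X * \<sigma>\<^sub>Y * (1 - \<rho>))"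
  define a where "a = (\<mu>\<^sub>X / \<sigma>\<^sub>X + \<mu>\<^sub>Y / \<sigma>\<^sub>Y)\<^sup>2 / (4 * (1 + \<rho>))"
  define b where "b = (\<mu>\<^sub>X / \<sigma>\<^sub>X - \<mu>\<^sub>Y / \<sigma>\<^sub>Y)\<^sup>2 / (4 * (1 - \<rho>))"
  have pos: "a \<ge> 0" "r > 0" "b \<ge> 0" "s > 0" using assms(2-5) by (simp_all add: r_def s_def a_def b_def)
  have Z: "distr M borel Z = chisq_difference 1 a r b s"
    unfolding assms(7) a_def b_def r_def s_def by (rule distr_product_bivariate_normal[OF assms(2-6)])
  \<comment> \<open>The common law of the summands is recorded beside the density, so that infinite
    divisibility can be read off directly.\<close>
  have main: "\<exists>(N :: (nat \<Rightarrow> real) measure) U. prob_space N \<and>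
               prob_space.indep_vars N (\<lambda>_. borel) U {1..m} \<and>
               (\<forall>i\<in>{1..m}. distr N borel (U i) = chisq_difference (1 / real m) a r b s \<and>
                  has_pdf N (U i) (summand_density \<mu>\<^sub>X \<mu>\<^sub>Y \<sigma>\<^sub>X \<sigma>\<^sub>Y \<rho> (1 / real m))) \<and>
               distr M borel Z = distr N borel (\<lambda>\<omega>. \<Sum>i = 1..m. U i \<omega>)" if m: "1 \<le> m" for m :: nat
  proof -
    let ?q = "1 / real m"
    let ?P = "chisq_difference ?q a r b s"
    \<comment> \<open>The m-fold product of the law of one summand; the summands are its
      coordinates.\<close>
    let ?N = "Pi\<^sub>M {1..m} (\<lambda>_. ?P)"
    let ?U = "\<lambda>i \<omega>. \<omega> i :: real"
    have q: "?q > 0" using m by simp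
    interpret P: prob_space ?P by (rule prob_space_chisq_difference[OF pos q])
    interpret N: prob_space ?N by (intro prob_space_PiM P.prob_space_axioms)
    have sets_N: "sets ?N = sets (Pi\<^sub>M {1..m} (\<lambda>_. borel))" by (intro sets_PiM_cong) simp_all
    have rv: "?U i \<in> borel_measurable ?N" if "i \<in> {1..m}" for i
      using measurable_component_singleton[OF that, of "\<lambda>_. ?P"] by (simp cong: measurable_cong_sets)
    have distr_U: "distr ?N borel (?U i) = ?P" if "i \<in> {1..m}" for i
    proof -
      have "distr ?N borel (?U i) = distr ?N ?P (?U i)" by (rule distr_cong) simp_all
      also have "\<dots> = ?P" using that by (intro distr_PiM_component P.prob_space_axioms)
      finally show ?thesis .
    qed
    have indep: "N.indep_vars (\<lambda>_. borel) ?U {1..m}"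
    proof (subst N.indep_vars_iff_distr_eq_PiM')
      show "{1..m} \<noteq> {}" using m by simp
      show "N.random_variable borel (?U i)" if "i \<in> {1..m}" for i using rv[OF that] .
      \<comment> \<open>Points of the product space are already extensional on {1..m}, so
        restriction acts as the identity and the joint law is the product measure itself.\<close>
      have "distr ?N (Pi\<^sub>M {1..m} (\<lambda>_. borel)) (\<lambda>\<omega>. \<lambda>i\<in>{1..m}. \<omega> i) = distr ?N ?N (\<lambda>\<omega>. \<omega>)"
        using sets_N by (intro distr_cong) (auto simp: space_PiM PiE_def extensional_restrict)
      also have "\<dots> = ?N" by (rule distr_id2) simp
      also have "\<dots> = Pi\<^sub>M {1..m} (\<lambda>i. distr ?N borel (?U i))"
        by (intro PiM_cong refl distr_U[symmetric])
      finally show "distr ?N (Pi\<^sub>M {1..m} (\<lambda>_. borel)) (\<lambda>\<omega>. \<lambda>i\<in>{1..m}. \<omega> i) = Pi\<^sub>M {1..m} (\<lambda>i. distr ?N borel (?U i))" .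
    qed
    let ?D = "\<lambda>x. \<integral>\<^sup>+y. gamma_mixture ?q a r (x + y) * gamma_mixture ?q b s y \<partial>lborel"
    let ?f = "summand_density \<mu>\<^sub>X \<mu>\<^sub>Y \<sigma>\<^sub>X \<sigma>\<^sub>Y \<rho> ?q"
    have f: "?f x = enn2ereal (?D x)" if "x \<noteq> 0" for x
      unfolding a_def b_def r_def s_def by (rule summand_density_eq[OF assms(2-5) q that])
    \<comment> \<open>The value at 0 may be infinite and is not computed; changing a measurable
      function at one point preserves measurability.\<close>
    have "(\<lambda>x. e2ennreal (?f x)) = (\<lambda>x. if x = 0 then e2ennreal (?f 0) else ?D x)"
      using f by auto
    then have meas: "(\<lambda>x. e2ennreal (?f x)) \<in> borel_measurable borel" by simp
    have "AE x in lborel. ?D x = e2ennreal (?f x)"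
      using f by (intro eventually_mono[OF AE_lborel_singleton[of 0]]) simp
    then have dens: "?P = density lborel (\<lambda>x. e2ennreal (?f x))"
      unfolding chisq_difference_density[OF pos q] using meas by (intro density_cong) simp_all
    have "has_pdf ?N (?U i) ?f" if i: "i \<in> {1..m}" for i
      unfolding has_pdf_def distributed_def
    proof (intro conjI)
      show "AE x in lborel. 0 \<le> ?f x"
        using f by (intro eventually_mono[OF AE_lborel_singleton[of 0]]) simp
      have "distr ?N lborel (?U i) = distr ?N borel (?U i)" by (rule distr_cong) simp_all
      then show "distr ?N lborel (?U i) = density lborel (\<lambda>x. e2ennreal (?f x))"
        using distr_U[OF i] dens by simp
    qed (use meas rv[OF i] in simp_all)
    moreover have "distr M borel Z = distr ?N borel (\<lambda>\<omega>. \<Sum>i = 1..m. ?U i \<omega>)"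
      unfolding Z using N.distr_sum_chisq_difference[OF pos q _ _ indep distr_U] m by simp
    ultimately show ?thesis using N.prob_space_axioms indep distr_U by blast
  qed
  have "infinitely_divisible (distr M borel Z)"
    unfolding infinitely_divisible_def
  proof (intro allI impI)
    fix m :: nat assume m: "1 \<le> m"
    then have "1 \<in> {1..m}" by simp
    with main[OF m] show "\<exists>(N :: (nat \<Rightarrow> real) measure) V. prob_space N \<and>
          prob_space.indep_vars N (\<lambda>_. borel) V {1..m} \<and>
          (\<forall>i\<in>{1..m}. distr N borel (V i) = distr N borel (V 1)) \<and>
          distr M borel Z = distr N borel (\<lambda>\<omega>. \<Sum>i = 1..m. V i \<omega>)" by metis
  qed
  moreover have "\<forall>m::nat. 1 \<le> m \<longrightarrow>
            (\<exists>(N :: (nat \<Rightarrow> real) measure) U.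
               prob_space N \<and>
               prob_space.indep_vars N (\<lambda>_. borel) U {1..m} \<and>
               (\<forall>i\<in>{1..m}.
                  has_pdf N (U i) (summand_density \<mu>\<^sub>X \<mu>\<^sub>Y \<sigma>\<^sub>X \<sigma>\<^sub>Y \<rho> (1 / real m))) \<and>
               distr M borel Z = distr N borel (\<lambda>\<omega>. \<Sum>i = 1..m. U i \<omega>))"
    using main by metis
  ultimately show ?thesis by (rule conjI[rotated])
qed

end
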